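(* Let $\mu_0$ be a given measure on $\mathbb{R}_+$ and consider the kinetic equation (defined in the context). Let $\varphi(\omega)=\omega+1$ and assume that $K$ is a sub-multiplicative model kernel, i.e. a model kernel with $K(\omega_1,\omega_2,\omega_3)\le \varphi(\omega_1)\varphi(\omega_2)\varphi(\omega_3)$. Assume further that $\langle\varphi,\mu_0\rangle<\infty$. (1) If $(\mu_t)_{t<T}$ and $(\nu_t)_{t<T}$ are local solutions starting from $\mu_0$, and if $(\nu_t)_{t<T}$ is strong, then $\mu_t=\nu_t$ for all $t<T$. (2) Moreover, any strong solution is conservative. (3) Also, if $\langle\varphi^2,\mu_0\rangle<\infty$, then there exists a unique maximal strong solution $(\mu_t)_{t<\zeta(\mu_0)}$ with $$\zeta(\mu_0)=\langle\varphi^2,\mu_0\rangle^{-1}\langle\varphi,\mu_0\rangle^{-1}.$$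
   Context: $\mathbb{R}_+=[0,\infty)$, $\langle f,\mu\rangle=\int f\,d\mu$, and $D=\{(\omega_1,\omega_2,\omega_3)\in\mathbb{R}_+^3:\omega_1+\omega_2\ge\omega_3\}$. Model kernel: a continuous function $K:\mathbb{R}_+^3\to\mathbb{R}_+$, homogeneous of degree $\lambda$, with $K(\omega_1,\omega_2,\omega_3)=K(\omega_2,\omega_1,\omega_3)$ for all $(\omega_1,\omega_2,\omega_3)\in\mathbb{R}_+^3$. Kinetic equation (weak isotropic 4-wave kinetic equation): $\mu_t=\mu_0+\int_0^tQ(\mu_s,\mu_s,\mu_s)\,ds$, where for bounded measurable $f$ of bounded support on $\mathbb{R}_+$ $$\langle f,Q(\mu,\mu,\mu)\rangle=\tfrac12\int_D\mu(d\omega_1)\mu(d\omega_2)\mu(d\omega_3)\,K(\omega_1,\omega_2,\omega_3)\,[f(\omega_1+\omega_2-\omega_3)+f(\omega_3)-f(\omega_2)-f(\omega_1)].$$ Solutions: a family $(\mu_t)_{t<T}$ of measures on $\mathbb{R}_+$ is a local solution if it satisfies the equation for all bounded measurable functions $f$ of bounded support and if $\langle\omega,\mu_t\rangle\le\langle\omega,\mu_0\rangle$ and $\langle\varphi,\mu_t\rangle\le\langle\varphi,\mu_0\rangle$ for all $t<T$. If $T=+\infty$ it is called a solution. It is conservative if $\int_0^\infty\omega\,\mu_t(d\omega)$ is finite and constant in $t$. A strong solution is any local solution $(\mu_t)_{t<T}$ with $\int_0^t\langle\varphi^2,\mu_s\rangle\,ds<\infty$ for all $t<T$. The word "maximal"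 in (3) is used by the author without a further definition.
   Formalization: In (3), the lifetime of the maximal (non-extendable) strong solution is shown to be at least ζ(μ_0), not equal to it (equality fails for K=0, where constant μ_t=μ_0 is strong for all time); existence and uniqueness of the strong solution on [0,ζ(μ_0)) are proved. *)

theory Defs
  imports "HOL-Probability.Probability"
begin

text \<open>
  A measure on \<open>[0,\<infinity>)\<close> is rendered as a Borel measure on the reals giving no mass to the
  negative half-line.
\<close>

definition measure_on_Rplus :: "real measure \<Rightarrow> bool" where
  "measure_on_Rplus \<mu> \<longleftrightarrow> sets \<mu> = sets borel \<and> emeasure \<mu> {..<0} = 0"

text \<open>\<open>\<langle>g, \<mu>\<rangle>\<close> for nonnegative \<open>g\<close>, possibly infinite.\<close>

definition moment :: "(real \<Rightarrow> real) \<Rightarrow> real measure \<Rightarrow> ennreal" where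
  "moment g \<mu> = (\<integral>\<^sup>+ x. ennreal (g x) \<partial>\<mu>)"

definition phi :: "real \<Rightarrow> real" where
  "phi x = x + 1"

text \<open>Kernels are total functions; only their values on \<open>[0,\<infinity>)\<^sup>3\<close> are constrained or used.\<close>

definition model_kernel :: "real \<Rightarrow> (real \<Rightarrow> real \<Rightarrow> real \<Rightarrow> real) \<Rightarrow> bool" where
  "model_kernel lam K \<longleftrightarrow>
     continuous_on ({0..} \<times> {0..} \<times> {0..}) (\<lambda>(x, y, z). K x y z) \<and>
     (\<forall>x\<ge>0. \<forall>y\<ge>0. \<forall>z\<ge>0. K x y z \<ge> 0) \<and>
     (\<forall>c>0. \<forall>x\<ge>0. \<forall>y\<ge>0. \<forall>z\<ge>0. K (c * x) (c * y) (c * z) = c powr lam * K x y z) \<and>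
     (\<forall>x\<ge>0. \<forall>y\<ge>0. \<forall>z\<ge>0. K x y z = K y x z)"

definition sub_multiplicative :: "(real \<Rightarrow> real \<Rightarrow> real \<Rightarrow> real) \<Rightarrow> bool" where
  "sub_multiplicative K \<longleftrightarrow>
     (\<forall>x\<ge>0. \<forall>y\<ge>0. \<forall>z\<ge>0. K x y z \<le> phi x * phi y * phi z)"

definition dom_D :: "(real \<times> real \<times> real) set" where
  "dom_D = {(x, y, z). 0 \<le> x \<and> 0 \<le> y \<and> 0 \<le> z \<and> z \<le> x + y}"

text \<open>
  The pairing \<open>\<langle>f, Q(\<mu>,\<mu>,\<mu>)\<rangle>\<close>. It is used only for finite \<open>\<langle>phi, \<mu>\<rangle>\<close>, bounded \<open>f\<close> and
  \<open>K \<le> phi phi phi\<close>, where \<open>\<mu>\<close> is finite and the integral converges absolutely.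
\<close>

definition Q_pair ::
  "(real \<Rightarrow> real \<Rightarrow> real \<Rightarrow> real) \<Rightarrow> real measure \<Rightarrow> (real \<Rightarrow> real) \<Rightarrow> real" where
  "Q_pair K \<mu> f =
     1 / 2 * (LINT (x, y, z) : dom_D | \<mu> \<Otimes>\<^sub>M (\<mu> \<Otimes>\<^sub>M \<mu>).
       K x y z * (f (x + y - z) + f z - f y - f x))"

definition test_function :: "(real \<Rightarrow> real) \<Rightarrow> bool" where
  "test_function f \<longleftrightarrow>
     f \<in> borel_measurable borel \<and> (\<exists>C. \<forall>x. \<bar>f x\<bar> \<le> C) \<and> (\<exists>R. \<forall>x. \<bar>x\<bar> > R \<longrightarrow> f x = 0)"

text \<open>The interval \<open>[0,T)\<close>, where \<open>T\<close> may be infinite.\<close>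

definition times :: "ennreal \<Rightarrow> real set" where
  "times T = {t. 0 \<le> t \<and> ennreal t < T}"

text \<open>
  Integrability in time is part of what it means to satisfy the equation: the Bochner integral
  of a function that is not integrable is 0 by convention.
\<close>

definition satisfies_kinetic_eq ::
  "(real \<Rightarrow> real \<Rightarrow> real \<Rightarrow> real) \<Rightarrow> real measure \<Rightarrow> ennreal \<Rightarrow> (real \<Rightarrow> real measure) \<Rightarrow> bool" where
  "satisfies_kinetic_eq K \<mu>0 T \<mu> \<longleftrightarrow>
     (\<forall>f. test_function f \<longrightarrow> (\<forall>t\<in>times T.
        set_integrable lborel {0..t} (\<lambda>s. Q_pair K (\<mu> s) f) \<and>
        (LINT x | \<mu> t. f x) = (LINT x | \<mu>0. f x) + (LINT s : {0..t} | lborel. Q_pair K (\<mu> s) f)))"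

definition local_solution ::
  "(real \<Rightarrow> real \<Rightarrow> real \<Rightarrow> real) \<Rightarrow> real measure \<Rightarrow> ennreal \<Rightarrow> (real \<Rightarrow> real measure) \<Rightarrow> bool" where
  "local_solution K \<mu>0 T \<mu> \<longleftrightarrow>
     0 < T \<and>
     (\<forall>t\<in>times T. measure_on_Rplus (\<mu> t)) \<and>
     satisfies_kinetic_eq K \<mu>0 T \<mu> \<and>
     (\<forall>t\<in>times T. moment (\<lambda>x. x) (\<mu> t) \<le> moment (\<lambda>x. x) \<mu>0 \<and>
                  moment phi (\<mu> t) \<le> moment phi \<mu>0)"

definition strong_solution ::
  "(real \<Rightarrow> real \<Rightarrow> real \<Rightarrow> real) \<Rightarrow> real measure \<Rightarrow> ennreal \<Rightarrow> (real \<Rightarrow> real measure) \<Rightarrow> bool" where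
  "strong_solution K \<mu>0 T \<mu> \<longleftrightarrow>
     local_solution K \<mu>0 T \<mu> \<and>
     (\<forall>t\<in>times T. (\<integral>\<^sup>+ s\<in>{0..t}. moment (\<lambda>x. (phi x)\<^sup>2) (\<mu> s) \<partial>lborel) < \<infinity>)"

definition conservative :: "ennreal \<Rightarrow> (real \<Rightarrow> real measure) \<Rightarrow> bool" where
  "conservative T \<mu> \<longleftrightarrow>
     (\<exists>c<\<infinity>. \<forall>t\<in>times T. moment (\<lambda>x. x) (\<mu> t) = c)"

text \<open>
  Families are total functions of time; two families on \<open>[0,T)\<close> are identified when they agree
  there.
\<close>

definition agree_on :: "ennreal \<Rightarrow> (real \<Rightarrow> real measure) \<Rightarrow> (real \<Rightarrow> real measure) \<Rightarrow> bool" where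
  "agree_on T \<mu> \<nu> \<longleftrightarrow> (\<forall>t\<in>times T. \<mu> t = \<nu> t)"

text \<open>A strong solution is maximal if no strong solution properly extends it.\<close>

definition maximal_strong_solution ::
  "(real \<Rightarrow> real \<Rightarrow> real \<Rightarrow> real) \<Rightarrow> real measure \<Rightarrow> ennreal \<Rightarrow> (real \<Rightarrow> real measure) \<Rightarrow> bool" where
  "maximal_strong_solution K \<mu>0 T \<mu> \<longleftrightarrow>
     strong_solution K \<mu>0 T \<mu> \<and>
     (\<forall>T' \<nu>. strong_solution K \<mu>0 T' \<nu> \<and> T \<le> T' \<and> agree_on T \<mu> \<nu> \<longrightarrow> T' = T)"

text \<open>
  The value is infinite exactly for the zero measure. It need not be the lifetime of the
  maximal strong solution: for \<open>K = 0\<close> the constant family is strong on \<open>[0,\<infinity>)\<close>.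
\<close>

definition zeta :: "real measure \<Rightarrow> ennreal" where
  "zeta \<mu>0 = inverse (moment (\<lambda>x. (phi x)\<^sup>2) \<mu>0) * inverse (moment phi \<mu>0)"

end

theory Submission
  imports Defs
begin

text \<open>
  Everything rests on one estimate for \<open>\<langle>\<phi>, (\<nu> - \<mu>)\<^sup>+\<rangle>\<close>. Expand \<open>\<nu>\<nu>\<nu> - \<mu>\<mu>\<mu>\<close>: the gain terms
  are controlled by \<open>\<nu>\<close> alone since \<open>\<mu> \<ge> \<nu> - (\<nu> - \<mu>)\<^sup>+\<close>, and the loss terms are tested only where
  \<open>\<mu> \<le> \<nu>\<close>; the dangerous contribution \<open>\<langle>\<phi>\<^sup>2, (\<nu> - \<mu>)\<^sup>+\<rangle>\<close> cancels between gain and loss. Hence the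
  growth rate is at most a multiple of \<open>\<langle>\<phi>\<^sup>2, \<nu>\<rangle> \<langle>\<phi>, \<bar>\<nu> - \<mu>\<bar>\<rangle>\<close>, with no second moment of \<open>\<mu>\<close>.
  The collision bracket vanishes on affine functions, so a strong solution \<open>\<nu>\<close> conserves
  \<open>\<langle>\<phi>, \<cdot>\<rangle>\<close>, whereas \<open>\<mu>\<close> does not increase it; therefore
  \<open>\<langle>\<phi>, \<bar>\<nu> - \<mu>\<bar>\<rangle> \<le> 2 \<langle>\<phi>, (\<nu> - \<mu>)\<^sup>+\<rangle>\<close> and Gronwall's lemma yields uniqueness.

  For existence, the same estimate with small errors makes the Euler polygons of truncated kernels
  and truncated initial data a Cauchy sequence in \<open>\<phi>\<close>-weighted total variation, as long as their second
  moments stay bounded. The bracket of \<open>\<phi>\<^sup>2\<close> is at most \<open>2 \<phi>(\<omega>\<^sub>1) \<phi>(\<omega>\<^sub>2)\<close>, so the second moment \<open>m\<close> obeys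
  \<open>m' \<le> \<langle>\<phi>, \<mu>\<^sub>0\<rangle> m\<^sup>2\<close>, which cannot blow up before \<open>\<zeta>(\<mu>\<^sub>0)\<close>. Gluing all strong solutions along
  uniqueness produces the maximal one.
\<close>


section \<open>Measures on the half-line and the collision integral\<close>

text \<open>The equation only sees test functions of bounded support, and no measure is at hand that
  dominates all times, so the Hahn set of the current time is not a fixed test set. Every comparison
  is therefore made for two measures at a time, with a common density for just these two, and
  \<open>excess\<close>, a supremum over test functions, transports the result in time. Two limits
  are taken in a fixed order: the time mesh goes to zero while the cutoff radius \<open>R\<close> is
  fixed, because the error constants grow with \<open>R\<close>; then \<open>R\<close> tends to
  infinity, which costs only the tail of the second moment of \<open>\<nu>\<close>. In the existence
  part the truncation error of the kernel is governed by a third moment, which may be infinite for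
  the initial measure. Cutting the initial measure makes it finite. Since the kernel cutoff
  \<open>N\<close> and the time step \<open>h\<close> are chosen after that cut, the third moments
  need not be bounded uniformly in the cut.\<close>

text \<open>\<open>wt\<close> agrees with \<open>phi\<close> on \<open>[0,\<infinity>)\<close> but is at least \<open>1\<close> on the whole line, so that pointwise
  estimates carry no side conditions.\<close>

definition wt :: "real \<Rightarrow> real" where "wt x = 1 + \<bar>x\<bar>"

lemma wt_ge_1 [simp]: "1 \<le> wt x" and wt_pos [simp]: "0 < wt x" and wt_nonneg [simp]: "0 \<le> wt x"
  by (simp_all add: wt_def)

lemma wt_measurable [measurable]: "wt \<in> borel_measurable borel"
  unfolding wt_def by measurable

lemma wt_eq_phi: "0 \<le> x \<Longrightarrow> wt x = phi x"
  by (simp add: wt_def phi_def)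

text \<open>One radius \<open>c\<close> serves all measures that are compared, so that estimates can
  be stated with a single constant. The condition \<open>0 \<le> c\<close> belongs to the class
  since \<open>ennreal\<close> sends negative numbers to \<open>0\<close>.\<close>

definition wclass :: "real \<Rightarrow> real measure \<Rightarrow> bool" where
  "wclass c \<mu> \<longleftrightarrow> measure_on_Rplus \<mu> \<and> (\<integral>\<^sup>+x. ennreal (wt x) \<partial>\<mu>) \<le> ennreal c \<and> 0 \<le> c"

definition gain_loss :: "(real \<Rightarrow> real) \<Rightarrow> real \<Rightarrow> real \<Rightarrow> real \<Rightarrow> real" where
  "gain_loss f x y z = f (x + y - z) + f z - f y - f x"

definition restr :: "(real \<Rightarrow> real \<Rightarrow> real \<Rightarrow> real) \<Rightarrow> real \<Rightarrow> real \<Rightarrow> real \<Rightarrow> real" where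
  "restr K x y z = indicator dom_D (x, y, z) * K x y z"

text \<open>The form in which kernels enter all estimates. Measurability and the product bound on
  \<open>dom_D\<close> survive the sharp truncation of the Euler scheme.\<close>

definition admissible :: "(real \<Rightarrow> real \<Rightarrow> real \<Rightarrow> real) \<Rightarrow> bool" where
  "admissible K \<longleftrightarrow> (\<lambda>(x, y, z). restr K x y z) \<in> borel_measurable (borel \<Otimes>\<^sub>M (borel \<Otimes>\<^sub>M borel)) \<and>
     (\<forall>x y z. 0 \<le> restr K x y z \<and> restr K x y z \<le> wt x * wt y * wt z)"

abbreviation triple :: "real measure \<Rightarrow> (real \<times> real \<times> real) measure" where
  "triple \<mu> \<equiv> \<mu> \<Otimes>\<^sub>M (\<mu> \<Otimes>\<^sub>M \<mu>)"

lemma Q_pair_eq: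
  "Q_pair K \<mu> f = 1 / 2 * (LINT (x, y, z) | triple \<mu>. restr K x y z * gain_loss f x y z)"
  unfolding Q_pair_def set_lebesgue_integral_def restr_def gain_loss_def
  by (intro arg_cong2[where f="(*)"] Bochner_Integration.integral_cong refl) (auto simp: algebra_simps)

lemma AE_nonneg:
  assumes "measure_on_Rplus \<mu>"
  shows "AE x in \<mu>. 0 \<le> x"
proof (rule AE_I)
  show "{x \<in> space \<mu>. \<not> 0 \<le> x} \<subseteq> {..<0}" by auto
qed (use assms in \<open>auto simp: measure_on_Rplus_def\<close>)

lemma nn_wt_eq_moment:
  assumes "measure_on_Rplus \<mu>"
  shows "(\<integral>\<^sup>+x. ennreal (wt x) \<partial>\<mu>) = moment phi \<mu>"
  unfolding moment_def
  using AE_nonneg[OF assms] by (intro nn_integral_cong_AE) (auto simp: wt_eq_phi)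

context
  fixes c :: real and \<mu> :: "real measure"
  assumes wc: "wclass c \<mu>"
begin

lemma wclass_sets [measurable_cong]: "sets \<mu> = sets borel"
  using wc by (simp add: wclass_def measure_on_Rplus_def)

lemma wclass_space: "space \<mu> = UNIV"
  using sets_eq_imp_space_eq[OF wclass_sets] by simp

lemma wclass_AE: "AE x in \<mu>. 0 \<le> x"
  using wc AE_nonneg by (simp add: wclass_def)

lemma wclass_integrable_wt: "integrable \<mu> wt"
  by (rule integrableI_nonneg) (use wc in \<open>auto simp: wclass_def intro: le_less_trans\<close>)

lemma wclass_integral_wt: "(LINT x|\<mu>. wt x) \<le> c"
proof -
  have "ennreal (LINT x|\<mu>. wt x) = (\<integral>\<^sup>+x. ennreal (wt x) \<partial>\<mu>)"
    by (rule nn_integral_eq_integral[symmetric, OF wclass_integrable_wt]) simp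
  also have "\<dots> \<le> ennreal c" using wc by (simp add: wclass_def)
  finally show ?thesis using wc by (simp add: wclass_def)
qed

lemma wclass_c_nonneg: "0 \<le> c" using wc by (simp add: wclass_def)

lemma wclass_integrable:
  assumes "f \<in> borel_measurable borel" "\<And>x. \<bar>f x\<bar> \<le> C * wt x"
  shows "integrable \<mu> f"
proof (rule Bochner_Integration.integrable_bound[where f="\<lambda>x. C * wt x"])
  show "integrable \<mu> (\<lambda>x. C * wt x)" using wclass_integrable_wt by simp
  show "f \<in> borel_measurable \<mu>" using assms(1) by simp
  show "AE x in \<mu>. norm (f x) \<le> norm (C * wt x)"
    using assms(2) abs_ge_self order_trans by (auto intro!: AE_I2) blast
qed

lemma wclass_finite: "finite_measure \<mu>"
proof
  have "integrable \<mu> (\<lambda>x. 1::real)" by (rule wclass_integrable[where C=1]) auto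
  then have "integrable \<mu> (indicator (space \<mu>) :: real \<Rightarrow> real)"
    by (rule Bochner_Integration.integrable_cong[THEN iffD1, rotated -1]) auto
  then show "emeasure \<mu> (space \<mu>) \<noteq> \<infinity>" by (simp add: integrable_indicator_iff)
qed

end

text \<open>The Radon-Nikodym derivatives are made real-valued and nonnegative at every point, so
  that later estimates on densities hold everywhere and not only almost everywhere.\<close>

lemma common_density:
  fixes \<mu> \<nu> :: "real measure"
  assumes "wclass c \<mu>" "wclass d \<nu>"
  obtains m u v where "finite_measure m" "sets m = sets borel"
    "u \<in> borel_measurable borel" "v \<in> borel_measurable borel"
    "\<And>x. 0 \<le> u x" "\<And>x. 0 \<le> v x"
    "\<mu> = density m (\<lambda>x. ennreal (u x))" "\<nu> = density m (\<lambda>x. ennreal (v x))"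
proof -
  interpret mu: finite_measure \<mu> using assms(1) by (rule wclass_finite)
  interpret nu: finite_measure \<nu> using assms(2) by (rule wclass_finite)
  have s: "sets \<mu> = sets borel" "sets \<nu> = sets borel" using wclass_sets assms by auto
  \<comment> \<open>The lattice supremum dominates both measures set by set, and its total mass is
    at most the sum of theirs, which keeps it finite.\<close>
  define m where "m = sup_measure' \<mu> \<nu>"
  have sm: "sets m = sets borel" by (simp add: m_def s)
  have le: "emeasure \<mu> X \<le> emeasure m X" "emeasure \<nu> X \<le> emeasure m X" if "X \<in> sets borel" for X
    unfolding m_def using that le_emeasure_sup_measure'1[of \<nu> \<mu> X] le_emeasure_sup_measure'2[of \<nu> \<mu> X] s by auto
  have "emeasure m UNIV \<le> emeasure \<mu> UNIV + emeasure \<nu> UNIV"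
    unfolding m_def by (subst emeasure_sup_measure')
      (auto simp: s intro!: SUP_least add_mono emeasure_mono)
  also have "\<dots> < \<infinity>" using mu.emeasure_finite[of UNIV] nu.emeasure_finite[of UNIV] by (simp add: less_top[symmetric])
  finally have fm: "finite_measure m"
    using sets_eq_imp_space_eq[OF sm] by (auto intro!: finite_measureI)
  interpret m: finite_measure m by fact
  have ex: "\<exists>f. f \<in> borel_measurable borel \<and> (\<forall>x. 0 \<le> f x) \<and> \<kappa> = density m (\<lambda>x. ennreal (f x))"
    if fk: "finite_measure \<kappa>" and sk: "sets \<kappa> = sets borel"
      and lek: "\<And>X. X \<in> sets borel \<Longrightarrow> emeasure \<kappa> X \<le> emeasure m X" for \<kappa> :: "real measure"
  proof -
    interpret k: finite_measure \<kappa> by fact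
    have ac: "absolutely_continuous m \<kappa>"
      unfolding absolutely_continuous_def null_sets_def using lek sm sk
      by auto (metis le_zero_eq)
    obtain f where f: "f \<in> borel_measurable m" "\<And>x. x \<in> space m \<Longrightarrow> 0 \<le> f x"
      "density m (\<lambda>x. ennreal (f x)) = \<kappa>"
    proof -
      have "AE x in m. RN_deriv m \<kappa> x \<noteq> \<infinity>"
        by (rule m.RN_deriv_finite) (use ac sm sk in \<open>auto intro: k.sigma_finite_measure_axioms\<close>)
      then have "density m (\<lambda>x. ennreal (enn2real (RN_deriv m \<kappa> x))) = density m (RN_deriv m \<kappa>)"
        by (intro density_cong) (auto simp: less_top)
      also have "\<dots> = \<kappa>" by (rule m.density_RN_deriv) (use ac sm sk in auto)
      finally show ?thesis by (intro that[of "\<lambda>x. enn2real (RN_deriv m \<kappa> x)"]) auto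
    qed
    moreover have "space m = UNIV" using sets_eq_imp_space_eq[OF sm] by simp
    moreover have "f \<in> borel_measurable borel" using f(1) sm measurable_cong_sets by blast
    ultimately show ?thesis by auto
  qed
  obtain u v where "u \<in> borel_measurable borel \<and> (\<forall>x. 0 \<le> u x) \<and> \<mu> = density m (\<lambda>x. ennreal (u x))"
    "v \<in> borel_measurable borel \<and> (\<forall>x. 0 \<le> v x) \<and> \<nu> = density m (\<lambda>x. ennreal (v x))"
    using ex[of \<mu>] ex[of \<nu>] le s mu.finite_measure_axioms nu.finite_measure_axioms by metis
  with fm sm that show thesis by blast
qed

lemma triple_density:
  fixes m :: "real measure"
  assumes "finite_measure m" "sets m = sets borel" "u \<in> borel_measurable borel"
    "\<And>x. 0 \<le> u x" "finite_measure (density m (\<lambda>x. ennreal (u x)))"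
  shows "triple (density m (\<lambda>x. ennreal (u x))) = density (triple m) (\<lambda>(x, y, z). ennreal (u x * u y * u z))"
proof -
  interpret m: finite_measure m by fact
  interpret d: finite_measure "density m (\<lambda>x. ennreal (u x))" by fact
  interpret pd: pair_sigma_finite "density m (\<lambda>x. ennreal (u x))" "density m (\<lambda>x. ennreal (u x))" ..
  interpret pm: pair_sigma_finite m m ..
  have [measurable]: "u \<in> borel_measurable m" using assms(2,3) measurable_cong_sets by blast
  have 1: "density m (\<lambda>x. ennreal (u x)) \<Otimes>\<^sub>M density m (\<lambda>x. ennreal (u x))
    = density (m \<Otimes>\<^sub>M m) (\<lambda>(x, y). ennreal (u x) * ennreal (u y))"
    by (rule pair_measure_density)
      (auto intro: m.sigma_finite_measure_axioms d.sigma_finite_measure_axioms)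
  have "triple (density m (\<lambda>x. ennreal (u x))) =
    density (triple m) (\<lambda>(x, p). ennreal (u x) * (case p of (y, z) \<Rightarrow> ennreal (u y) * ennreal (u z)))"
    unfolding 1
    by (rule pair_measure_density) (auto simp: pm.sigma_finite_measure_axioms 1[symmetric] pd.sigma_finite_measure_axioms)
  also have "\<dots> = density (triple m) (\<lambda>(x, y, z). ennreal (u x * u y * u z))"
    using assms(4) by (intro density_cong) (auto simp: ennreal_mult mult_ac)
  finally show ?thesis .
qed

lemma triple_product:
  fixes m :: "real measure" and p q r :: "real \<Rightarrow> real"
  assumes "sigma_finite_measure m" and p: "integrable m p" and q: "integrable m q" and r: "integrable m r"
  shows "integrable (triple m) (\<lambda>(x, y, z). p x * q y * r z)"
    and "(LINT (x, y, z) | triple m. p x * q y * r z) = (LINT x|m. p x) * (LINT x|m. q x) * (LINT x|m. r x)"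
proof -
  interpret m: sigma_finite_measure m by fact
  interpret pm: pair_sigma_finite m m ..
  interpret pm3: pair_sigma_finite m "m \<Otimes>\<^sub>M m" ..
  have [measurable]: "p \<in> borel_measurable m" "q \<in> borel_measurable m" "r \<in> borel_measurable m"
    using p q r by auto
  have i2: "integrable (m \<Otimes>\<^sub>M m) (\<lambda>(y, z). q y * r z)"
    by (rule pm.Fubini_integrable) (use q r in \<open>auto simp: abs_mult\<close>)
  have v2: "(LINT (y, z) | (m \<Otimes>\<^sub>M m). q y * r z) = (LINT x|m. q x) * (LINT x|m. r x)"
    by (subst pm.integral_fst'[OF i2, symmetric]) simp
  have i3: "integrable (triple m) (\<lambda>(x, w). p x * (case w of (y, z) \<Rightarrow> q y * r z))"
    by (rule pm3.Fubini_integrable) (use p i2 in \<open>auto simp: abs_mult\<close>)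
  have v3: "(LINT (x, w) | triple m. p x * (case w of (y, z) \<Rightarrow> q y * r z)) = (LINT x|m. p x) * (LINT (y, z) | (m \<Otimes>\<^sub>M m). q y * r z)"
    by (subst pm3.integral_fst'[OF i3, symmetric]) simp
  have eq: "(\<lambda>(x, w). p x * (case w of (y, z) \<Rightarrow> q y * r z)) = (\<lambda>(x, y, z). p x * q y * r z)"
    by (auto simp: fun_eq_iff)
  show "integrable (triple m) (\<lambda>(x, y, z). p x * q y * r z)" using i3 unfolding eq .
  show "(LINT (x, y, z) | triple m. p x * q y * r z) = (LINT x|m. p x) * (LINT x|m. q x) * (LINT x|m. r x)"
    using v3 v2 unfolding eq by simp
qed

section \<open>Pairs of measures with common densities\<close>

lemma abs_prod3_diff:
  fixes a1 a2 a3 b1 b2 b3 :: real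
  assumes "0 \<le> a1" "0 \<le> a2" "0 \<le> a3" "0 \<le> b1" "0 \<le> b2" "0 \<le> b3"
  shows "\<bar>b1 * b2 * b3 - a1 * a2 * a3\<bar> \<le> \<bar>b1 - a1\<bar> * b2 * b3 + a1 * \<bar>b2 - a2\<bar> * b3 + a1 * a2 * \<bar>b3 - a3\<bar>"
proof -
  have "b1 * b2 * b3 - a1 * a2 * a3 = (b1 - a1) * b2 * b3 + a1 * (b2 - a2) * b3 + a1 * a2 * (b3 - a3)"
    by (simp add: algebra_simps)
  also have "\<bar>\<dots>\<bar> \<le> \<bar>(b1 - a1) * b2 * b3\<bar> + \<bar>a1 * (b2 - a2) * b3\<bar> + \<bar>a1 * a2 * (b3 - a3)\<bar>"
    by linarith
  finally show ?thesis using assms by (simp add: abs_mult)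
qed

text \<open>Turns arguments about the signed measure \<open>\<nu> - \<mu>\<close> into pointwise
  inequalities between \<open>u\<close> and \<open>v\<close>: the difference of two collision
  integrals becomes one integral over \<open>triple m\<close> with the factor
  \<open>v x * v y * v z - u x * u y * u z\<close>.\<close>

locale density_pair =
  fixes c :: real and \<mu> \<nu> m :: "real measure" and u v :: "real \<Rightarrow> real"
  assumes class_mu: "wclass c \<mu>" and class_nu: "wclass c \<nu>"
    and finite_m: "finite_measure m" and sets_m: "sets m = sets borel"
    and u_meas [measurable]: "u \<in> borel_measurable borel" and v_meas [measurable]: "v \<in> borel_measurable borel"
    and u_nonneg [simp]: "\<And>x. 0 \<le> u x" and v_nonneg [simp]: "\<And>x. 0 \<le> v x"
    and mu_eq: "\<mu> = density m (\<lambda>x. ennreal (u x))" and nu_eq: "\<nu> = density m (\<lambda>x. ennreal (v x))"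

lemma density_pair_exists:
  assumes "wclass c \<mu>" "wclass c \<nu>"
  obtains m u v where "density_pair c \<mu> \<nu> m u v"
proof -
  obtain m u v where "finite_measure m" "sets m = sets borel"
    "u \<in> borel_measurable borel" "v \<in> borel_measurable borel"
    "\<And>x. 0 \<le> u x" "\<And>x. 0 \<le> v x"
    "\<mu> = density m (\<lambda>x. ennreal (u x))" "\<nu> = density m (\<lambda>x. ennreal (v x))"
    using common_density[OF assms] by blast
  then show thesis using assms by (intro that[of m u v]) (simp add: density_pair_def)
qed

lemma (in density_pair) swap: "density_pair c \<nu> \<mu> m v u"
  using density_pair_axioms unfolding density_pair_def by blast

context density_pair
begin

sublocale m: finite_measure m by (rule finite_m)

lemma borel_measurable_m [simp]: "borel_measurable m = borel_measurable borel"
  by (intro measurable_cong_sets sets_m refl)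

lemma integral_mu_density:
  assumes [measurable]: "f \<in> borel_measurable borel"
  shows "integrable \<mu> f \<longleftrightarrow> integrable m (\<lambda>x. u x * f x)"
    and "(LINT x|\<mu>. f x) = (LINT x|m. u x * f x)"
  unfolding mu_eq using integrable_density[of f m u] integral_density[of f m u] by simp_all

lemma integral_nu_density:
  assumes [measurable]: "f \<in> borel_measurable borel"
  shows "integrable \<nu> f \<longleftrightarrow> integrable m (\<lambda>x. v x * f x)"
    and "(LINT x|\<nu>. f x) = (LINT x|m. v x * f x)"
  unfolding nu_eq using integrable_density[of f m v] integral_density[of f m v] by simp_all

lemma has_bochner_mu:
  assumes [measurable]: "f \<in> borel_measurable borel" and "integrable \<mu> f"
  shows "has_bochner_integral m (\<lambda>x. f x * u x) (LINT x|\<mu>. f x)"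
  using assms integral_mu_density[of f] by (simp add: has_bochner_integral_iff mult.commute)

lemma has_bochner_nu:
  assumes [measurable]: "f \<in> borel_measurable borel" and "integrable \<nu> f"
  shows "has_bochner_integral m (\<lambda>x. f x * v x) (LINT x|\<nu>. f x)"
  using assms integral_nu_density[of f] by (simp add: has_bochner_integral_iff mult.commute)

text \<open>Integrability and value travel together in \<open>has_bochner_integral\<close>, so that
  the long sums of product terms below are integrated by plain introduction rules.\<close>

lemma triple_has_bochner:
  assumes "has_bochner_integral m p P" "has_bochner_integral m q Q" "has_bochner_integral m r R"
  shows "has_bochner_integral (triple m) (\<lambda>(x, y, z). p x * q y * r z :: real) (P * Q * R)"
  using assms triple_product[OF m.sigma_finite_measure_axioms, of p q r]
  by (auto simp: has_bochner_integral_iff)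

text \<open>The factor \<open>2\<close> cancels the \<open>1 / 2\<close> in the definition of
  \<open>Q_pair\<close>. The hypothesis \<open>L\<close> dominates the integrand by a product of
  weights, which is integrable by Fubini.\<close>

lemma Q_pair_mu:
  assumes K: "admissible K" and [measurable]: "f \<in> borel_measurable borel"
    and L: "\<And>x y z. \<bar>restr K x y z * gain_loss f x y z\<bar> \<le> L * (wt x * wt y * wt z)"
  shows "has_bochner_integral (triple m)
     (\<lambda>(x, y, z). restr K x y z * gain_loss f x y z * (u x * u y * u z)) (2 * Q_pair K \<mu> f)"
proof -
  let ?g = "\<lambda>(x, y, z). restr K x y z * gain_loss f x y z"
  have [measurable]: "(\<lambda>(x, y, z). restr K x y z) \<in> borel_measurable (borel \<Otimes>\<^sub>M (borel \<Otimes>\<^sub>M borel))"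
    using K by (simp add: admissible_def)
  have gm [measurable]: "?g \<in> borel_measurable (borel \<Otimes>\<^sub>M (borel \<Otimes>\<^sub>M borel))"
  proof -
    have "(\<lambda>p. (case p of (x, y, z) \<Rightarrow> restr K x y z) * gain_loss f (fst p) (fst (snd p)) (snd (snd p)))
      \<in> borel_measurable (borel \<Otimes>\<^sub>M (borel \<Otimes>\<^sub>M borel))"
      unfolding gain_loss_def by measurable
    then show ?thesis by (simp add: case_prod_beta')
  qed
  have ss: "sets (triple m) = sets (borel \<Otimes>\<^sub>M (borel \<Otimes>\<^sub>M borel))"
    by (intro sets_pair_measure_cong sets_m)
  have gm' [measurable]: "?g \<in> borel_measurable (triple m)"
    using gm ss measurable_cong_sets by blast
  have wm: "(\<lambda>p. u (fst p) * u (fst (snd p)) * u (snd (snd p))) \<in> borel_measurable (triple m)"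
    unfolding measurable_cong_sets[OF ss refl] by measurable
  have w: "has_bochner_integral m (\<lambda>x. wt x * u x) (LINT x|\<mu>. wt x)"
    by (rule has_bochner_mu) (auto intro: wclass_integrable_wt[OF class_mu])
  have dom: "integrable (triple m) (\<lambda>(x, y, z). (wt x * u x) * (wt y * u y) * (wt z * u z))"
    using triple_has_bochner[OF w w w] by (simp add: has_bochner_integral_iff)
  have int: "integrable (triple m) (\<lambda>(x, y, z). restr K x y z * gain_loss f x y z * (u x * u y * u z))"
  proof (rule Bochner_Integration.integrable_bound)
    show "integrable (triple m) (\<lambda>p. L * (case p of (x, y, z) \<Rightarrow> (wt x * u x) * (wt y * u y) * (wt z * u z)))"
      using dom by simp
    have "(\<lambda>p. ?g p * (u (fst p) * u (fst (snd p)) * u (snd (snd p)))) \<in> borel_measurable (triple m)"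
      by (rule borel_measurable_times[OF gm' wm])
    then show "(\<lambda>(x, y, z). restr K x y z * gain_loss f x y z * (u x * u y * u z)) \<in> borel_measurable (triple m)"
      by (simp add: case_prod_beta')
    have "\<bar>restr K x y z * gain_loss f x y z * (u x * u y * u z)\<bar> \<le> L * (wt x * wt y * wt z) * (u x * u y * u z)" for x y z
      unfolding abs_mult[of _ "u x * u y * u z"] using L[of x y z] by (intro mult_mono) auto
    moreover have "L * (wt x * wt y * wt z) * (u x * u y * u z) = L * ((wt x * u x) * (wt y * u y) * (wt z * u z))" for x y z
      by (simp only: mult_ac)
    ultimately have "\<bar>restr K x y z * gain_loss f x y z * (u x * u y * u z)\<bar> \<le> L * ((wt x * u x) * (wt y * u y) * (wt z * u z))" for x y z
      by metis
    then have *: "\<bar>restr K x y z * gain_loss f x y z * (u x * u y * u z)\<bar> \<le> \<bar>L * ((wt x * u x) * (wt y * u y) * (wt z * u z))\<bar>" for x y z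
      using order_trans[OF _ abs_ge_self] by metis
    show "AE p in triple m. norm (case p of (x, y, z) \<Rightarrow> restr K x y z * gain_loss f x y z * (u x * u y * u z)) \<le>
       norm (L * (case p of (x, y, z) \<Rightarrow> (wt x * u x) * (wt y * u y) * (wt z * u z)))"
    proof (intro AE_I2)
      fix p :: "real \<times> real \<times> real"
      obtain x y z where [simp]: "p = (x, y, z)" by (metis prod.exhaust)
      show "norm (case p of (x, y, z) \<Rightarrow> restr K x y z * gain_loss f x y z * (u x * u y * u z)) \<le>
         norm (L * (case p of (x, y, z) \<Rightarrow> (wt x * u x) * (wt y * u y) * (wt z * u z)))"
        using *[of x y z] by (simp only: prod.case real_norm_def \<open>p = (x, y, z)\<close>)
    qed
  qed
  have "2 * Q_pair K \<mu> f = (LINT p | density (triple m) (\<lambda>(x, y, z). ennreal (u x * u y * u z)). ?g p)"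
    unfolding Q_pair_eq
    by (subst triple_density[OF finite_m sets_m u_meas u_nonneg, folded mu_eq, OF wclass_finite[OF class_mu]]) simp
  also have "\<dots> = (LINT p | density (triple m) (\<lambda>p. ennreal (u (fst p) * u (fst (snd p)) * u (snd (snd p)))). ?g p)"
    by (simp add: case_prod_beta')
  also have "\<dots> = (LINT p | triple m. (u (fst p) * u (fst (snd p)) * u (snd (snd p))) *\<^sub>R ?g p)"
    by (rule integral_density[OF gm' wm]) simp
  also have "\<dots> = (LINT (x, y, z) | triple m. restr K x y z * gain_loss f x y z * (u x * u y * u z))"
    by (intro Bochner_Integration.integral_cong) (auto simp: mult_ac)
  finally show ?thesis using int by (simp add: has_bochner_integral_iff)
qed

lemma Q_pair_nu:
  assumes "admissible K" "f \<in> borel_measurable borel"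
    "\<And>x y z. \<bar>restr K x y z * gain_loss f x y z\<bar> \<le> L * (wt x * wt y * wt z)"
  shows "has_bochner_integral (triple m)
     (\<lambda>(x, y, z). restr K x y z * gain_loss f x y z * (v x * v y * v z)) (2 * Q_pair K \<nu> f)"
proof -
  interpret s: density_pair c \<nu> \<mu> m v u by (rule swap)
  show ?thesis using assms by (rule s.Q_pair_mu)
qed

text \<open>The \<open>wt\<close>-weighted total variation of \<open>\<nu> - \<mu>\<close>; its
  value does not depend on the choice of \<open>m\<close>.\<close>

definition wdist :: real where "wdist = (LINT x|m. wt x * \<bar>v x - u x\<bar>)"

lemma wdist_has_bochner: "has_bochner_integral m (\<lambda>x. wt x * \<bar>v x - u x\<bar>) wdist"
proof -
  have "integrable m (\<lambda>x. wt x * v x - wt x * u x)"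
    using has_bochner_mu[OF wt_measurable wclass_integrable_wt[OF class_mu]] has_bochner_nu[OF wt_measurable wclass_integrable_wt[OF class_nu]]
    by (auto simp: has_bochner_integral_iff)
  then have "integrable m (\<lambda>x. \<bar>wt x * v x - wt x * u x\<bar>)" by simp
  moreover have "(\<lambda>x. \<bar>wt x * v x - wt x * u x\<bar>) = (\<lambda>x. wt x * \<bar>v x - u x\<bar>)"
    by (auto simp: fun_eq_iff abs_mult right_diff_distrib[symmetric])
  ultimately show ?thesis by (simp add: has_bochner_integral_iff wdist_def)
qed

lemma wdist_nonneg: "0 \<le> wdist"
  unfolding wdist_def by (intro integral_nonneg_AE) auto

text \<open>Replacing the three factors one after the other costs
  \<open>L * c\<^sup>2 * wdist\<close> each time; this gives the \<open>3\<close>, halved by the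
  prefactor of \<open>Q_pair\<close>.\<close>

lemma Q_pair_lipschitz:
  assumes K: "admissible K" and [measurable]: "f \<in> borel_measurable borel"
    and L: "\<And>x y z. \<bar>restr K x y z * gain_loss f x y z\<bar> \<le> L * (wt x * wt y * wt z)"
  shows "\<bar>Q_pair K \<nu> f - Q_pair K \<mu> f\<bar> \<le> 3 / 2 * L * c\<^sup>2 * wdist"
proof -
  let ?p = "\<lambda>x. wt x * u x" and ?q = "\<lambda>x. wt x * v x" and ?w = "\<lambda>x. wt x * \<bar>v x - u x\<bar>"
  let ?P = "LINT x|\<mu>. wt x" and ?Q = "LINT x|\<nu>. wt x"
  have p: "has_bochner_integral m ?p ?P" by (rule has_bochner_mu) (auto intro: wclass_integrable_wt[OF class_mu])
  have q: "has_bochner_integral m ?q ?Q" by (rule has_bochner_nu) (auto intro: wclass_integrable_wt[OF class_nu])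
  have P: "0 \<le> ?P" "?P \<le> c" "0 \<le> ?Q" "?Q \<le> c"
    using wclass_integral_wt[OF class_mu] wclass_integral_wt[OF class_nu] by (auto intro!: integral_nonneg_AE)
  have L0: "0 \<le> L"
    using order_trans[OF abs_ge_zero L[of 0 0 0]] by (simp add: wt_def)
  let ?R = "\<lambda>p. (case p of (x, y, z) \<Rightarrow> ?w x * ?q y * ?q z) + (case p of (x, y, z) \<Rightarrow> ?p x * ?w y * ?q z)
      + (case p of (x, y, z) \<Rightarrow> ?p x * ?p y * ?w z)"
  have R: "has_bochner_integral (triple m) (\<lambda>p. L * ?R p) (L * (wdist * ?Q * ?Q + ?P * wdist * ?Q + ?P * ?P * wdist))"
    by (intro has_bochner_integral_mult_right has_bochner_integral_add triple_has_bochner p q wdist_has_bochner)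
  let ?l = "\<lambda>p. (case p of (x, y, z) \<Rightarrow> restr K x y z * gain_loss f x y z * (v x * v y * v z))
     - (case p of (x, y, z) \<Rightarrow> restr K x y z * gain_loss f x y z * (u x * u y * u z))"
  have l: "has_bochner_integral (triple m) ?l (2 * Q_pair K \<nu> f - 2 * Q_pair K \<mu> f)"
    by (intro has_bochner_integral_diff Q_pair_nu Q_pair_mu) (use assms in auto)
  have le: "\<bar>?l p\<bar> \<le> L * ?R p" for p
  proof -
    obtain x y z where [simp]: "p = (x, y, z)" by (metis prod.exhaust)
    have "?l p = (restr K x y z * gain_loss f x y z) * (v x * v y * v z - u x * u y * u z)"
      by (simp add: algebra_simps)
    also have "\<bar>\<dots>\<bar> \<le> L * (wt x * wt y * wt z) *
       (\<bar>v x - u x\<bar> * v y * v z + u x * \<bar>v y - u y\<bar> * v z + u x * u y * \<bar>v z - u z\<bar>)"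
      unfolding abs_mult[of "restr K x y z * gain_loss f x y z"]
      by (intro mult_mono L abs_prod3_diff) (use L0 in auto)
    also have "\<dots> = L * ?R p" by (simp add: algebra_simps)
    finally show ?thesis .
  qed
  have "\<bar>2 * Q_pair K \<nu> f - 2 * Q_pair K \<mu> f\<bar> = \<bar>integral\<^sup>L (triple m) ?l\<bar>"
    using l by (simp add: has_bochner_integral_iff)
  also have "\<dots> \<le> (LINT p|triple m. L * ?R p)"
    by (rule integral_abs_bound_integral) (use l R le in \<open>auto simp: has_bochner_integral_iff\<close>)
  also have "\<dots> = L * (wdist * ?Q * ?Q + ?P * wdist * ?Q + ?P * ?P * wdist)"
    using R by (simp add: has_bochner_integral_iff)
  also have "\<dots> \<le> L * (wdist * c * c + c * wdist * c + c * c * wdist)"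
    by (intro mult_left_mono add_mono mult_mono) (use P L0 wdist_nonneg wclass_c_nonneg[OF class_mu] in auto)
  finally have "\<bar>2 * (Q_pair K \<nu> f - Q_pair K \<mu> f)\<bar> \<le> L * (3 * (c\<^sup>2 * wdist))"
    by (simp add: algebra_simps power2_eq_square)
  then show ?thesis unfolding abs_mult by simp
qed

end

text \<open>Here \<open>a\<close>, \<open>b\<close> are the weights of the first two variables and
  \<open>G\<close> is the gain part of the bracket. \<open>e1\<close> and \<open>e2\<close> measure
  how far the test function is from the optimal one, which equals the weight where
  \<open>v > u\<close> and \<open>0\<close> elsewhere; for that one they vanish. After
  multiplication by the three weights, every squared weight on the right falls on a factor
  \<open>v\<close>, except within \<open>e1\<close> and \<open>e2\<close>. The terms that would put
  it on a positive part, \<open>a * max 0 (v1 - u1)\<close> and \<open>b * max 0 (v2 - u2)\<close>,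
  are produced by the gain and absorbed by the loss with the same coefficient.\<close>

lemma collision_pointwise:
  fixes a b :: real
  assumes nn: "0 \<le> u1" "0 \<le> u2" "0 \<le> u3" "0 \<le> v1" "0 \<le> v2" "0 \<le> v3"
    and G: "0 \<le> G" "G \<le> a + b" and f: "0 \<le> f1" "f1 \<le> a" "0 \<le> f2" "f2 \<le> b"
  defines "e1 \<equiv> (a - f1) * max 0 (v1 - u1) + f1 * max 0 (u1 - v1)"
    and "e2 \<equiv> (b - f2) * max 0 (v2 - u2) + f2 * max 0 (u2 - v2)"
    and "w1 \<equiv> \<bar>v1 - u1\<bar>" and "w2 \<equiv> \<bar>v2 - u2\<bar>" and "w3 \<equiv> \<bar>v3 - u3\<bar>"
  shows "(G - f2 - f1) * (v1 * v2 * v3 - u1 * u2 * u3) \<le>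
     (b * w1 * v2 * v3 + a * v1 * w2 * (u3 + v3) + a * v1 * (u2 + v2) * w3 + e1 * u2 * u3) +
     (a * w2 * v1 * v3 + b * v2 * w1 * (u3 + v3) + b * v2 * (u1 + v1) * w3 + e2 * u1 * u3) +
     (a + b) * v1 * v2 * w3"
proof -
  \<comment> \<open>The summand \<open>ax * max 0 (vx - ux) * vy * vz\<close> on the left is the
    dangerous gain term, carried along here so that the loss absorbs it.\<close>
  have loss: "- fx * (vx * vy * vz - ux * uy * uz) + ax * max 0 (vx - ux) * vy * vz
      \<le> ax * vx * wy * (uz + vz) + ax * vx * (uy + vy) * wz + ((ax - fx) * max 0 (vx - ux) + fx * max 0 (ux - vx)) * uy * uz"
    if h: "0 \<le> ux" "0 \<le> uy" "0 \<le> uz" "0 \<le> vx" "0 \<le> vy" "0 \<le> vz" "0 \<le> fx" "fx \<le> ax"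
      "wy = \<bar>vy - uy\<bar>" "wz = \<bar>vz - uz\<bar>" for ax fx ux uy uz vx vy vz wy wz :: real
  proof -
    define d e where "d = max 0 (vx - ux)" and "e = max 0 (ux - vx)"
    have de: "vx - ux = d - e" "d \<le> vx" "0 \<le> d" using h by (auto simp: d_def e_def)
    have eq: "- fx * (vx * vy * vz - ux * uy * uz) + ax * d * vy * vz
      = ax * d * (vy * vz - uy * uz) + fx * vx * (uy * uz - vy * vz) + (ax * d - fx * (vx - ux)) * uy * uz"
      by (simp add: algebra_simps)
    have e: "ax * d - fx * (vx - ux) = (ax - fx) * d + fx * e"
      by (subst de(1)) (simp add: algebra_simps)
    have t1: "vy * vz - uy * uz \<le> wy * vz + uy * wz"
    proof -
      have "vy * vz - uy * uz = (vy - uy) * vz + uy * (vz - uz)" by (simp add: algebra_simps)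
      also have "\<dots> \<le> wy * vz + uy * wz"
        using h by (intro add_mono mult_right_mono mult_left_mono) auto
      finally show ?thesis .
    qed
    have t2: "uy * uz - vy * vz \<le> wy * uz + vy * wz"
    proof -
      have "uy * uz - vy * vz = (uy - vy) * uz + vy * (uz - vz)" by (simp add: algebra_simps)
      also have "\<dots> \<le> wy * uz + vy * wz"
        using h by (intro add_mono mult_right_mono mult_left_mono) auto
      finally show ?thesis .
    qed
    have n: "0 \<le> wy * vz + uy * wz" "0 \<le> wy * uz + vy * wz" using h by auto
    have "ax * d * (vy * vz - uy * uz) \<le> ax * d * (wy * vz + uy * wz)"
      using t1 h de by (intro mult_left_mono) auto
    also have "\<dots> \<le> ax * vx * (wy * vz + uy * wz)"
      using de h n by (intro mult_right_mono mult_left_mono) auto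
    finally have 1: "ax * d * (vy * vz - uy * uz) \<le> ax * vx * (wy * vz + uy * wz)" .
    have "fx * vx * (uy * uz - vy * vz) \<le> fx * vx * (wy * uz + vy * wz)"
      using t2 h by (intro mult_left_mono) auto
    also have "\<dots> \<le> ax * vx * (wy * uz + vy * wz)"
      using h n by (intro mult_right_mono) auto
    finally have 2: "fx * vx * (uy * uz - vy * vz) \<le> ax * vx * (wy * uz + vy * wz)" .
    have "- fx * (vx * vy * vz - ux * uy * uz) + ax * d * vy * vz
       \<le> ax * vx * (wy * vz + uy * wz) + ax * vx * (wy * uz + vy * wz) + ((ax - fx) * d + fx * e) * uy * uz"
      using eq e 1 2 by simp
    also have "\<dots> = ax * vx * wy * (uz + vz) + ax * vx * (uy + vy) * wz + ((ax - fx) * d + fx * e) * uy * uz"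
      by (simp add: algebra_simps)
    finally show ?thesis by (simp only: d_def e_def)
  qed
  have gain: "G * (v1 * v2 * v3 - u1 * u2 * u3) \<le> (a + b) * (max 0 (v1 - u1) * v2 * v3 + v1 * max 0 (v2 - u2) * v3 + v1 * v2 * w3)"
  proof -
    let ?d1 = "max 0 (v1 - u1)" and ?d2 = "max 0 (v2 - u2)"
    have d: "v1 - u1 \<le> ?d1" "v2 - u2 \<le> ?d2" "0 \<le> ?d1" "0 \<le> ?d2" "v3 - u3 \<le> w3" "0 \<le> w3" by (auto simp: w3_def)
    \<comment> \<open>Replacing each \<open>u\<close> by \<open>min v u\<close> lowers the product
      and equals \<open>v\<close> minus the positive part of \<open>v - u\<close>, so that only
      factors \<open>v\<close> accompany the positive parts.\<close>
    have m: "min v1 u1 * min v2 u2 * min v3 u3 \<le> u1 * u2 * u3"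
      using nn by (intro mult_mono) auto
    have mm: "min v1 u1 = v1 - ?d1" "min v2 u2 = v2 - ?d2" "v3 - w3 \<le> min v3 u3"
      by (auto simp: w3_def)
    have "v1 * v2 * v3 - min v1 u1 * min v2 u2 * min v3 u3
       = ?d1 * v2 * v3 + min v1 u1 * ?d2 * v3 + min v1 u1 * min v2 u2 * (v3 - min v3 u3)"
      unfolding mm(1,2) by (simp add: algebra_simps)
    also have "\<dots> \<le> ?d1 * v2 * v3 + v1 * ?d2 * v3 + v1 * v2 * w3"
    proof -
      have "min v1 u1 * ?d2 * v3 \<le> v1 * ?d2 * v3" using nn d by (intro mult_right_mono) auto
      moreover have "min v1 u1 * min v2 u2 * (v3 - min v3 u3) \<le> v1 * v2 * w3"
        using nn d mm(3) by (intro mult_mono mult_nonneg_nonneg) auto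
      ultimately show ?thesis by linarith
    qed
    finally have "v1 * v2 * v3 - u1 * u2 * u3 \<le> ?d1 * v2 * v3 + v1 * ?d2 * v3 + v1 * v2 * w3" (is "_ \<le> ?r")
      using m by linarith
    then have "G * (v1 * v2 * v3 - u1 * u2 * u3) \<le> G * ?r" using G by (intro mult_left_mono)
    also have "\<dots> \<le> (a + b) * ?r" using G nn d by (intro mult_right_mono) auto
    finally show ?thesis .
  qed
  have l1: "- f1 * (v1 * v2 * v3 - u1 * u2 * u3) + a * max 0 (v1 - u1) * v2 * v3
      \<le> a * v1 * w2 * (u3 + v3) + a * v1 * (u2 + v2) * w3 + e1 * u2 * u3"
    unfolding e1_def by (rule loss) (use nn f in \<open>auto simp: w2_def w3_def\<close>)
  have l2: "- f2 * (v2 * v1 * v3 - u2 * u1 * u3) + b * max 0 (v2 - u2) * v1 * v3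
      \<le> b * v2 * w1 * (u3 + v3) + b * v2 * (u1 + v1) * w3 + e2 * u1 * u3"
    unfolding e2_def by (rule loss) (use nn f in \<open>auto simp: w1_def w3_def\<close>)
  have r1: "b * max 0 (v1 - u1) * v2 * v3 \<le> b * w1 * v2 * v3"
    using nn f by (intro mult_right_mono mult_left_mono) (auto simp: w1_def)
  have r2: "a * max 0 (v2 - u2) * v1 * v3 \<le> a * w2 * v1 * v3"
    using nn f by (intro mult_right_mono mult_left_mono) (auto simp: w2_def)
  have split: "(G - f2 - f1) * (v1 * v2 * v3 - u1 * u2 * u3) = G * (v1 * v2 * v3 - u1 * u2 * u3)
      + (- f1 * (v1 * v2 * v3 - u1 * u2 * u3)) + (- f2 * (v2 * v1 * v3 - u2 * u1 * u3))"
    by (simp add: algebra_simps)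
  define d1 d2 where "d1 = max 0 (v1 - u1)" and "d2 = max 0 (v2 - u2)"
  have "(a + b) * (d1 * v2 * v3 + v1 * d2 * v3 + v1 * v2 * w3) =
     a * d1 * v2 * v3 + b * d1 * v2 * v3 + a * d2 * v1 * v3 + b * d2 * v1 * v3 + (a + b) * v1 * v2 * w3"
    by (simp add: algebra_simps)
  then show ?thesis
    using gain l1 l2 r1 r2 unfolding split d1_def[symmetric] d2_def[symmetric] by linarith
qed

section \<open>The positive part of a difference of measures\<close>

text \<open>\<open>excess g \<nu> \<mu>\<close> is \<open>\<langle>g, (\<nu> - \<mu>)\<^sup>+\<rangle>\<close>, phrased without signed measures; see \<open>excess_eq\<close> below.\<close>

definition excess :: "(real \<Rightarrow> real) \<Rightarrow> real measure \<Rightarrow> real measure \<Rightarrow> real" where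
  "excess g \<nu> \<mu> = (SUP f \<in> {f \<in> borel_measurable borel. \<forall>x. 0 \<le> f x \<and> f x \<le> g x}. (LINT x|\<nu>. f x) - (LINT x|\<mu>. f x))"

lemma wt_bound_nonneg:
  assumes "\<And>x. 0 \<le> f x" "\<And>x. f x \<le> C * wt x" shows "\<And>x. \<bar>f x\<bar> \<le> C * wt x"
  using assms by simp

text \<open>Stated through integrals, so that later arguments need neither \<open>m\<close> nor
  densities. One set serves all weights \<open>f\<close> at once, and this is what permits limits in
  the weight.\<close>

definition hahn_set :: "real measure \<Rightarrow> real measure \<Rightarrow> real set \<Rightarrow> bool" where
  "hahn_set \<nu> \<mu> A \<longleftrightarrow> A \<in> sets borel \<and>
    (\<forall>f C. f \<in> borel_measurable borel \<longrightarrow> (\<forall>x. 0 \<le> f x \<and> f x \<le> C * wt x) \<longrightarrow>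
       (LINT x|\<mu>. f x * indicator A x) \<le> (LINT x|\<nu>. f x * indicator A x) \<and>
       (LINT x|\<nu>. f x * indicator (- A) x) \<le> (LINT x|\<mu>. f x * indicator (- A) x) \<and>
       excess f \<nu> \<mu> = (LINT x|\<nu>. f x * indicator A x) - (LINT x|\<mu>. f x * indicator A x))"

context density_pair
begin

lemma test_diff:
  assumes "f \<in> borel_measurable borel" "\<And>x. 0 \<le> f x" "\<And>x. f x \<le> C * wt x"
  shows "has_bochner_integral m (\<lambda>x. f x * (v x - u x)) ((LINT x|\<nu>. f x) - (LINT x|\<mu>. f x))"
  unfolding right_diff_distrib
  by (intro has_bochner_integral_diff has_bochner_nu has_bochner_mu assms(1) wclass_integrable[OF class_mu assms(1), of C]
      wclass_integrable[OF class_nu assms(1), of C] wt_bound_nonneg[OF assms(2,3)])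

lemma test_diff_indicator:
  assumes [measurable]: "f \<in> borel_measurable borel" "B \<in> sets borel" and "\<And>x. 0 \<le> f x" "\<And>x. f x \<le> C * wt x"
  shows "has_bochner_integral m (\<lambda>x. f x * indicator B x * (v x - u x))
    ((LINT x|\<nu>. f x * indicator B x) - (LINT x|\<mu>. f x * indicator B x))"
proof (rule test_diff[where C=C])
  show "f x * indicator B x \<le> C * wt x" "0 \<le> f x * indicator B x" for x
    using assms(3)[of x] assms(4)[of x] by (auto simp: indicator_def)
qed measurable

text \<open>Among \<open>0 \<le> f \<le> g\<close> the product \<open>f * (v - u)\<close> is
  pointwise largest for \<open>f = g\<close> on \<open>u < v\<close> and \<open>f = 0\<close>
  elsewhere, so the supremum is attained there. The same bound supplies the boundedness from above
  that a real-valued \<open>SUP\<close> requires.\<close>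

lemma excess_eq_aux:
  assumes g: "g \<in> borel_measurable borel" "\<And>x. 0 \<le> g x" "\<And>x. g x \<le> C * wt x"
  shows "excess g \<nu> \<mu> = (LINT x|\<nu>. g x * indicator {x. u x < v x} x) - (LINT x|\<mu>. g x * indicator {x. u x < v x} x)" (is "?L = ?R")
    and "\<lbrakk>f \<in> borel_measurable borel; \<And>x. 0 \<le> f x; \<And>x. f x \<le> g x\<rbrakk> \<Longrightarrow> (LINT x|\<nu>. f x) - (LINT x|\<mu>. f x) \<le> excess g \<nu> \<mu>"
proof -
  note [measurable] = g(1)
  have A [measurable]: "{x. u x < v x} \<in> sets borel" by measurable
  note G = test_diff_indicator[OF g(1) A g(2,3)]
  have le: "(LINT x|\<nu>. f x) - (LINT x|\<mu>. f x) \<le> ?R"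
    if f: "f \<in> borel_measurable borel" "\<And>x. 0 \<le> f x" "\<And>x. f x \<le> g x" for f
  proof -
    have F: "has_bochner_integral m (\<lambda>x. f x * (v x - u x)) ((LINT x|\<nu>. f x) - (LINT x|\<mu>. f x))"
      by (rule test_diff[where C=C]) (use f g(3) order_trans in blast)+
    have "f x * (v x - u x) \<le> g x * indicator {x. u x < v x} x * (v x - u x)" for x
    proof (cases "u x < v x")
      case True
      then show ?thesis using f(3)[of x] by (simp add: mult_right_mono)
    next
      case False
      then have "f x * (v x - u x) \<le> 0" using f(2)[of x] by (intro mult_nonneg_nonpos) auto
      then show ?thesis using False by simp
    qed
    then have "(LINT x|m. f x * (v x - u x)) \<le> (LINT x|m. g x * indicator {x. u x < v x} x * (v x - u x))"
      using F G by (intro integral_mono) (auto simp: has_bochner_integral_iff)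
    then show ?thesis using F G by (simp add: has_bochner_integral_iff)
  qed
  have bd: "bdd_above ((\<lambda>f. (LINT x|\<nu>. f x) - (LINT x|\<mu>. f x)) ` {f \<in> borel_measurable borel. \<forall>x. 0 \<le> f x \<and> f x \<le> g x})"
    using le by (intro bdd_aboveI2[where M="?R"]) auto
  have up: "(LINT x|\<nu>. f x) - (LINT x|\<mu>. f x) \<le> excess g \<nu> \<mu>"
    if "f \<in> borel_measurable borel" "\<And>x. 0 \<le> f x" "\<And>x. f x \<le> g x" for f
    unfolding excess_def by (rule cSUP_upper[OF _ bd]) (use that in auto)
  then show "\<lbrakk>f \<in> borel_measurable borel; \<And>x. 0 \<le> f x; \<And>x. f x \<le> g x\<rbrakk> \<Longrightarrow> (LINT x|\<nu>. f x) - (LINT x|\<mu>. f x) \<le> excess g \<nu> \<mu>" .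
  show "?L = ?R"
  proof (rule antisym)
    show "?L \<le> ?R"
      unfolding excess_def using le g(2) by (intro cSUP_least) (auto intro!: exI[of _ "\<lambda>x. 0"])
    show "?R \<le> ?L" by (rule up) (use g(2) in \<open>auto simp: indicator_def\<close>)
  qed
qed

lemma excess_eq:
  assumes g: "g \<in> borel_measurable borel" "\<And>x. 0 \<le> g x" "\<And>x. g x \<le> C * wt x"
  shows "has_bochner_integral m (\<lambda>x. g x * max 0 (v x - u x)) (excess g \<nu> \<mu>)"
proof -
  have A: "{x. u x < v x} \<in> sets borel" by measurable
  have "(\<lambda>x. g x * indicator {x. u x < v x} x * (v x - u x)) = (\<lambda>x. g x * max 0 (v x - u x))"
    by (auto simp: indicator_def fun_eq_iff)
  with test_diff_indicator[OF g(1) A g(2,3)] excess_eq_aux(1)[OF g] show ?thesis by simp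
qed

lemma hahn_set_pos: "hahn_set \<nu> \<mu> {x. u x < v x}"
  unfolding hahn_set_def
proof (intro conjI allI impI)
  show A: "{x. u x < v x} \<in> sets borel" by measurable
  then have A': "- {x. u x < v x} \<in> sets borel" by auto
  fix f C assume f: "f \<in> borel_measurable borel" "\<forall>x. 0 \<le> f x \<and> f x \<le> C * wt x"
  have "0 \<le> (LINT x|m. f x * indicator {x. u x < v x} x * (v x - u x))"
    using f by (intro integral_nonneg_AE) (auto simp: indicator_def)
  then show "(LINT x|\<mu>. f x * indicator {x. u x < v x} x) \<le> (LINT x|\<nu>. f x * indicator {x. u x < v x} x)"
    using test_diff_indicator[OF f(1) A, of C] f(2) by (simp add: has_bochner_integral_iff)
  have "0 \<le> (LINT x|m. - (f x * indicator (- {x. u x < v x}) x * (v x - u x)))"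
    using f by (intro integral_nonneg_AE) (auto simp: indicator_def mult_nonneg_nonpos)
  then show "(LINT x|\<nu>. f x * indicator (- {x. u x < v x}) x) \<le> (LINT x|\<mu>. f x * indicator (- {x. u x < v x}) x)"
    using test_diff_indicator[OF f(1) A', of C] f(2) by (simp add: has_bochner_integral_iff)
  show "excess f \<nu> \<mu> = (LINT x|\<nu>. f x * indicator {x. u x < v x} x) - (LINT x|\<mu>. f x * indicator {x. u x < v x} x)"
    using excess_eq_aux(1)[OF f(1), of C] f(2) by simp
qed

end

lemma hahn_set_exists:
  assumes "wclass c \<mu>" "wclass c \<nu>"
  obtains A where "hahn_set \<nu> \<mu> A"
proof -
  obtain m u v where "density_pair c \<mu> \<nu> m u v" using density_pair_exists[OF assms] .
  then show thesis by (rule that[OF density_pair.hahn_set_pos])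
qed

lemma hahn_setD:
  assumes "hahn_set \<nu> \<mu> A"
  shows "A \<in> sets borel"
    and "\<lbrakk>f \<in> borel_measurable borel; \<And>x. 0 \<le> f x; \<And>x. f x \<le> C * wt x\<rbrakk> \<Longrightarrow>
       (LINT x|\<mu>. f x * indicator A x) \<le> (LINT x|\<nu>. f x * indicator A x)"
    and "\<lbrakk>f \<in> borel_measurable borel; \<And>x. 0 \<le> f x; \<And>x. f x \<le> C * wt x\<rbrakk> \<Longrightarrow>
       (LINT x|\<nu>. f x * indicator (- A) x) \<le> (LINT x|\<mu>. f x * indicator (- A) x)"
    and "\<lbrakk>f \<in> borel_measurable borel; \<And>x. 0 \<le> f x; \<And>x. f x \<le> C * wt x\<rbrakk> \<Longrightarrow>
       excess f \<nu> \<mu> = (LINT x|\<nu>. f x * indicator A x) - (LINT x|\<mu>. f x * indicator A x)"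
  using assms unfolding hahn_set_def by blast+

lemma excess_upper:
  assumes "wclass c \<mu>" "wclass c \<nu>" and g: "g \<in> borel_measurable borel" "\<And>x. g x \<le> C * wt x"
    and f: "f \<in> borel_measurable borel" "\<And>x. 0 \<le> f x" "\<And>x. f x \<le> g x"
  shows "(LINT x|\<nu>. f x) - (LINT x|\<mu>. f x) \<le> excess g \<nu> \<mu>"
proof -
  obtain m u v where "density_pair c \<mu> \<nu> m u v" using density_pair_exists[OF assms(1,2)] .
  moreover have "0 \<le> g x" for x using f order_trans by blast
  ultimately show ?thesis using density_pair.excess_eq_aux(2) g f by blast
qed

lemma excess_least:
  assumes "\<And>x. 0 \<le> g x" and "\<And>f. \<lbrakk>f \<in> borel_measurable borel; \<And>x. 0 \<le> f x; \<And>x. f x \<le> g x\<rbrakk> \<Longrightarrow> (LINT x|\<nu>. f x) - (LINT x|\<mu>. f x) \<le> e"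
  shows "excess g \<nu> \<mu> \<le> e"
  unfolding excess_def using assms by (intro cSUP_least) (auto intro!: exI[of _ "\<lambda>x. 0"])

lemma excess_nonneg:
  assumes "wclass c \<mu>" "wclass c \<nu>" "g \<in> borel_measurable borel" "\<And>x. 0 \<le> g x" "\<And>x. g x \<le> C * wt x"
  shows "0 \<le> excess g \<nu> \<mu>"
  using excess_upper[OF assms(1-3,5), where f="\<lambda>x. 0"] assms(4) by auto

section \<open>Compactly supported weights and the removal of the cutoff\<close>

definition wtR :: "real \<Rightarrow> real \<Rightarrow> real" where "wtR R x = wt x * indicator {x. \<bar>x\<bar> \<le> R} x"

lemma wtR_bounds: "0 \<le> wtR R x" "wtR R x \<le> wt x" "wtR R x \<le> 1 * wt x" "wtR R x \<le> 1 + \<bar>R\<bar>"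
  by (auto simp: wtR_def indicator_def) (auto simp: wt_def)

lemma wtR_measurable [measurable]: "wtR R \<in> borel_measurable borel"
  unfolding wtR_def by measurable

lemma integral_cutoff_tendsto:
  fixes f :: "real \<Rightarrow> real"
  assumes sets: "sets \<mu> = sets borel" and "integrable \<mu> f"
  shows "(\<lambda>n. LINT x|\<mu>. f x * indicator {x. \<bar>x\<bar> \<le> real n} x) \<longlonglongrightarrow> (LINT x|\<mu>. f x)"
proof (rule integral_dominated_convergence[where w="\<lambda>x. \<bar>f x\<bar>"])
  have [measurable]: "f \<in> borel_measurable \<mu>" using assms by auto
  have "{x. \<bar>x\<bar> \<le> real n} \<in> sets borel" for n by measurable
  then have [measurable]: "{x. \<bar>x\<bar> \<le> real n} \<in> sets \<mu>" for n by (simp add: sets)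
  show "(\<lambda>x. f x * indicator {x. \<bar>x\<bar> \<le> real n} x) \<in> borel_measurable \<mu>" for n by measurable
  show "f \<in> borel_measurable \<mu>" by simp
  show "integrable \<mu> (\<lambda>x. \<bar>f x\<bar>)" using assms by simp
  have "(\<lambda>n. f x * indicator {x. \<bar>x\<bar> \<le> real n} x) \<longlonglongrightarrow> f x" for x
  proof (rule tendsto_eventually)
    obtain N where "\<bar>x\<bar> \<le> real N" using real_arch_simple by blast
    then show "\<forall>\<^sub>F n in sequentially. f x * indicator {x. \<bar>x\<bar> \<le> real n} x = f x"
      by (auto simp: eventually_sequentially intro!: exI[of _ N])
  qed
  then show "AE x in \<mu>. (\<lambda>n. f x * indicator {x. \<bar>x\<bar> \<le> real n} x) \<longlonglongrightarrow> f x" by simp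
  show "AE x in \<mu>. norm (f x * indicator {x. \<bar>x\<bar> \<le> real n} x) \<le> \<bar>f x\<bar>" for n
    by (auto simp: indicator_def)
qed

text \<open>One Hahn set of the pair is optimal for every cutoff and for \<open>wt\<close> itself,
  so dominated convergence for two fixed measures suffices.\<close>

lemma excess_cutoff_tendsto:
  assumes "wclass c \<mu>" "wclass c \<nu>"
  shows "(\<lambda>n. excess (wtR (real n)) \<nu> \<mu>) \<longlonglongrightarrow> excess wt \<nu> \<mu>"
proof -
  obtain A where hA: "hahn_set \<nu> \<mu> A" using hahn_set_exists[OF assms] .
  note [measurable] = hahn_setD(1)[OF hA] and A = hahn_setD(4)[OF hA]
  have i: "integrable \<kappa> (\<lambda>x. wt x * indicator A x)" if "wclass c \<kappa>" for \<kappa>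
    by (rule wclass_integrable[OF that, where C=1]) (auto simp: indicator_def)
  have "(\<lambda>n. (LINT x|\<nu>. wtR (real n) x * indicator A x) - (LINT x|\<mu>. wtR (real n) x * indicator A x))
    \<longlonglongrightarrow> (LINT x|\<nu>. wt x * indicator A x) - (LINT x|\<mu>. wt x * indicator A x)"
    using tendsto_diff[OF integral_cutoff_tendsto[OF wclass_sets[OF assms(2)] i[OF assms(2)]]
         integral_cutoff_tendsto[OF wclass_sets[OF assms(1)] i[OF assms(1)]]]
    by (simp add: wtR_def mult_ac)
  moreover have "excess (wtR R) \<nu> \<mu> = (LINT x|\<nu>. wtR R x * indicator A x) - (LINT x|\<mu>. wtR R x * indicator A x)" for R
    by (rule A[where C=1]) (auto simp: wtR_bounds)
  moreover have "excess wt \<nu> \<mu> = (LINT x|\<nu>. wt x * indicator A x) - (LINT x|\<mu>. wt x * indicator A x)"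
    by (rule A[where C=1]) auto
  ultimately show ?thesis by simp
qed

text \<open>The modulus of a number is twice its positive part minus the number. The defect
  \<open>\<delta>\<close> will be \<open>0\<close> for uniqueness and the weight lost by cutting the
  initial measure for existence.\<close>

lemma (in density_pair) wdist_le:
  assumes "(LINT x|\<mu>. wt x) \<le> (LINT x|\<nu>. wt x) + \<delta>"
  shows "wdist \<le> 2 * excess wt \<nu> \<mu> + \<delta>"
proof -
  have e: "has_bochner_integral m (\<lambda>x. wt x * max 0 (v x - u x)) (excess wt \<nu> \<mu>)"
    by (rule excess_eq[where C=1]) auto
  have "has_bochner_integral m (\<lambda>x. 2 * (wt x * max 0 (v x - u x)) - (wt x * v x - wt x * u x)) (2 * excess wt \<nu> \<mu> - ((LINT x|\<nu>. wt x) - (LINT x|\<mu>. wt x)))"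
    by (intro has_bochner_integral_diff has_bochner_integral_mult_right has_bochner_nu has_bochner_mu e
        wclass_integrable_wt[OF class_mu] wclass_integrable_wt[OF class_nu]) auto
  moreover have "2 * (wt x * max 0 (v x - u x)) - (wt x * v x - wt x * u x) = wt x * \<bar>v x - u x\<bar>" for x
    by (auto simp: max_def abs_if algebra_simps)
  ultimately have "wdist = 2 * excess wt \<nu> \<mu> - ((LINT x|\<nu>. wt x) - (LINT x|\<mu>. wt x))"
    unfolding wdist_def by (simp add: has_bochner_integral_iff)
  then show ?thesis using assms by simp
qed

lemma admissible_nonneg: "admissible K \<Longrightarrow> 0 \<le> restr K x y z"
  and admissible_le: "admissible K \<Longrightarrow> restr K x y z \<le> wt x * wt y * wt z"
  by (auto simp: admissible_def)

text \<open>On the support of the kernel all four frequencies are nonnegative, so \<open>wt\<close>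
  is affine along a collision; the last equation is its conservation in a single collision.\<close>

lemma restr_nonzeroD:
  assumes "restr K x y z \<noteq> 0"
  shows "0 \<le> x" "0 \<le> y" "0 \<le> z" "z \<le> x + y" "wt (x + y - z) + wt z = wt x + wt y"
  using assms by (auto simp: restr_def dom_D_def indicator_def wt_def split: if_splits)

lemma restr_gain_loss_le:
  assumes K: "admissible K" and "\<And>x y z. restr K x y z \<noteq> 0 \<Longrightarrow> \<bar>gain_loss f x y z\<bar> \<le> L" "0 \<le> L"
  shows "\<bar>restr K x y z * gain_loss f x y z\<bar> \<le> L * (wt x * wt y * wt z)"
proof (cases "restr K x y z = 0")
  case False
  have "\<bar>restr K x y z * gain_loss f x y z\<bar> \<le> (wt x * wt y * wt z) * L"
    unfolding abs_mult using admissible_nonneg[OF K] admissible_le[OF K] assms(2)[OF False]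
    by (intro mult_mono) auto
  then show ?thesis by (simp add: mult.commute)
qed (use assms in auto)

lemma restr_gain_loss_bounded:
  assumes K: "admissible K" and "\<And>x. \<bar>f x\<bar> \<le> b"
  shows "\<bar>restr K x y z * gain_loss f x y z\<bar> \<le> (4 * b) * (wt x * wt y * wt z)"
proof (rule restr_gain_loss_le[OF K])
  show "\<bar>gain_loss f x y z\<bar> \<le> 4 * b" for x y z
    unfolding gain_loss_def using assms(2)[of x] assms(2)[of y] assms(2)[of z] assms(2)[of "x+y-z"] by linarith
  show "0 \<le> 4 * b" using assms(2)[of 0] by linarith
qed

section \<open>The one-sided collision estimate\<close>

lemma restr_mult_le:
  assumes K: "admissible K" and "X \<le> Y" "0 \<le> Y"
  shows "restr K x y z * X \<le> wt x * wt y * wt z * Y"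
proof -
  have "restr K x y z * X \<le> restr K x y z * Y"
    using admissible_nonneg[OF K] assms(2) by (intro mult_left_mono)
  also have "\<dots> \<le> wt x * wt y * wt z * Y"
    using admissible_le[OF K] assms(3) by (intro mult_right_mono)
  finally show ?thesis .
qed

text \<open>The test set \<open>A\<close> is arbitrary because it will be the Hahn set of a later
  time, while \<open>B\<close> is the Hahn set of the present pair. The mismatch is paid for by the
  integrals over \<open>B - A\<close> and \<open>A - B\<close>, and the cutoff by the tail of the
  second moment of \<open>\<nu>\<close>, which is \<open>k\<close> minus the integral of
  \<open>g\<close>.\<close>

lemma Q_pair_one_sided:
  fixes R :: real
  assumes mu: "wclass c \<mu>" and nu: "wclass c \<nu>" and K: "admissible K"
    and sq: "integrable \<nu> (\<lambda>x. (wt x)\<^sup>2)" and A [measurable]: "A \<in> sets borel" and R: "0 \<le> R"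
    and mass: "(LINT x|\<mu>. wt x) \<le> (LINT x|\<nu>. wt x) + \<delta>"
  defines "k \<equiv> LINT x|\<nu>. (wt x)\<^sup>2" and "g \<equiv> \<lambda>x. wt x * wtR R x"
  obtains B where "B \<in> sets borel"
    "Q_pair K \<nu> (\<lambda>x. wtR R x * indicator A x) - Q_pair K \<mu> (\<lambda>x. wtR R x * indicator A x)
     \<le> 6 * k * c * (2 * excess wt \<nu> \<mu> + \<delta>) + c\<^sup>2 * ((k - (LINT x|\<nu>. g x))
        + ((LINT x|\<nu>. g x * indicator (B - A) x) - (LINT x|\<mu>. g x * indicator (B - A) x))
        + ((LINT x|\<mu>. g x * indicator (A - B) x) - (LINT x|\<nu>. g x * indicator (A - B) x)))"
proof -
  obtain m u v where "density_pair c \<mu> \<nu> m u v" using density_pair_exists[OF mu nu] .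
  then interpret density_pair c \<mu> \<nu> m u v .
  define B where "B = {x. u x < v x}"
  have B [measurable]: "B \<in> sets borel" unfolding B_def by measurable
  have BA: "B - A \<in> sets borel" "A - B \<in> sets borel" by measurable
  have gm [measurable]: "g \<in> borel_measurable borel" unfolding g_def by measurable
  have g0: "0 \<le> g x" for x by (simp add: g_def wtR_bounds)
  have gle: "g x \<le> (1 + R) * wt x" for x
    using wtR_bounds(4)[of R x] R by (simp add: g_def mult.commute)
  define f where "f x = wtR R x * indicator A x" for x
  have fm [measurable]: "f \<in> borel_measurable borel" unfolding f_def by measurable
  have f: "0 \<le> f x" "f x \<le> wt x" "\<bar>f x\<bar> \<le> 1 + R" for x
    using wtR_bounds[of R x] R by (auto simp: f_def indicator_def)
  let ?p = "\<lambda>x. wt x * u x" and ?q = "\<lambda>x. wt x * v x" and ?w = "\<lambda>x. wt x * \<bar>v x - u x\<bar>"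
    and ?r = "\<lambda>x. (wt x)\<^sup>2 * v x" and ?s = "\<lambda>x. wt x * u x + wt x * v x"
  \<comment> \<open>Majorant of the weighted defect of the test function \<open>f\<close>. Inside
    the radius \<open>R\<close> it vanishes off the symmetric difference of \<open>A\<close> and
    \<open>B\<close>; outside, where \<open>f\<close> is \<open>0\<close>, it is the whole
    \<open>(wt x)\<^sup>2 * v x\<close>.\<close>
  define E where "E x = ((wt x)\<^sup>2 * v x - g x * v x) + g x * indicator (B - A) x * (v x - u x) - g x * indicator (A - B) x * (v x - u x)" for x
  define EI where "EI = (k - (LINT x|\<nu>. g x))
        + ((LINT x|\<nu>. g x * indicator (B - A) x) - (LINT x|\<mu>. g x * indicator (B - A) x))
        - ((LINT x|\<nu>. g x * indicator (A - B) x) - (LINT x|\<mu>. g x * indicator (A - B) x))"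
  let ?P = "LINT x|\<mu>. wt x" and ?Q = "LINT x|\<nu>. wt x"
  have p: "has_bochner_integral m ?p ?P" by (rule has_bochner_mu) (auto intro: wclass_integrable_wt[OF class_mu])
  have q: "has_bochner_integral m ?q ?Q" by (rule has_bochner_nu) (auto intro: wclass_integrable_wt[OF class_nu])
  have s: "has_bochner_integral m ?s (?P + ?Q)" by (intro has_bochner_integral_add p q)
  have r: "has_bochner_integral m ?r k" unfolding k_def by (rule has_bochner_nu) (auto intro: sq)
  have gi: "integrable \<nu> g" by (rule wclass_integrable[OF nu gm]) (use g0 gle in auto)
  have E: "has_bochner_integral m E EI"
    unfolding E_def EI_def
    by (intro has_bochner_integral_add has_bochner_integral_diff r has_bochner_nu gm gi
        test_diff_indicator[OF gm BA(1) g0 gle] test_diff_indicator[OF gm BA(2) g0 gle])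
  have P: "0 \<le> ?P" "?P \<le> c" "0 \<le> ?Q" "?Q \<le> c"
    using wclass_integral_wt[OF class_mu] wclass_integral_wt[OF class_nu] by (auto intro!: integral_nonneg_AE)
  have c0: "0 \<le> c" by (rule wclass_c_nonneg[OF mu])
  have k0: "0 \<le> k" unfolding k_def by (intro integral_nonneg_AE) auto
  have Ebound: "wt x * ((wt x - f x) * max 0 (v x - u x) + f x * max 0 (u x - v x)) \<le> E x" for x
  proof (cases "\<bar>x\<bar> \<le> R")
    case True
    then have "g x = (wt x)\<^sup>2" "f x = wt x * indicator A x"
      by (auto simp: g_def f_def wtR_def power2_eq_square)
    then show ?thesis
      by (auto simp: E_def B_def indicator_def power2_eq_square algebra_simps)
  next
    case False
    then have "g x = 0" "f x = 0" by (auto simp: g_def f_def wtR_def)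
    moreover have "wt x * (wt x * max 0 (v x - u x)) \<le> wt x * (wt x * v x)"
      by (intro mult_left_mono) auto
    ultimately show ?thesis by (simp add: E_def power2_eq_square mult_ac)
  qed
  have E0: "0 \<le> E x" for x
    using order_trans[OF _ Ebound[of x]] f[of x] by simp
  have EI0: "0 \<le> EI"
    using E E0 integral_nonneg_AE[of E m] by (auto simp: has_bochner_integral_iff)
  let ?R = "\<lambda>p. (case p of (x, y, z) \<Rightarrow> ?w x * ?r y * ?q z) + (case p of (x, y, z) \<Rightarrow> ?r x * ?w y * ?s z)
     + (case p of (x, y, z) \<Rightarrow> ?r x * ?s y * ?w z) + (case p of (x, y, z) \<Rightarrow> E x * ?p y * ?p z)
     + (case p of (x, y, z) \<Rightarrow> ?r x * ?w y * ?q z) + (case p of (x, y, z) \<Rightarrow> ?w x * ?r y * ?s z)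
     + (case p of (x, y, z) \<Rightarrow> ?s x * ?r y * ?w z) + (case p of (x, y, z) \<Rightarrow> ?p x * E y * ?p z)
     + (case p of (x, y, z) \<Rightarrow> ?r x * ?q y * ?w z) + (case p of (x, y, z) \<Rightarrow> ?q x * ?r y * ?w z)"
  let ?I = "wdist * k * ?Q + k * wdist * (?P + ?Q) + k * (?P + ?Q) * wdist + EI * ?P * ?P
     + k * wdist * ?Q + wdist * k * (?P + ?Q) + (?P + ?Q) * k * wdist + ?P * EI * ?P + k * ?Q * wdist + ?Q * k * wdist"
  have RI: "has_bochner_integral (triple m) ?R ?I"
    by (intro has_bochner_integral_add triple_has_bochner p q wdist_has_bochner r s E)
  have L: "\<bar>restr K x y z * gain_loss f x y z\<bar> \<le> 4 * (1 + R) * (wt x * wt y * wt z)" for x y z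
    by (rule restr_gain_loss_bounded[OF K f(3)])
  let ?l = "\<lambda>p. (case p of (x, y, z) \<Rightarrow> restr K x y z * gain_loss f x y z * (v x * v y * v z))
     - (case p of (x, y, z) \<Rightarrow> restr K x y z * gain_loss f x y z * (u x * u y * u z))"
  have l: "has_bochner_integral (triple m) ?l (2 * Q_pair K \<nu> f - 2 * Q_pair K \<mu> f)"
    by (intro has_bochner_integral_diff Q_pair_nu[OF K fm L] Q_pair_mu[OF K fm L])
  have pw: "?l p \<le> ?R p" for p
  proof -
    obtain x y z where pxyz: "p = (x, y, z)" by (metis prod.exhaust)
    define e where "e x = (wt x - f x) * max 0 (v x - u x) + f x * max 0 (u x - v x)" for x
    define X where "X = (wt y * \<bar>v x - u x\<bar> * v y * v z + wt x * v x * \<bar>v y - u y\<bar> * (u z + v z) + wt x * v x * (u y + v y) * \<bar>v z - u z\<bar> + e x * u y * u z) +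
     (wt x * \<bar>v y - u y\<bar> * v x * v z + wt y * v y * \<bar>v x - u x\<bar> * (u z + v z) + wt y * v y * (u x + v x) * \<bar>v z - u z\<bar> + e y * u x * u z) +
     (wt x + wt y) * v x * v y * \<bar>v z - u z\<bar>"
    have e0: "0 \<le> e x" for x using f[of x] by (simp add: e_def)
    have X0: "0 \<le> X" unfolding X_def using e0[of x] e0[of y] by (intro add_nonneg_nonneg mult_nonneg_nonneg) auto
    have "restr K x y z * (gain_loss f x y z * (v x * v y * v z - u x * u y * u z)) \<le> wt x * wt y * wt z * X"
    proof (cases "restr K x y z = 0")
      case True
      then show ?thesis using X0 by simp
    next
      case False
      have G: "f (x + y - z) + f z \<le> wt x + wt y"
        using restr_nonzeroD(5)[OF False] f(2)[of "x+y-z"] f(2)[of z] by linarith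
      have "gain_loss f x y z * (v x * v y * v z - u x * u y * u z) \<le> X"
        unfolding X_def gain_loss_def e_def
        by (rule collision_pointwise) (use f(1,2) G in auto)
      then show ?thesis by (intro restr_mult_le[OF K] X0)
    qed
    then have "?l p \<le> wt x * wt y * wt z * X"
      by (simp add: pxyz right_diff_distrib mult.assoc)
    also have "\<dots> = ?w x * ?r y * ?q z + ?r x * ?w y * ?s z + ?r x * ?s y * ?w z + (wt x * e x) * ?p y * ?p z
     + ?r x * ?w y * ?q z + ?w x * ?r y * ?s z + ?s x * ?r y * ?w z + ?p x * (wt y * e y) * ?p z
     + ?r x * ?q y * ?w z + ?q x * ?r y * ?w z"
    proof -
      have "a * b * cc * ((b * w1 * v2 * v3 + a * v1 * w2 * (u3 + v3) + a * v1 * (u2 + v2) * w3 + e1 * u2 * u3) +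
        (a * w2 * v1 * v3 + b * v2 * w1 * (u3 + v3) + b * v2 * (u1 + v1) * w3 + e2 * u1 * u3) + (a + b) * v1 * v2 * w3)
       = (a * w1) * (b * b * v2) * (cc * v3) + (a * a * v1) * (b * w2) * (cc * u3 + cc * v3) + (a * a * v1) * (b * u2 + b * v2) * (cc * w3)
        + (a * e1) * (b * u2) * (cc * u3) + (a * a * v1) * (b * w2) * (cc * v3) + (a * w1) * (b * b * v2) * (cc * u3 + cc * v3)
        + (a * u1 + a * v1) * (b * b * v2) * (cc * w3) + (a * u1) * (b * e2) * (cc * u3)
        + (a * a * v1) * (b * v2) * (cc * w3) + (a * v1) * (b * b * v2) * (cc * w3)"
        for a b cc u1 u2 u3 v1 v2 v3 w1 w2 w3 e1 e2 :: real
        by (simp add: algebra_simps)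
      then show ?thesis unfolding X_def power2_eq_square by this
    qed
    also have "\<dots> \<le> ?R p"
      unfolding pxyz prod.case using Ebound[of x, folded e_def] Ebound[of y, folded e_def]
      by (intro add_mono order_refl mult_right_mono mult_left_mono) auto
    finally show ?thesis .
  qed
  have W0: "0 \<le> wdist" by (rule wdist_nonneg)
  have "2 * Q_pair K \<nu> f - 2 * Q_pair K \<mu> f \<le> ?I"
    using integral_mono[of "triple m" ?l ?R] l RI pw by (simp add: has_bochner_integral_iff)
  also have "\<dots> \<le> wdist * k * c + k * wdist * (c + c) + k * (c + c) * wdist + EI * c * c
     + k * wdist * c + wdist * k * (c + c) + (c + c) * k * wdist + c * EI * c + k * c * wdist + c * k * wdist"
    by (intro add_mono mult_mono order_refl mult_nonneg_nonneg add_nonneg_nonneg) (use P W0 k0 EI0 c0 in auto)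
  \<comment> \<open>Each factor \<open>c + c\<close> counts twice, so the eight terms with
    \<open>wdist\<close> add up to \<open>12 * k * c * wdist\<close>; half of this is the constant
    \<open>6\<close> of the statement.\<close>
  also have "\<dots> = 2 * (6 * k * c * wdist + c\<^sup>2 * EI)"
    by (simp add: algebra_simps power2_eq_square)
  finally have "Q_pair K \<nu> f - Q_pair K \<mu> f \<le> 6 * k * c * wdist + c\<^sup>2 * EI" by simp
  also have "\<dots> \<le> 6 * k * c * (2 * excess wt \<nu> \<mu> + \<delta>) + c\<^sup>2 * EI"
    using wdist_le[OF mass] k0 c0 by (intro add_mono mult_left_mono) auto
  finally show thesis
    by (intro that[OF B]) (simp add: EI_def f_def[abs_def] algebra_simps)
qed

section \<open>Telescoping and Gronwall estimates\<close>

text \<open>Over \<open>n\<close> equal subintervals the quadratic errors sum to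
  \<open>C * t\<^sup>2 / n\<close>, which tends to \<open>0\<close>. Hence \<open>C\<close> may be
  as large as desired, as long as it does not depend on the partition.\<close>

lemma telescoping_increments:
  fixes h H :: "real \<Rightarrow> real"
  assumes inc: "\<And>s t. \<lbrakk>0 \<le> s; s \<le> t; t \<le> T\<rbrakk> \<Longrightarrow> h t - h s \<le> H t - H s + C * (t - s)\<^sup>2"
    and t: "0 \<le> t" "t \<le> T"
  shows "h t - h 0 \<le> H t - H 0"
proof -
  define D where "D s = h s - H s" for s
  have step: "D t' - D s \<le> C * (t' - s)\<^sup>2" if "0 \<le> s" "s \<le> t'" "t' \<le> T" for s t'
    using inc[OF that] by (simp add: D_def)
  have bound: "D t - D 0 \<le> C * t\<^sup>2 / real n" if n: "0 < n" for n :: nat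
  proof -
    define p where "p i = real i * t / real n" for i
    have "D (p i) - D 0 \<le> real i * (C * (t / real n)\<^sup>2)" if "i \<le> n" for i
      using that
    proof (induction i)
      case (Suc i)
      have pT: "p (Suc i) \<le> T"
      proof -
        have "real (Suc i) * t \<le> real n * t" using Suc.prems t by (intro mult_right_mono) auto
        then have "p (Suc i) \<le> t" using n by (simp add: p_def pos_divide_le_eq mult.commute)
        then show ?thesis using t by simp
      qed
      have "p (Suc i) - p i = t / real n" by (simp add: p_def diff_divide_distrib[symmetric] algebra_simps)
      moreover have "0 \<le> t / real n" using t by simp
      moreover from this have "p i \<le> p (Suc i)" using calculation by linarith
      moreover have "0 \<le> p i" using t by (simp add: p_def)
      ultimately have "D (p (Suc i)) - D (p i) \<le> C * (t / real n)\<^sup>2"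
        using step[of "p i" "p (Suc i)"] pT by metis
      with Suc show ?case by (simp add: algebra_simps)
    qed (simp add: p_def)
    from this[of n] have "D t - D 0 \<le> real n * (C * (t / real n)\<^sup>2)" using n by (simp add: p_def)
    also have "\<dots> = C * t\<^sup>2 / real n" using n by (simp add: power2_eq_square)
    finally show ?thesis .
  qed
  have "(\<lambda>n. C * t\<^sup>2 / real n) \<longlonglongrightarrow> 0" by (rule lim_const_over_n)
  then have "D t - D 0 \<le> 0"
    by (rule LIMSEQ_le_const) (use bound in \<open>auto intro!: exI[of _ 1]\<close>)
  then show ?thesis by (simp add: D_def)
qed

lemma set_integral_split:
  fixes f :: "real \<Rightarrow> real"
  assumes "set_integrable lborel {0..T} f" "0 \<le> s" "s \<le> t" "t \<le> T"
  shows "(LINT r:{0..t}|lborel. f r) = (LINT r:{0..s}|lborel. f r) + (LINT r:{s<..t}|lborel. f r)"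
proof -
  have "{0..t} = {0..s} \<union> {s<..t}" using assms by auto
  moreover have "set_integrable lborel {0..s} f" "set_integrable lborel {s<..t} f"
    using assms by (auto intro!: set_integrable_subset[OF assms(1)])
  ultimately show ?thesis using set_integral_Un[of "{0..s}" "{s<..t}" lborel f] by fastforce
qed

lemma set_integral_singleton [simp]: "(LINT r:{a}|lborel. f r :: real) = 0"
  unfolding set_lebesgue_integral_def
  by (intro integral_eq_zero_AE eventually_mono[OF AE_lborel_singleton[of a]]) auto

lemma set_integral_continuous:
  fixes f :: "real \<Rightarrow> real"
  assumes "set_integrable lborel {0..T} f"
  shows "continuous_on {0..T} (\<lambda>t. LINT r:{0..t}|lborel. f r)"
proof -
  have "continuous_on {0..T} (\<lambda>t. integral {0..t} f)"
    by (rule indefinite_integral_continuous_1[OF set_borel_integral_eq_integral(1)[OF assms]])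
  moreover have "(LINT r:{0..t}|lborel. f r) = integral {0..t} f" if "t \<in> {0..T}" for t
    using that by (intro set_borel_integral_eq_integral(2) set_integrable_subset[OF assms]) auto
  ultimately show ?thesis using continuous_on_cong[OF refl] by (metis (no_types, lifting))
qed

text \<open>The factor \<open>2 ^ n\<close> replaces the exponential of the usual statement: the integral of \<open>k\<close> is cut
  into \<open>n\<close> pieces of size at most \<open>1 / 2\<close>.\<close>

lemma gronwall_linear:
  fixes k h :: "real \<Rightarrow> real"
  assumes k: "set_integrable lborel {0..T} k" "\<And>t. 0 \<le> k t"
    and kh: "set_integrable lborel {0..T} (\<lambda>t. k t * h t)"
    and h: "\<And>t. t \<in> {0..T} \<Longrightarrow> 0 \<le> h t" "\<And>t. t \<in> {0..T} \<Longrightarrow> h t \<le> a + (LINT r:{0..t}|lborel. k r * h r)"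
    and t: "t \<in> {0..T}" "(LINT r:{0..t}|lborel. k r) \<le> real n / 2"
  shows "h t \<le> a * 2 ^ n"
proof -
  define E where "E t = (LINT r:{0..t}|lborel. k r)" for t
  define z where "z t = a + (LINT r:{0..t}|lborel. k r * h r)" for t
  have E0: "E 0 = 0" and z0: "z 0 = a" by (simp_all add: E_def z_def)
  have zs: "z t = z s + (LINT r:{s<..t}|lborel. k r * h r)" if "0 \<le> s" "s \<le> t" "t \<le> T" for s t
    using set_integral_split[OF kh that] by (simp add: z_def)
  have Es: "E t = E s + (LINT r:{s<..t}|lborel. k r)" if "0 \<le> s" "s \<le> t" "t \<le> T" for s t
    using set_integral_split[OF k(1) that] by (simp add: E_def)
  have zmono: "z s \<le> z t" if "0 \<le> s" "s \<le> t" "t \<le> T" for s t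
  proof -
    have "0 \<le> (LINT r:{s<..t}|lborel. k r * h r)"
      unfolding set_lebesgue_integral_def using that k(2) h(1) by (intro integral_nonneg_AE) (auto simp: indicator_def)
    then show ?thesis using zs[OF that] by simp
  qed
  \<comment> \<open>The majorant \<open>z\<close> is monotone, so \<open>h\<close> is at most the
    end value \<open>z t\<close> on the whole of \<open>(s, t]\<close>. In this implicit form,
    \<open>z t \<le> 2 * z s\<close> follows as soon as \<open>E\<close> grows by at most
    \<open>1 / 2\<close>.\<close>
  have inc: "z t - z s \<le> z t * (E t - E s)" if "0 \<le> s" "s \<le> t" "t \<le> T" for s t
  proof -
    have "(LINT r:{s<..t}|lborel. k r * h r) \<le> (LINT r:{s<..t}|lborel. k r * z t)"
    proof (rule set_integral_mono)
      show "set_integrable lborel {s<..t} (\<lambda>r. k r * h r)" "set_integrable lborel {s<..t} (\<lambda>r. k r * z t)"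
        using that by (auto intro!: set_integrable_subset[OF kh] set_integrable_subset[OF k(1)] set_integrable_mult_left)
      show "k r * h r \<le> k r * z t" if "r \<in> {s<..t}" for r
      proof (rule mult_left_mono[OF _ k(2)])
        have "h r \<le> z r" using h(2)[of r] \<open>0 \<le> s\<close> \<open>t \<le> T\<close> that by (auto simp: z_def)
        also have "\<dots> \<le> z t" using \<open>0 \<le> s\<close> \<open>t \<le> T\<close> that by (intro zmono) auto
        finally show "h r \<le> z t" .
      qed
    qed
    also have "\<dots> = z t * (E t - E s)" using Es[OF that] by simp
    finally show ?thesis using zs[OF that] by simp
  qed
  have z_nonneg: "0 \<le> z t" if "t \<in> {0..T}" for t
    using h[OF that] by (simp add: z_def)
  have cont: "continuous_on {0..T} E"
    unfolding E_def by (rule set_integral_continuous[OF k(1)])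
  have "z t \<le> a * 2 ^ n" if "t \<in> {0..T}" "E t \<le> real n / 2" for t n
    using that
  proof (induction n arbitrary: t)
    case 0
    have "z t - z 0 \<le> z t * (E t - E 0)" using 0 by (intro inc) auto
    also have "\<dots> \<le> 0" using 0 E0 z_nonneg[of t] by (intro mult_nonneg_nonpos) auto
    finally show ?case using z0 by simp
  next
    case (Suc n)
    have a0: "0 \<le> a" using z_nonneg[of 0] z0 Suc.prems by auto
    show ?case
    proof (cases "E t \<le> real n / 2")
      case True
      then have "z t \<le> a * 2 ^ n" using Suc by simp
      also have "\<dots> \<le> a * 2 ^ Suc n" using a0 by (intro mult_left_mono) auto
      finally show ?thesis .
    next
      case False
      have "continuous_on {0..t} E" using cont Suc.prems by (elim continuous_on_subset) auto
      then obtain s where s: "0 \<le> s" "s \<le> t" "E s = real n / 2"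
        using IVT'[of E 0 "real n / 2" t] False E0 Suc.prems by auto
      have zs: "z s \<le> a * 2 ^ n" using Suc.IH[of s] s Suc.prems by auto
      have "z t - z s \<le> z t * (E t - E s)" using s Suc.prems by (intro inc) auto
      also have "\<dots> \<le> z t * (1 / 2)"
        using s Suc.prems z_nonneg[of t] by (intro mult_left_mono) (auto simp: field_simps)
      finally show ?thesis using zs by simp
    qed
  qed
  then have "z t \<le> a * 2 ^ n" using t by (simp add: E_def)
  then show ?thesis using h(2)[OF t(1)] by (simp add: z_def)
qed

section \<open>Approximate solutions\<close>

lemma Q_pair_bound:
  assumes mu: "wclass c \<mu>" and K: "admissible K" and f: "f \<in> borel_measurable borel"
    and L: "\<And>x y z. \<bar>restr K x y z * gain_loss f x y z\<bar> \<le> L * (wt x * wt y * wt z)"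
  shows "\<bar>Q_pair K \<mu> f\<bar> \<le> L / 2 * c ^ 3"
proof -
  obtain m u v where "density_pair c \<mu> \<mu> m u v" using density_pair_exists[OF mu mu] .
  then interpret density_pair c \<mu> \<mu> m u v .
  let ?p = "\<lambda>x. wt x * u x" and ?P = "LINT x|\<mu>. wt x"
  let ?l = "\<lambda>(x, y, z). restr K x y z * gain_loss f x y z * (u x * u y * u z)"
  let ?R = "\<lambda>p. L * (case p of (x, y, z) \<Rightarrow> ?p x * ?p y * ?p z)"
  have L0: "0 \<le> L"
    using order_trans[OF abs_ge_zero L[of 0 0 0]] by (simp add: wt_def)
  have p: "has_bochner_integral m ?p ?P" by (rule has_bochner_mu) (auto intro: wclass_integrable_wt[OF class_mu])
  have P: "0 \<le> ?P" "?P \<le> c" using wclass_integral_wt[OF mu] by (auto intro!: integral_nonneg_AE)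
  have R: "has_bochner_integral (triple m) ?R (L * (?P * ?P * ?P))"
    by (intro has_bochner_integral_mult_right triple_has_bochner p)
  have l: "has_bochner_integral (triple m) ?l (2 * Q_pair K \<mu> f)" by (rule Q_pair_mu[OF K f L])
  have le: "\<bar>?l p\<bar> \<le> ?R p" for p
  proof -
    obtain x y z where p: "p = (x, y, z)" by (metis prod.exhaust)
    have "\<bar>restr K x y z * gain_loss f x y z * (u x * u y * u z)\<bar> \<le> L * (wt x * wt y * wt z) * (u x * u y * u z)"
      unfolding abs_mult[of _ "u x * u y * u z"] using L[of x y z] by (intro mult_mono) auto
    also have "\<dots> = L * (?p x * ?p y * ?p z)" by (simp only: mult_ac)
    finally show ?thesis by (simp only: p prod.case)
  qed
  have "\<bar>2 * Q_pair K \<mu> f\<bar> = \<bar>integral\<^sup>L (triple m) ?l\<bar>"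
    using l by (simp add: has_bochner_integral_iff)
  also have "\<dots> \<le> (LINT p|triple m. ?R p)"
    by (rule integral_abs_bound_integral) (use l R le in \<open>auto simp: has_bochner_integral_iff\<close>)
  also have "\<dots> = L * (?P * ?P * ?P)" using R by (simp add: has_bochner_integral_iff)
  also have "\<dots> \<le> L * (c * c * c)"
    using P L0 wclass_c_nonneg[OF mu] by (intro mult_left_mono mult_mono) auto
  finally show ?thesis unfolding abs_mult by (simp add: power3_eq_cube)
qed

text \<open>Normalised by \<open>wt\<close>, so that the error of an approximate solution can be
  uniform over the whole class; other test functions are reached by scaling.\<close>

definition tests :: "(real \<Rightarrow> real) \<Rightarrow> bool" where
  "tests f \<longleftrightarrow> f \<in> borel_measurable borel \<and> (\<forall>x. \<bar>f x\<bar> \<le> wt x) \<and> (\<exists>R. \<forall>x. \<bar>x\<bar> > R \<longrightarrow> f x = 0)"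

lemma testsI:
  assumes "f \<in> borel_measurable borel" "\<And>x. \<bar>f x\<bar> \<le> wtR R x"
  shows "tests f"
  unfolding tests_def
proof (intro conjI allI exI[of _ R] impI)
  show "\<bar>f x\<bar> \<le> wt x" for x using assms(2)[of x] wtR_bounds(2)[of R x] by linarith
  show "f x = 0" if "\<bar>x\<bar> > R" for x using assms(2)[of x] that by (simp add: wtR_def)
qed (rule assms)

text \<open>\<open>q f\<close> is the time derivative of \<open>\<langle>f, \<mu>\<rangle>\<close>; solutions are the case \<open>e = 0\<close>, and Euler polygons
  satisfy this with small \<open>e\<close>.\<close>

definition approx_solution ::
  "(real \<Rightarrow> real \<Rightarrow> real \<Rightarrow> real) \<Rightarrow> real \<Rightarrow> real \<Rightarrow> real \<Rightarrow> (real \<Rightarrow> real measure) \<Rightarrow> ((real \<Rightarrow> real) \<Rightarrow> real \<Rightarrow> real) \<Rightarrow> bool" where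
  "approx_solution K c T e \<mu> q \<longleftrightarrow>
     (\<forall>t\<in>{0..T}. wclass c (\<mu> t)) \<and>
     (\<forall>f. tests f \<longrightarrow> set_integrable lborel {0..T} (q f) \<and>
        (\<forall>t\<in>{0..T}. \<bar>q f t - Q_pair K (\<mu> t) f\<bar> \<le> e \<and>
           (LINT x|\<mu> t. f x) = (LINT x|\<mu> 0. f x) + (LINT s:{0..t}|lborel. q f s)))"

lemma approx_solution_increment:
  assumes "approx_solution K c T e \<mu> q" "tests f" "0 \<le> s" "s \<le> t" "t \<le> T"
  shows "(LINT x|\<mu> t. f x) - (LINT x|\<mu> s. f x) = (LINT r:{s<..t}|lborel. q f r)"
proof -
  have i: "set_integrable lborel {0..T} (q f)"
    using assms(1,2) unfolding approx_solution_def by blast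
  have eq: "(LINT x|\<mu> r. f x) = (LINT x|\<mu> 0. f x) + (LINT s:{0..r}|lborel. q f s)" if "r \<in> {0..T}" for r
    using assms(1,2) that unfolding approx_solution_def by blast
  have "(LINT x|\<mu> t. f x) = (LINT x|\<mu> 0. f x) + (LINT s:{0..t}|lborel. q f s)"
    "(LINT x|\<mu> s. f x) = (LINT x|\<mu> 0. f x) + (LINT s:{0..s}|lborel. q f s)"
    by (rule eq, use assms(3-5) in simp)+
  then show ?thesis using set_integral_split[OF i assms(3-5)] by linarith
qed

lemma set_integral_le_const:
  fixes f :: "real \<Rightarrow> real"
  assumes "set_integrable lborel {s<..t} f" "s \<le> t" "\<And>r. r \<in> {s<..t} \<Longrightarrow> \<bar>f r\<bar> \<le> M"
  shows "\<bar>LINT r:{s<..t}|lborel. f r\<bar> \<le> M * (t - s)"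
proof -
  have c: "set_integrable lborel {s<..t} (\<lambda>r. d)" "(LINT r:{s<..t}|lborel. d) = d * (t - s)" for d :: real
    using assms(2) by (simp_all add: set_integrable_def set_lebesgue_integral_def)
  have "f r \<le> M" "- M \<le> f r" if "r \<in> {s<..t}" for r using assms(3)[OF that] by auto
  then show ?thesis
    using set_integral_mono[OF assms(1) c(1)[of M]] set_integral_mono[OF c(1)[of "-M"] assms(1)]
    unfolding c(2) by (intro abs_leI) auto
qed

text \<open>The quotient \<open>f / b\<close> is a normalised test function, and its bracket is at
  most \<open>4 * (1 + R)\<close>. The prefactor of \<open>Q_pair\<close> turns this into
  \<open>2 * (1 + R) * c ^ 3\<close>.\<close>

lemma approx_solution_lipschitz:
  assumes sol: "approx_solution K c T e \<mu> q" and K: "admissible K" and R: "0 \<le> R"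
    and f: "f \<in> borel_measurable borel" "\<And>x. \<bar>f x\<bar> \<le> b * wtR R x" and b: "0 < b"
    and t: "0 \<le> s" "s \<le> t" "t \<le> T"
  shows "\<bar>(LINT x|\<mu> t. f x) - (LINT x|\<mu> s. f x)\<bar> \<le> b * (e + 2 * (1 + R) * c ^ 3) * (t - s)"
proof -
  define g where "g x = f x / b" for x
  have gm: "g \<in> borel_measurable borel" unfolding g_def using f(1) by measurable
  have gle: "\<bar>g x\<bar> \<le> wtR R x" for x
    using f(2)[of x] b by (simp add: g_def abs_divide pos_divide_le_eq mult.commute)
  have g: "tests g" by (rule testsI[OF gm gle])
  have gb: "\<bar>g x\<bar> \<le> 1 + R" for x using gle[of x] wtR_bounds(4)[of R x] R by linarith
  have i: "set_integrable lborel {s<..t} (q g)"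
    using sol g t by (auto simp: approx_solution_def intro: set_integrable_subset[of lborel "{0..T}"])
  have "\<bar>q g r\<bar> \<le> e + 2 * (1 + R) * c ^ 3" if "r \<in> {s<..t}" for r
  proof -
    have r: "r \<in> {0..T}" using that t by auto
    have "\<bar>q g r - Q_pair K (\<mu> r) g\<bar> \<le> e" "wclass c (\<mu> r)" using sol g r by (auto simp: approx_solution_def)
    moreover from this have "\<bar>Q_pair K (\<mu> r) g\<bar> \<le> 4 * (1 + R) / 2 * c ^ 3"
      by (intro Q_pair_bound K gm restr_gain_loss_bounded gb)
    moreover have "4 * (1 + R) / 2 * c ^ 3 = 2 * (1 + R) * c ^ 3" by simp
    ultimately show ?thesis by linarith
  qed
  then have "\<bar>(LINT x|\<mu> t. g x) - (LINT x|\<mu> s. g x)\<bar> \<le> (e + 2 * (1 + R) * c ^ 3) * (t - s)"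
    unfolding approx_solution_increment[OF sol g t] by (rule set_integral_le_const[OF i t(2)])
  moreover have "(LINT x|\<mu> r. g x) = (LINT x|\<mu> r. f x) / b" for r unfolding g_def[abs_def] by simp
  ultimately have "\<bar>(LINT x|\<mu> t. f x) - (LINT x|\<mu> s. f x)\<bar> / b \<le> (e + 2 * (1 + R) * c ^ 3) * (t - s)"
    using b by (simp add: diff_divide_distrib[symmetric] abs_divide)
  then have "\<bar>(LINT x|\<mu> t. f x) - (LINT x|\<mu> s. f x)\<bar> \<le> (e + 2 * (1 + R) * c ^ 3) * (t - s) * b"
    using b by (simp only: pos_divide_le_eq)
  then show ?thesis by (simp only: mult_ac)
qed

lemma lipschitz_imp_continuous_on:
  fixes h :: "real \<Rightarrow> real"
  assumes "\<And>s t. \<lbrakk>0 \<le> s; s \<le> t; t \<le> T\<rbrakk> \<Longrightarrow> \<bar>h t - h s\<bar> \<le> M * (t - s)"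
  shows "continuous_on {0..T} h"
proof (cases "0 \<le> T")
  case True
  have *: "dist (h x) (h y) \<le> \<bar>M\<bar> * dist x y" if "x \<in> {0..T}" "y \<in> {0..T}" for x y
  proof -
    have "\<bar>h y - h x\<bar> \<le> \<bar>M\<bar> * \<bar>y - x\<bar>" if "0 \<le> x" "x \<le> y" "y \<le> T" for x y
      using order_trans[OF assms[OF that] mult_right_mono[OF abs_ge_self[of M], of "y - x"]] that by simp
    from this[of x y] this[of y x] that show ?thesis
      by (cases "x \<le> y") (auto simp: dist_real_def abs_minus_commute)
  qed
  show ?thesis
    by (rule Lipschitz.lipschitz_on_continuous_on[of "\<bar>M\<bar>"]) (rule lipschitz_onI; use * in auto)
qed simp

text \<open>A supremum of functions with a common Lipschitz constant inherits that constant, and the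
  rates of the two solutions add up. The constant grows with \<open>R\<close>, so the cutoff stays
  in place until the time mesh has been refined.\<close>

lemma excess_lipschitz:
  assumes sn: "approx_solution K c T e1 \<nu> q1" and sm: "approx_solution K c T e2 \<mu> q2" and K: "admissible K" and R: "0 \<le> R"
    and t: "0 \<le> s" "s \<le> t" "t \<le> T"
  shows "\<bar>excess (wtR R) (\<nu> t) (\<mu> t) - excess (wtR R) (\<nu> s) (\<mu> s)\<bar> \<le> (e1 + e2 + 4 * (1 + R) * c ^ 3) * (t - s)"
proof -
  have wc: "wclass c (\<nu> s)" "wclass c (\<mu> s)" "wclass c (\<nu> t)" "wclass c (\<mu> t)"
    using sn sm t by (auto simp: approx_solution_def)
  have l: "\<bar>((LINT x|\<nu> t. f x) - (LINT x|\<mu> t. f x)) - ((LINT x|\<nu> s. f x) - (LINT x|\<mu> s. f x))\<bar> \<le> (e1 + e2 + 4 * (1 + R) * c ^ 3) * (t - s)"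
    if f: "f \<in> borel_measurable borel" "\<And>x. 0 \<le> f x" "\<And>x. f x \<le> wtR R x" for f
  proof -
    have "\<bar>f x\<bar> \<le> 1 * wtR R x" for x using f by simp
    then have "\<bar>(LINT x|\<nu> t. f x) - (LINT x|\<nu> s. f x)\<bar> \<le> 1 * (e1 + 2 * (1 + R) * c ^ 3) * (t - s)"
      "\<bar>(LINT x|\<mu> t. f x) - (LINT x|\<mu> s. f x)\<bar> \<le> 1 * (e2 + 2 * (1 + R) * c ^ 3) * (t - s)"
      by (intro approx_solution_lipschitz[OF sn K R f(1)] approx_solution_lipschitz[OF sm K R f(1)] t; simp)+
    then show ?thesis by (simp add: algebra_simps)
  qed
  have "excess (wtR R) (\<nu> t) (\<mu> t) \<le> excess (wtR R) (\<nu> s) (\<mu> s) + (e1 + e2 + 4 * (1 + R) * c ^ 3) * (t - s)"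
  proof (rule excess_least)
    fix f assume f: "f \<in> borel_measurable borel" "\<And>x. 0 \<le> f x" "\<And>x. f x \<le> wtR R x"
    have "(LINT x|\<nu> s. f x) - (LINT x|\<mu> s. f x) \<le> excess (wtR R) (\<nu> s) (\<mu> s)"
      by (rule excess_upper[OF wc(2,1) wtR_measurable wtR_bounds(3) f])
    then show "(LINT x|\<nu> t. f x) - (LINT x|\<mu> t. f x) \<le> excess (wtR R) (\<nu> s) (\<mu> s) + (e1 + e2 + 4 * (1 + R) * c ^ 3) * (t - s)"
      using l[OF f] by linarith
  qed (rule wtR_bounds)
  moreover have "excess (wtR R) (\<nu> s) (\<mu> s) \<le> excess (wtR R) (\<nu> t) (\<mu> t) + (e1 + e2 + 4 * (1 + R) * c ^ 3) * (t - s)"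
  proof (rule excess_least)
    fix f assume f: "f \<in> borel_measurable borel" "\<And>x. 0 \<le> f x" "\<And>x. f x \<le> wtR R x"
    have "(LINT x|\<nu> t. f x) - (LINT x|\<mu> t. f x) \<le> excess (wtR R) (\<nu> t) (\<mu> t)"
      by (rule excess_upper[OF wc(4,3) wtR_measurable wtR_bounds(3) f])
    then show "(LINT x|\<nu> s. f x) - (LINT x|\<mu> s. f x) \<le> excess (wtR R) (\<nu> t) (\<mu> t) + (e1 + e2 + 4 * (1 + R) * c ^ 3) * (t - s)"
      using l[OF f] by linarith
  qed (rule wtR_bounds)
  ultimately show ?thesis by linarith
qed

section \<open>Second moments as monotone limits of test integrals\<close>

definition sq_moment :: "real measure \<Rightarrow> ennreal" where
  "sq_moment \<mu> = (\<integral>\<^sup>+x. ennreal ((wt x)\<^sup>2) \<partial>\<mu>)"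

lemma sq_cutoff:
  shows "(\<lambda>x. wt x * wtR R x) \<in> borel_measurable borel" "0 \<le> wt x * wtR R x"
    "wt x * wtR R x \<le> (1 + \<bar>R\<bar>) * wtR R x" "wt x * wtR R x = (wt x)\<^sup>2 * indicator {x. \<bar>x\<bar> \<le> R} x"
proof -
  show "(\<lambda>x. wt x * wtR R x) \<in> borel_measurable borel" by measurable
  show "0 \<le> wt x * wtR R x" by (simp add: wtR_bounds)
  show "wt x * wtR R x = (wt x)\<^sup>2 * indicator {x. \<bar>x\<bar> \<le> R} x" by (simp add: wtR_def power2_eq_square)
  show "wt x * wtR R x \<le> (1 + \<bar>R\<bar>) * wtR R x"
  proof (cases "\<bar>x\<bar> \<le> R")
    case True
    then have "wt x \<le> 1 + \<bar>R\<bar>" by (simp add: wt_def)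
    then show ?thesis by (intro mult_right_mono wtR_bounds)
  qed (simp add: wtR_def)
qed

text \<open>Expresses the second moment through compactly supported test functions, whose integrals
  are continuous in time along an approximate solution. This gives measurability in time and, in the
  limit of the approximations, lower semicontinuity.\<close>

lemma sq_moment_eq_SUP:
  assumes mu: "wclass c \<mu>"
  shows "sq_moment \<mu> = (SUP n. ennreal (LINT x|\<mu>. wt x * wtR (real n) x))"
proof -
  have "integrable \<mu> (\<lambda>x. wt x * wtR (real n) x)" for n
  proof (rule wclass_integrable[OF mu sq_cutoff(1)])
    show "\<bar>wt x * wtR (real n) x\<bar> \<le> (1 + real n) * wt x" for x
      using wtR_bounds(4)[of "real n" x] wtR_bounds(1)[of "real n" x] by (simp add: abs_mult mult.commute)
  qed
  then have e: "ennreal (LINT x|\<mu>. wt x * wtR (real n) x) = (\<integral>\<^sup>+x. ennreal (wt x * wtR (real n) x) \<partial>\<mu>)" for n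
    by (intro nn_integral_eq_integral[symmetric]) (auto simp: wtR_bounds)
  have s: "ennreal ((wt x)\<^sup>2) = (SUP n. ennreal (wt x * wtR (real n) x))" for x
  proof (rule antisym)
    obtain N where "\<bar>x\<bar> \<le> real N" using real_arch_simple by blast
    then have "ennreal ((wt x)\<^sup>2) = ennreal (wt x * wtR (real N) x)" by (simp add: sq_cutoff(4))
    also have "\<dots> \<le> (SUP n. ennreal (wt x * wtR (real n) x))" by (rule SUP_upper) simp
    finally show "ennreal ((wt x)\<^sup>2) \<le> (SUP n. ennreal (wt x * wtR (real n) x))" .
    show "(SUP n. ennreal (wt x * wtR (real n) x)) \<le> ennreal ((wt x)\<^sup>2)"
      by (intro SUP_least ennreal_leI) (auto simp: sq_cutoff(4) indicator_def)
  qed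
  have "sq_moment \<mu> = (\<integral>\<^sup>+x. (SUP n. ennreal (wt x * wtR (real n) x)) \<partial>\<mu>)"
    unfolding sq_moment_def s ..
  also have "\<dots> = (SUP n. \<integral>\<^sup>+x. ennreal (wt x * wtR (real n) x) \<partial>\<mu>)"
  proof (rule nn_integral_monotone_convergence_SUP)
    show "incseq (\<lambda>n x. ennreal (wt x * wtR (real n) x))"
      by (auto simp: incseq_def le_fun_def wtR_def indicator_def intro!: ennreal_leI)
    show "(\<lambda>x. ennreal (wt x * wtR (real n) x)) \<in> borel_measurable \<mu>" for n
      using sq_cutoff(1) wclass_sets[OF mu] by (auto simp: measurable_cong_sets[OF wclass_sets[OF mu] refl])
  qed
  finally show ?thesis by (simp add: e)
qed

section \<open>Stability\<close>

lemma approx_solution_wclass: "approx_solution K c T e \<mu> q \<Longrightarrow> t \<in> {0..T} \<Longrightarrow> wclass c (\<mu> t)"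
  by (auto simp: approx_solution_def)

lemma approx_solution_test_continuous:
  assumes sol: "approx_solution K c T e \<mu> q" and K: "admissible K" and R: "0 \<le> R"
    and f: "f \<in> borel_measurable borel" "\<And>x. \<bar>f x\<bar> \<le> b * wtR R x" and b: "0 < b"
  shows "continuous_on {0..T} (\<lambda>t. LINT x|\<mu> t. f x)"
  by (rule lipschitz_imp_continuous_on) (rule approx_solution_lipschitz[OF sol K R f b])

lemma sq_cutoff_continuous:
  assumes "approx_solution K c T e \<mu> q" "admissible K"
  shows "continuous_on {0..T} (\<lambda>t. LINT x|\<mu> t. wt x * wtR (real n) x)"
proof (rule approx_solution_test_continuous[OF assms])
  show "\<bar>wt x * wtR (real n) x\<bar> \<le> (1 + real n) * wtR (real n) x" for x
    using sq_cutoff(2,3)[of x "real n"] by simp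
qed (use sq_cutoff(1) in auto)

lemma sq_moment_measurable:
  assumes "approx_solution K c T e \<mu> q" "admissible K"
  shows "(\<lambda>t. sq_moment (\<mu> t) * indicator {0..T} t) \<in> borel_measurable borel"
proof -
  have "(\<lambda>t. indicator {0..T} t *\<^sub>R (LINT x|\<mu> t. wt x * wtR (real n) x)) \<in> borel_measurable borel" for n
    by (rule borel_measurable_continuous_on_indicator[OF _ sq_cutoff_continuous[OF assms]]) simp
  then have "(\<lambda>t. SUP n. ennreal (indicator {0..T} t *\<^sub>R (LINT x|\<mu> t. wt x * wtR (real n) x))) \<in> borel_measurable borel"
    by measurable
  moreover have "(SUP n. ennreal (indicator {0..T} t *\<^sub>R (LINT x|\<mu> t. wt x * wtR (real n) x))) = sq_moment (\<mu> t) * indicator {0..T} t" for t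
    using sq_moment_eq_SUP[OF approx_solution_wclass[OF assms(1)], of t] by (cases "t \<in> {0..T}") simp_all
  ultimately show ?thesis by simp
qed

text \<open>Each cut-off excess is Lipschitz in time, and a pointwise limit of continuous functions
  is measurable.\<close>

lemma excess_measurable:
  assumes "approx_solution K c T e1 \<nu> q1" "approx_solution K c T e2 \<mu> q2" "admissible K"
  shows "(\<lambda>t. indicator {0..T} t * excess wt (\<nu> t) (\<mu> t)) \<in> borel_measurable borel"
proof (rule borel_measurable_LIMSEQ_real)
  have "continuous_on {0..T} (\<lambda>t. excess (wtR (real n)) (\<nu> t) (\<mu> t))" for n
    by (rule lipschitz_imp_continuous_on) (rule excess_lipschitz[OF assms], auto)
  then show "(\<lambda>t. indicator {0..T} t * excess (wtR (real n)) (\<nu> t) (\<mu> t)) \<in> borel_measurable borel" for n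
    using borel_measurable_continuous_on_indicator[of "{0..T}" "\<lambda>t. excess (wtR (real n)) (\<nu> t) (\<mu> t)"] by simp
  show "(\<lambda>n. indicator {0..T} t * excess (wtR (real n)) (\<nu> t) (\<mu> t)) \<longlonglongrightarrow> indicator {0..T} t * excess wt (\<nu> t) (\<mu> t)" for t
  proof (cases "t \<in> {0..T}")
    case True
    then show ?thesis
      using excess_cutoff_tendsto[OF approx_solution_wclass[OF assms(2) True] approx_solution_wclass[OF assms(1) True]] by simp
  qed simp
qed

lemma excess_wt_bounds:
  assumes "wclass c \<mu>" "wclass c \<nu>"
  shows "0 \<le> excess wt \<nu> \<mu>" "excess wt \<nu> \<mu> \<le> c"
proof -
  show "0 \<le> excess wt \<nu> \<mu>" by (rule excess_nonneg[OF assms, where C=1]) auto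
  show "excess wt \<nu> \<mu> \<le> c"
  proof (rule excess_least)
    fix f :: "real \<Rightarrow> real" assume f: "f \<in> borel_measurable borel" "\<And>x. 0 \<le> f x" "\<And>x. f x \<le> wt x"
    have "(LINT x|\<nu>. f x) \<le> (LINT x|\<nu>. wt x)"
      by (intro integral_mono wclass_integrable[OF assms(2) f(1), of 1] wclass_integrable_wt[OF assms(2)]) (use f in auto)
    moreover have "0 \<le> (LINT x|\<mu>. f x)" using f by (intro integral_nonneg_AE) auto
    ultimately show "(LINT x|\<nu>. f x) - (LINT x|\<mu>. f x) \<le> c" using wclass_integral_wt[OF assms(2)] by linarith
  qed simp
qed

lemma sq_moment_finiteD:
  assumes "wclass c \<mu>" "sq_moment \<mu> < \<infinity>"
  shows "integrable \<mu> (\<lambda>x. (wt x)\<^sup>2)" "(LINT x|\<mu>. (wt x)\<^sup>2) = enn2real (sq_moment \<mu>)"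
proof -
  show i: "integrable \<mu> (\<lambda>x. (wt x)\<^sup>2)"
  proof (rule integrableI_nonneg)
    show "(\<lambda>x. (wt x)\<^sup>2) \<in> borel_measurable \<mu>"
      unfolding measurable_cong_sets[OF wclass_sets[OF assms(1)] refl] by measurable
  qed (use assms(2) in \<open>auto simp: sq_moment_def\<close>)
  show "(LINT x|\<mu>. (wt x)\<^sup>2) = enn2real (sq_moment \<mu>)"
    unfolding sq_moment_def by (rule integral_eq_nn_integral) (use i in auto)
qed

text \<open>At time \<open>t\<close> the integral of \<open>f\<close> against
  \<open>\<nu> - \<mu>\<close> is nonpositive. Going back to \<open>s\<close>, it can have been
  positive only by a Lipschitz constant times \<open>t - s\<close>.\<close>

lemma hahn_increment:
  assumes sn: "approx_solution K c T e1 \<nu> q1" and sm: "approx_solution K c T e2 \<mu> q2" and K: "admissible K" and R: "0 \<le> R"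
    and t: "0 \<le> s" "s \<le> t" "t \<le> T" and f: "f \<in> borel_measurable borel" "\<And>x. 0 \<le> f x" "\<And>x. f x \<le> (1 + R) * wtR R x"
    and le: "(LINT x|\<nu> t. f x) \<le> (LINT x|\<mu> t. f x)"
  shows "(LINT x|\<nu> s. f x) - (LINT x|\<mu> s. f x) \<le> (1 + R) * (e1 + e2 + 4 * (1 + R) * c ^ 3) * (t - s)"
proof -
  have "\<bar>f x\<bar> \<le> (1 + R) * wtR R x" for x using f by simp
  then have "\<bar>(LINT x|\<nu> t. f x) - (LINT x|\<nu> s. f x)\<bar> \<le> (1 + R) * (e1 + 2 * (1 + R) * c ^ 3) * (t - s)"
    "\<bar>(LINT x|\<mu> t. f x) - (LINT x|\<mu> s. f x)\<bar> \<le> (1 + R) * (e2 + 2 * (1 + R) * c ^ 3) * (t - s)"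
    using R by (intro approx_solution_lipschitz[OF sn K R f(1)] approx_solution_lipschitz[OF sm K R f(1)] t; simp)+
  moreover have "(1 + R) * (e1 + 2 * (1 + R) * c ^ 3) * (t - s) + (1 + R) * (e2 + 2 * (1 + R) * c ^ 3) * (t - s)
    = (1 + R) * (e1 + e2 + 4 * (1 + R) * c ^ 3) * (t - s)" by (simp add: algebra_simps)
  ultimately show ?thesis using le by linarith
qed

text \<open>The test function is frozen on the Hahn set at the later time \<open>t\<close>; at the earlier time \<open>r\<close> the Hahn
  set is a different one, and the discrepancy is of order \<open>t - r\<close>, which disappears under telescoping.\<close>

lemma stability_pointwise:
  assumes sn: "approx_solution K c T e1 \<nu> q1" and sm: "approx_solution K c T e2 \<mu> q2" and K: "admissible K" and R: "0 \<le> R"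
    and t: "0 \<le> r" "r \<le> t" "t \<le> T" and A: "hahn_set (\<nu> t) (\<mu> t) A"
    and mass: "(LINT x|\<mu> r. wt x) \<le> (LINT x|\<nu> r. wt x) + \<delta>" and sq: "sq_moment (\<nu> r) < \<infinity>"
  defines "k \<equiv> enn2real (sq_moment (\<nu> r))" and "f \<equiv> \<lambda>x. wtR R x * indicator A x"
  shows "q1 f r - q2 f r \<le> e1 + e2 + 6 * k * c * (2 * excess wt (\<nu> r) (\<mu> r) + \<delta>)
     + c\<^sup>2 * (k - (LINT x|\<nu> r. wt x * wtR R x)) + 2 * c\<^sup>2 * (1 + R) * (e1 + e2 + 4 * (1 + R) * c ^ 3) * (t - r)"
proof -
  have wc: "wclass c (\<nu> r)" "wclass c (\<mu> r)" using approx_solution_wclass[OF sn] approx_solution_wclass[OF sm] t by auto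
  have [measurable]: "A \<in> sets borel" by (rule hahn_setD(1)[OF A])
  define g where "g x = wt x * wtR R x" for x
  have gm [measurable]: "g \<in> borel_measurable borel" unfolding g_def by measurable
  have g0: "0 \<le> g x" for x by (simp add: g_def wtR_bounds)
  have gle: "g x \<le> (1 + R) * wtR R x" for x
    using sq_cutoff(3)[of x R] R by (simp add: g_def)
  have f: "tests f"
    unfolding f_def by (rule testsI[where R=R]) (auto simp: indicator_def wtR_bounds)
  have kk: "k = (LINT x|\<nu> r. (wt x)\<^sup>2)" unfolding k_def using sq_moment_finiteD(2)[OF wc(1) sq] by simp
  obtain B where B [measurable]: "B \<in> sets borel" and Q: "Q_pair K (\<nu> r) f - Q_pair K (\<mu> r) f
     \<le> 6 * k * c * (2 * excess wt (\<nu> r) (\<mu> r) + \<delta>) + c\<^sup>2 * ((k - (LINT x|\<nu> r. g x))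
        + ((LINT x|\<nu> r. g x * indicator (B - A) x) - (LINT x|\<mu> r. g x * indicator (B - A) x))
        + ((LINT x|\<mu> r. g x * indicator (A - B) x) - (LINT x|\<nu> r. g x * indicator (A - B) x)))"
    by (rule Q_pair_one_sided[OF wc(2,1) K sq_moment_finiteD(1)[OF wc(1) sq] hahn_setD(1)[OF A] R mass],
        rule that, assumption, unfold f_def kk g_def, assumption)
  let ?C = "(1 + R) * (e1 + e2 + 4 * (1 + R) * c ^ 3) * (t - r)"
  have m: "(\<lambda>x. g x * indicator (B - A) x) \<in> borel_measurable borel" "(\<lambda>x. g x * indicator (A - B) x) \<in> borel_measurable borel"
    by measurable
  have n: "0 \<le> g x * indicator S x" "g x * indicator S x \<le> (1 + R) * wtR R x" for x and S :: "real set"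
    using g0[of x] gle[of x] wtR_bounds(1)[of R x] R by (auto simp: indicator_def)
  have nw: "g x * indicator S x \<le> (1 + R) * wt x" for x and S :: "real set"
    using n(2)[of x S] mult_left_mono[OF wtR_bounds(2)[of R x], of "1 + R"] R by linarith
  have e1: "g x * indicator (B - A) x * indicator (- A) x = g x * indicator (B - A) x"
    "g x * indicator (A - B) x * indicator A x = g x * indicator (A - B) x" for x
    by (auto simp: indicator_def)
  have "(LINT x|\<nu> t. g x * indicator (B - A) x) \<le> (LINT x|\<mu> t. g x * indicator (B - A) x)"
    using hahn_setD(3)[OF A m(1) n(1) nw] unfolding e1 .
  from hahn_increment[OF sn sm K R t m(1) n this]
  have d1: "(LINT x|\<nu> r. g x * indicator (B - A) x) - (LINT x|\<mu> r. g x * indicator (B - A) x) \<le> ?C" .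
  have "(LINT x|\<mu> t. g x * indicator (A - B) x) \<le> (LINT x|\<nu> t. g x * indicator (A - B) x)"
    using hahn_setD(2)[OF A m(2) n(1) nw] unfolding e1 .
  from hahn_increment[OF sm sn K R t m(2) n this]
  have d2: "(LINT x|\<mu> r. g x * indicator (A - B) x) - (LINT x|\<nu> r. g x * indicator (A - B) x) \<le> ?C"
    by (simp add: add.commute)
  have r: "r \<in> {0..T}" using t by auto
  have q: "\<bar>q1 f r - Q_pair K (\<nu> r) f\<bar> \<le> e1" "\<bar>q2 f r - Q_pair K (\<mu> r) f\<bar> \<le> e2"
    using sn sm f r unfolding approx_solution_def by blast+
  have "c\<^sup>2 * ((k - (LINT x|\<nu> r. g x))
        + ((LINT x|\<nu> r. g x * indicator (B - A) x) - (LINT x|\<mu> r. g x * indicator (B - A) x))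
        + ((LINT x|\<mu> r. g x * indicator (A - B) x) - (LINT x|\<nu> r. g x * indicator (A - B) x)))
     \<le> c\<^sup>2 * ((k - (LINT x|\<nu> r. g x)) + ?C + ?C)"
    using d1 d2 by (intro mult_left_mono add_mono order_refl) auto
  also have "\<dots> = c\<^sup>2 * (k - (LINT x|\<nu> r. g x)) + 2 * c\<^sup>2 * (1 + R) * (e1 + e2 + 4 * (1 + R) * c ^ 3) * (t - r)"
    by (simp add: algebra_simps)
  finally show ?thesis using q Q unfolding g_def by linarith
qed

lemma set_integrable_const_Icc: "set_integrable lborel {a..b::real} (\<lambda>r. d :: real)"
  by (intro borel_integrable_atLeastAtMost' continuous_on_const)

lemma approx_solution_integrable:
  "approx_solution K c T e \<mu> q \<Longrightarrow> tests f \<Longrightarrow> set_integrable lborel {0..T} (q f)"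
  unfolding approx_solution_def by blast

lemma approx_solution_close:
  "approx_solution K c T e \<mu> q \<Longrightarrow> tests f \<Longrightarrow> t \<in> {0..T} \<Longrightarrow> \<bar>q f t - Q_pair K (\<mu> t) f\<bar> \<le> e"
  unfolding approx_solution_def by blast

text \<open>Serves both uniqueness, with \<open>e1 = e2 = \<delta> = 0\<close>, and the Cauchy
  property of the Euler polygons. Second moments enter through \<open>\<nu>\<close> alone, and only
  in the time integral bounded by \<open>E\<close>. The Gronwall kernel is
  \<open>12 * c * k\<close>: the \<open>6\<close> of the one-sided estimate times the
  \<open>2\<close> from passing to the excess. The choice of \<open>n\<close> makes its integral at
  most \<open>n / 2\<close>.\<close>

lemma stability:
  assumes sn: "approx_solution K c T e1 \<nu> q1" and sm: "approx_solution K c T e2 \<mu> q2" and K: "admissible K"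
    and mass: "\<And>t. t \<in> {0..T} \<Longrightarrow> (LINT x|\<mu> t. wt x) \<le> (LINT x|\<nu> t. wt x) + \<delta>" and \<delta>: "0 \<le> \<delta>"
    and E: "(\<integral>\<^sup>+s. sq_moment (\<nu> s) * indicator {0..T} s \<partial>lborel) \<le> ennreal E" "0 \<le> E"
    and n: "24 * c * E \<le> real n" and t: "t \<in> {0..T}"
  shows "excess wt (\<nu> t) (\<mu> t) \<le> (excess wt (\<nu> 0) (\<mu> 0) + (e1 + e2) * T + 6 * c * \<delta> * E) * 2 ^ n"
proof -
  have T: "0 \<le> T" using t by simp
  have wcn: "wclass c (\<nu> r)" and wcm: "wclass c (\<mu> r)" if "r \<in> {0..T}" for r
    using approx_solution_wclass[OF sn that] approx_solution_wclass[OF sm that] by auto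
  have c0: "0 \<le> c" using wclass_c_nonneg[OF wcn[of 0]] T by simp
  have e0: "0 \<le> e1" "0 \<le> e2"
  proof -
    have z: "tests (\<lambda>x. 0)" by (rule testsI[where R=0]) (auto simp: wtR_bounds)
    show "0 \<le> e1" using approx_solution_close[OF sn z, of 0] T by simp
    show "0 \<le> e2" using approx_solution_close[OF sm z, of 0] T by simp
  qed
  \<comment> \<open>\<open>enn2real\<close> gives \<open>0\<close> where the second moment is
    infinite, which happens for a null set of times only.\<close>
  define k where "k r = enn2real (sq_moment (\<nu> r) * indicator {0..T} r)" for r
  define h where "h r = excess wt (\<nu> r) (\<mu> r)" for r
  define g where "g n r = (LINT x|\<nu> r. wt x * wtR (real n) x)" for n r
  have km [measurable]: "k \<in> borel_measurable borel"
    unfolding k_def[abs_def] using sq_moment_measurable[OF sn K] by measurable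
  have k0: "0 \<le> k r" for r by (simp add: k_def)
  have fin: "AE r in lborel. sq_moment (\<nu> r) * indicator {0..T} r \<noteq> \<infinity>"
    by (rule nn_integral_noteq_infinite) (use sq_moment_measurable[OF sn K] E in \<open>auto simp: top_unique\<close>)
  have kn: "(\<integral>\<^sup>+r. ennreal (k r) \<partial>lborel) \<le> ennreal E"
  proof -
    have "(\<integral>\<^sup>+r. ennreal (k r) \<partial>lborel) = (\<integral>\<^sup>+s. sq_moment (\<nu> s) * indicator {0..T} s \<partial>lborel)"
      using fin by (intro nn_integral_cong_AE) (auto simp: k_def less_top elim!: eventually_mono)
    then show ?thesis using E by simp
  qed
  have ki: "integrable lborel k"
    by (rule integrableI_nonneg) (use kn k0 in \<open>auto intro: le_less_trans\<close>)
  have kset: "set_integrable lborel S k" if "S \<in> sets borel" for S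
    using integrable_mult_indicator[OF _ ki, of S] that by (simp add: set_integrable_def)
  have kE: "(LINT r:{0..t}|lborel. k r) \<le> E" for t
  proof -
    have "(LINT r:{0..t}|lborel. k r) \<le> (LINT r|lborel. k r)"
      unfolding set_lebesgue_integral_def
      by (intro integral_mono ki kset[unfolded set_integrable_def]) (auto simp: indicator_def k0)
    also have "ennreal (LINT r|lborel. k r) \<le> ennreal E"
      using kn by (subst nn_integral_eq_integral[symmetric]) (use ki k0 in auto)
    then have "(LINT r|lborel. k r) \<le> E" using E by simp
    finally show ?thesis .
  qed
  have hb: "0 \<le> h r" "h r \<le> c" if "r \<in> {0..T}" for r
    unfolding h_def using excess_wt_bounds[OF wcm[OF that] wcn[OF that]] .
  have kh: "set_integrable lborel {0..T} (\<lambda>r. k r * h r)"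
    unfolding set_integrable_def
  proof (rule Bochner_Integration.integrable_bound[where f="\<lambda>r. c * k r"])
    show "integrable lborel (\<lambda>r. c * k r)" using ki by simp
    have "(\<lambda>r. k r * (indicator {0..T} r * h r)) \<in> borel_measurable lborel"
      using excess_measurable[OF sn sm K, folded h_def] by simp
    then show "(\<lambda>r. indicator {0..T} r *\<^sub>R (k r * h r)) \<in> borel_measurable lborel"
      by (simp add: mult_ac)
    have "\<bar>indicator {0..T} r *\<^sub>R (k r * h r)\<bar> \<le> c * k r" for r
      using hb[of r] k0[of r] c0 by (auto simp: indicator_def abs_mult mult.commute[of "k r"] intro!: mult_right_mono)
    then show "AE r in lborel. norm (indicator {0..T} r *\<^sub>R (k r * h r)) \<le> norm (c * k r)"
      using c0 k0 by simp
  qed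
  have gset: "set_integrable lborel {0..T} (g n)" for n
    unfolding g_def[abs_def] by (intro borel_integrable_atLeastAtMost' sq_cutoff_continuous[OF sn K])
  \<comment> \<open>\<open>F n\<close> bounds the rate at cutoff \<open>n\<close>, its last summand
    being the tail of the second moment; \<open>G\<close> is what remains when \<open>n\<close>
    tends to infinity.\<close>
  define F where "F n r = (e1 + e2) + (6 * c * \<delta>) * k r + (12 * c) * (k r * h r) + c\<^sup>2 * (k r - g n r)" for n r
  define G where "G r = (e1 + e2) + (6 * c * \<delta>) * k r + (12 * c) * (k r * h r)" for r
  have Gset: "set_integrable lborel {0..T} G"
    unfolding G_def[abs_def]
    by (intro set_integral_add set_integrable_mult_right set_integrable_const_Icc kset kh) auto
  have Fset: "set_integrable lborel {0..T} (F n)" for n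
    unfolding F_def[abs_def]
    by (intro set_integral_add set_integral_diff set_integrable_mult_right set_integrable_const_Icc kset kh gset) auto
  have cut: "excess (wtR (real n)) (\<nu> t) (\<mu> t) - excess (wtR (real n)) (\<nu> 0) (\<mu> 0) \<le> (LINT r:{0..t}|lborel. F n r)"
    if t: "t \<in> {0..T}" for n t
  proof -
    \<comment> \<open>Grows with the cutoff \<open>n\<close>, which is harmless because
      \<open>n\<close> stays fixed while the partition of the time interval is refined.\<close>
    define C where "C = 2 * c\<^sup>2 * (1 + real n) * (e1 + e2 + 4 * (1 + real n) * c ^ 3)"
    have C0: "0 \<le> C" unfolding C_def using c0 e0 by simp
    have inc: "excess (wtR (real n)) (\<nu> t) (\<mu> t) - excess (wtR (real n)) (\<nu> s) (\<mu> s)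
       \<le> (LINT r:{0..t}|lborel. F n r) - (LINT r:{0..s}|lborel. F n r) + C * (t - s)\<^sup>2"
      if st: "0 \<le> s" "s \<le> t" "t \<le> T" for s t
    proof -
      have tT: "t \<in> {0..T}" "s \<in> {0..T}" using st by auto
      obtain A where A: "hahn_set (\<nu> t) (\<mu> t) A" using hahn_set_exists[OF wcm wcn] tT by metis
      note [measurable] = hahn_setD(1)[OF A]
      define f where "f x = wtR (real n) x * indicator A x" for x
      have fm: "f \<in> borel_measurable borel" unfolding f_def by measurable
      have fb: "0 \<le> f x" "f x \<le> wtR (real n) x" for x by (auto simp: f_def indicator_def wtR_bounds)
      have f: "tests f" by (rule testsI[OF fm, where R="real n"]) (use fb in simp)
      have qi: "set_integrable lborel {s<..t} (q1 f)" "set_integrable lborel {s<..t} (q2 f)"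
        using st by (auto intro!: set_integrable_subset[OF approx_solution_integrable[OF sn f]]
            set_integrable_subset[OF approx_solution_integrable[OF sm f]])
      have "excess (wtR (real n)) (\<nu> t) (\<mu> t) = (LINT x|\<nu> t. f x) - (LINT x|\<mu> t. f x)"
        unfolding f_def by (rule hahn_setD(4)[OF A, where C=1]) (auto simp: wtR_bounds)
      moreover have "(LINT x|\<nu> s. f x) - (LINT x|\<mu> s. f x) \<le> excess (wtR (real n)) (\<nu> s) (\<mu> s)"
        by (rule excess_upper[OF wcm[OF tT(2)] wcn[OF tT(2)] wtR_measurable wtR_bounds(3) fm fb])
      ultimately have "excess (wtR (real n)) (\<nu> t) (\<mu> t) - excess (wtR (real n)) (\<nu> s) (\<mu> s)
         \<le> ((LINT x|\<nu> t. f x) - (LINT x|\<nu> s. f x)) - ((LINT x|\<mu> t. f x) - (LINT x|\<mu> s. f x))"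
        by linarith
      also have "\<dots> = (LINT r:{s<..t}|lborel. q1 f r - q2 f r)"
        using approx_solution_increment[OF sn f st] approx_solution_increment[OF sm f st] qi by simp
      also have "\<dots> \<le> (LINT r:{s<..t}|lborel. F n r + C * (t - s))"
      proof (rule set_integral_mono_AE)
        show "set_integrable lborel {s<..t} (\<lambda>r. q1 f r - q2 f r)" using qi by auto
        show "set_integrable lborel {s<..t} (\<lambda>r. F n r + C * (t - s))"
          using st by (intro set_integral_add set_integrable_subset[OF Fset] set_integrable_subset[OF set_integrable_const_Icc[of 0 T]]) auto
        show "AE r\<in>{s<..t} in lborel. q1 f r - q2 f r \<le> F n r + C * (t - s)"
          using fin
        proof (eventually_elim, intro impI)
          fix r assume fr: "sq_moment (\<nu> r) * indicator {0..T} r \<noteq> \<infinity>" and r: "r \<in> {s<..t}"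
          have rT: "r \<in> {0..T}" "0 \<le> r" "r \<le> t" using r st by auto
          then have fr': "sq_moment (\<nu> r) < \<infinity>" "enn2real (sq_moment (\<nu> r)) = k r"
            using fr by (auto simp: k_def less_top)
          have "q1 f r - q2 f r \<le> e1 + e2 + 6 * k r * c * (2 * h r + \<delta>) + c\<^sup>2 * (k r - g n r) + C * (t - r)"
            using stability_pointwise[OF sn sm K of_nat_0_le_iff[of n] rT(2,3) st(3) A mass[OF rT(1)] fr'(1), folded f_def[abs_def]]
            unfolding C_def g_def h_def fr'(2) .
          also have "\<dots> = F n r + C * (t - r)" by (simp add: F_def algebra_simps)
          also have "\<dots> \<le> F n r + C * (t - s)" using C0 r by (intro add_left_mono mult_left_mono) auto
          finally show "q1 f r - q2 f r \<le> F n r + C * (t - s)" .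
        qed
      qed
      also have "\<dots> = (LINT r:{s<..t}|lborel. F n r) + C * (t - s)\<^sup>2"
      proof -
        have c: "set_integrable lborel {s<..t} (\<lambda>r. C * (t - s))" "(LINT r:{s<..t}|lborel. C * (t - s)) = C * (t - s)\<^sup>2"
          using st by (simp_all add: set_integrable_def set_lebesgue_integral_def power2_eq_square)
        have "{s<..t} \<subseteq> {0..T}" using st by auto
        from set_integral_add(2)[OF set_integrable_subset[OF Fset[of n] _ this] c(1)]
        show ?thesis unfolding c(2) by simp
      qed
      also have "(LINT r:{s<..t}|lborel. F n r) = (LINT r:{0..t}|lborel. F n r) - (LINT r:{0..s}|lborel. F n r)"
        using set_integral_split[OF Fset st] by simp
      finally show ?thesis .
    qed
    have "excess (wtR (real n)) (\<nu> t) (\<mu> t) - excess (wtR (real n)) (\<nu> 0) (\<mu> 0)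
      \<le> (LINT r:{0..t}|lborel. F n r) - (LINT r:{0..0}|lborel. F n r)"
      by (rule telescoping_increments[where h="\<lambda>t. excess (wtR (real n)) (\<nu> t) (\<mu> t)" and H="\<lambda>t. LINT r:{0..t}|lborel. F n r", OF inc])
        (use t in auto)
    then show ?thesis by simp
  qed
  have glim: "(\<lambda>n. g n r) \<longlonglongrightarrow> k r" "g n r \<le> k r" "0 \<le> g n r"
    if "r \<in> {0..T}" "sq_moment (\<nu> r) < \<infinity>" for r n
  proof -
    note i = sq_moment_finiteD[OF wcn[OF that(1)] that(2)]
    have kr: "k r = (LINT x|\<nu> r. (wt x)\<^sup>2)" using that(1) i(2) by (simp add: k_def)
    show "(\<lambda>n. g n r) \<longlonglongrightarrow> k r"
      unfolding g_def kr sq_cutoff(4) by (rule integral_cutoff_tendsto[OF wclass_sets[OF wcn[OF that(1)]] i(1)])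
    show "g n r \<le> k r"
      unfolding g_def kr
    proof (rule integral_mono[OF _ i(1)])
      show "integrable (\<nu> r) (\<lambda>x. wt x * wtR (real n) x)"
        by (rule Bochner_Integration.integrable_bound[OF i(1)])
          (auto simp: sq_cutoff(4) measurable_cong_sets[OF wclass_sets[OF wcn[OF that(1)]] refl] indicator_def)
    qed (auto simp: sq_cutoff(4) indicator_def)
    show "0 \<le> g n r" unfolding g_def by (intro integral_nonneg_AE) (auto simp: wtR_bounds)
  qed
  have main: "h t \<le> h 0 + (LINT r:{0..t}|lborel. G r)" if t: "t \<in> {0..T}" for t
  proof -
    have s: "set_integrable lborel {0..t} f" if "set_integrable lborel {0..T} f" for f :: "real \<Rightarrow> real"
      using t by (intro set_integrable_subset[OF that]) auto
    have "(\<lambda>n. LINT r:{0..t}|lborel. k r - g n r) \<longlonglongrightarrow> (LINT r:{0..t}|lborel. 0)"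
      unfolding set_lebesgue_integral_def
    proof (rule integral_dominated_convergence[where w=k])
      show "(\<lambda>r. indicator {0..t} r *\<^sub>R (k r - g n r)) \<in> borel_measurable lborel" for n
        using set_integral_diff(1)[OF kset s[OF gset[of n]]]
        unfolding set_integrable_def by (intro borel_measurable_integrable) auto
      show "AE r in lborel. (\<lambda>n. indicator {0..t} r *\<^sub>R (k r - g n r)) \<longlonglongrightarrow> indicator {0..t} r *\<^sub>R 0"
        using fin
      proof eventually_elim
        case (elim r)
        show ?case
        proof (cases "r \<in> {0..t}")
          case True
          then have r: "r \<in> {0..T}" "sq_moment (\<nu> r) < \<infinity>" using t elim by (auto simp: less_top)
          have "(\<lambda>n. k r - g n r) \<longlonglongrightarrow> k r - k r" by (intro tendsto_intros glim r)
          then show ?thesis using True by simp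
        qed simp
      qed
      show "AE r in lborel. norm (indicator {0..t} r *\<^sub>R (k r - g n r)) \<le> k r" for n
        using fin
      proof eventually_elim
        case (elim r)
        show ?case
        proof (cases "r \<in> {0..t}")
          case True
          then have r: "r \<in> {0..T}" "sq_moment (\<nu> r) < \<infinity>" using t elim by (auto simp: less_top)
          then show ?thesis using True glim(2,3)[OF r, of n] by simp
        qed (simp add: k0)
      qed
    qed (use ki in auto)
    then have lim0: "(\<lambda>n. LINT r:{0..t}|lborel. k r - g n r) \<longlonglongrightarrow> 0" by (simp add: set_lebesgue_integral_def)
    have "(LINT r:{0..t}|lborel. F n r) = (LINT r:{0..t}|lborel. G r) + c\<^sup>2 * (LINT r:{0..t}|lborel. k r - g n r)" for n
    proof -
      have "F n = (\<lambda>r. G r + c\<^sup>2 * (k r - g n r))" by (auto simp: F_def G_def fun_eq_iff)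
      moreover have "set_integrable lborel {0..t} (\<lambda>r. c\<^sup>2 * (k r - g n r))"
        by (intro set_integrable_mult_right set_integral_diff kset s[OF gset]) auto
      ultimately show ?thesis using set_integral_add(2)[OF s[OF Gset]] by simp
    qed
    then have "(\<lambda>n. LINT r:{0..t}|lborel. F n r) \<longlonglongrightarrow> (LINT r:{0..t}|lborel. G r) + c\<^sup>2 * 0"
      using tendsto_add[OF tendsto_const tendsto_mult[OF tendsto_const lim0]] by simp
    then have R: "(\<lambda>n. LINT r:{0..t}|lborel. F n r) \<longlonglongrightarrow> (LINT r:{0..t}|lborel. G r)" by simp
    have z: "0 \<in> {0..T}" using T by simp
    have L: "(\<lambda>n. excess (wtR (real n)) (\<nu> t) (\<mu> t) - excess (wtR (real n)) (\<nu> 0) (\<mu> 0)) \<longlonglongrightarrow> h t - h 0"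
      unfolding h_def by (intro tendsto_diff excess_cutoff_tendsto[OF wcm wcn] t z)
    have "h t - h 0 \<le> (LINT r:{0..t}|lborel. G r)"
      by (rule LIMSEQ_le[OF L R]) (use cut[OF t] in auto)
    then show ?thesis by simp
  qed
  define a where "a = h 0 + (e1 + e2) * T + 6 * c * \<delta> * E"
  have ha: "h t \<le> a + (LINT r:{0..t}|lborel. (12 * c * k r) * h r)" if t: "t \<in> {0..T}" for t
  proof -
    have s: "set_integrable lborel {0..t} f" if "set_integrable lborel {0..T} f" for f :: "real \<Rightarrow> real"
      using t by (intro set_integrable_subset[OF that]) auto
    have "(LINT r:{0..t}|lborel. G r) = (LINT r:{0..t}|lborel. (e1 + e2)) + (6 * c * \<delta>) * (LINT r:{0..t}|lborel. k r)
        + (LINT r:{0..t}|lborel. 12 * c * (k r * h r))"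
    proof -
      have 1: "set_integrable lborel {0..t} (\<lambda>r. e1 + e2)" "set_integrable lborel {0..t} (\<lambda>r. 6 * c * \<delta> * k r)"
        "set_integrable lborel {0..t} (\<lambda>r. 12 * c * (k r * h r))"
        by (intro set_integrable_const_Icc set_integrable_mult_right kset s[OF kh]; simp)+
      show ?thesis unfolding G_def[abs_def]
        using set_integral_add(2)[OF set_integral_add(1)[OF 1(1,2)] 1(3)] set_integral_add(2)[OF 1(1,2)] by simp
    qed
    also have "(LINT r:{0..t}|lborel. (e1 + e2)) = (e1 + e2) * t"
      using t by (simp add: set_lebesgue_integral_def)
    also have "(e1 + e2) * t + 6 * c * \<delta> * (LINT r:{0..t}|lborel. k r) + (LINT r:{0..t}|lborel. 12 * c * (k r * h r))
      \<le> (e1 + e2) * T + 6 * c * \<delta> * E + (LINT r:{0..t}|lborel. (12 * c * k r) * h r)"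
      using t e0 c0 \<delta> kE[of t] by (intro add_mono mult_left_mono) (auto simp: mult.assoc)
    finally show ?thesis using main[OF t] by (simp add: a_def)
  qed
  have "h t \<le> a * 2 ^ n"
  proof (rule gronwall_linear[of T "\<lambda>r. 12 * c * k r" h])
    show "set_integrable lborel {0..T} (\<lambda>r. 12 * c * k r)" by (intro set_integrable_mult_right kset) auto
    show "set_integrable lborel {0..T} (\<lambda>r. 12 * c * k r * h r)"
      using set_integrable_mult_right[of "12 * c", OF kh] by (simp add: mult.assoc)
    have "(LINT r:{0..t}|lborel. 12 * c * k r) = 12 * c * (LINT r:{0..t}|lborel. k r)" by (rule set_integral_mult_right)
    also have "\<dots> \<le> 12 * c * E" using kE[of t] c0 by (intro mult_left_mono) auto
    finally show "(LINT r:{0..t}|lborel. 12 * c * k r) \<le> real n / 2" using n by simp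
  qed (use k0 c0 hb ha t in auto)
  then show ?thesis by (simp add: h_def a_def)
qed

section \<open>Conservation laws\<close>

text \<open>\<open>K\<close> is continuous on the closed octant and arbitrary elsewhere. Hence the
  octant indicator comes first, to obtain a measurable function on the whole space, and the
  indicator of the closed set \<open>dom_D\<close> second.\<close>

lemma admissible_model_kernel:
  assumes "model_kernel lam K" "sub_multiplicative K"
  shows "admissible K"
  unfolding admissible_def
proof (intro conjI allI)
  have c: "continuous_on ({0..} \<times> {0..} \<times> {0..}) (\<lambda>(x, y, z). K x y z)"
    using assms(1) by (simp add: model_kernel_def)
  have cl: "closed ({0..} \<times> {0..} \<times> {0..} :: (real \<times> real \<times> real) set)"
    by (intro closed_Times closed_atLeast)
  have m: "(\<lambda>p. indicator ({0..} \<times> {0..} \<times> {0..}) p *\<^sub>R (case p of (x, y, z) \<Rightarrow> K x y z)) \<in> borel_measurable borel"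
    by (rule borel_measurable_continuous_on_indicator[OF borel_closed[OF cl] c])
  have D: "closed dom_D"
  proof -
    have Deq: "dom_D = {p. 0 \<le> fst p} \<inter> {p. 0 \<le> fst (snd p)} \<inter> {p. 0 \<le> snd (snd p)} \<inter> {p. snd (snd p) \<le> fst p + fst (snd p)}"
      by (auto simp: dom_D_def)
    show ?thesis
      unfolding Deq by (intro closed_Int closed_Collect_le continuous_intros)
  qed
  have "(\<lambda>p. indicator dom_D p * (indicator ({0..} \<times> {0..} \<times> {0..}) p *\<^sub>R (case p of (x, y, z) \<Rightarrow> K x y z))) \<in> borel_measurable borel"
    by (intro borel_measurable_times m borel_measurable_indicator borel_closed D)
  also have "(\<lambda>p. indicator dom_D p * (indicator ({0..} \<times> {0..} \<times> {0..}) p *\<^sub>R (case p of (x, y, z) \<Rightarrow> K x y z))) = (\<lambda>(x, y, z). restr K x y z)"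
    by (auto simp: fun_eq_iff restr_def dom_D_def indicator_def)
  finally show "(\<lambda>(x, y, z). restr K x y z) \<in> borel_measurable (borel \<Otimes>\<^sub>M (borel \<Otimes>\<^sub>M borel))"
    by (simp add: borel_prod)
  fix x y z :: real
  show "0 \<le> restr K x y z"
    using assms(1) by (auto simp: restr_def dom_D_def model_kernel_def indicator_def)
  show "restr K x y z \<le> wt x * wt y * wt z"
    using assms(2) by (auto simp: restr_def dom_D_def sub_multiplicative_def indicator_def wt_eq_phi)
qed

lemma moment_phi_sq:
  assumes "measure_on_Rplus \<mu>"
  shows "moment (\<lambda>x. (phi x)\<^sup>2) \<mu> = sq_moment \<mu>"
  unfolding moment_def sq_moment_def
  using AE_nonneg[OF assms] by (intro nn_integral_cong_AE) (auto simp: wt_eq_phi)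

lemma wclassI:
  assumes "measure_on_Rplus \<mu>" "moment phi \<mu> \<le> ennreal c" "0 \<le> c"
  shows "wclass c \<mu>"
  using assms nn_wt_eq_moment[OF assms(1)] by (simp add: wclass_def)

lemma moment_id:
  assumes "wclass c \<mu>"
  shows "moment (\<lambda>x. x) \<mu> = ennreal (LINT x|\<mu>. \<bar>x\<bar>)"
proof -
  have "moment (\<lambda>x. x) \<mu> = (\<integral>\<^sup>+x. ennreal \<bar>x\<bar> \<partial>\<mu>)"
    unfolding moment_def using wclass_AE[OF assms] by (intro nn_integral_cong_AE) auto
  also have "\<dots> = ennreal (LINT x|\<mu>. \<bar>x\<bar>)"
    by (intro nn_integral_eq_integral wclass_integrable[OF assms, where C=1]) (auto simp: wt_def)
  finally show ?thesis .
qed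

lemma moment_phi:
  assumes "wclass c \<mu>"
  shows "moment phi \<mu> = ennreal (LINT x|\<mu>. wt x)"
  using assms nn_wt_eq_moment[of \<mu>] nn_integral_eq_integral[OF wclass_integrable_wt[OF assms]]
  by (simp add: wclass_def)

lemma tests_test_function:
  assumes "tests f" shows "test_function f"
proof -
  obtain R where R: "\<And>x. \<bar>x\<bar> > R \<Longrightarrow> f x = 0" using assms by (auto simp: tests_def)
  have "\<bar>f x\<bar> \<le> 1 + \<bar>R\<bar>" for x
  proof (cases "\<bar>x\<bar> > R")
    case False
    have "\<bar>f x\<bar> \<le> wt x" using assms by (simp add: tests_def)
    then show ?thesis using False by (simp add: wt_def)
  qed (simp add: R)
  then show ?thesis using assms unfolding tests_def test_function_def by blast
qed

lemma local_solution_initial: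
  assumes "local_solution K \<mu>0 T \<mu>" "test_function f"
  shows "(LINT x|\<mu> 0. f x) = (LINT x|\<mu>0. f x)"
proof -
  have "0 \<in> times T" using assms(1) by (simp add: times_def local_solution_def)
  then have "(LINT x|\<mu> 0. f x) = (LINT x|\<mu>0. f x) + (LINT s:{0..0}|lborel. Q_pair K (\<mu> s) f)"
    using assms unfolding local_solution_def satisfies_kinetic_eq_def by blast
  then show ?thesis by simp
qed

lemma times_mono: "t \<in> times T \<Longrightarrow> 0 \<le> s \<Longrightarrow> s \<le> t \<Longrightarrow> s \<in> times T"
  unfolding times_def using le_less_trans[OF ennreal_leI] by blast

text \<open>Every compact interval inside the lifetime carries an approximate solution without
  error. Its own value \<open>\<mu> 0\<close> takes the place of \<open>\<mu>0\<close>, with which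
  it agrees on test functions.\<close>

lemma local_solution_approx:
  assumes sol: "local_solution K \<mu>0 T \<mu>" and c: "moment phi \<mu>0 \<le> ennreal c" "0 \<le> c" and t: "t \<in> times T"
  shows "approx_solution K c t 0 \<mu> (\<lambda>f s. Q_pair K (\<mu> s) f)"
  unfolding approx_solution_def
proof (intro conjI ballI allI impI)
  fix s assume s: "s \<in> {0..t}"
  then have sT: "s \<in> times T" using times_mono[OF t] by simp
  then show "wclass c (\<mu> s)"
    using sol c unfolding local_solution_def by (intro wclassI) (blast intro: order_trans)+
  fix f assume f: "tests f"
  show "(LINT x|\<mu> s. f x) = (LINT x|\<mu> 0. f x) + (LINT r:{0..s}|lborel. Q_pair K (\<mu> r) f)"
    unfolding local_solution_initial[OF sol tests_test_function[OF f]]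
    using sol sT tests_test_function[OF f] unfolding local_solution_def satisfies_kinetic_eq_def by blast
next
  fix f assume f: "tests f"
  show "set_integrable lborel {0..t} (\<lambda>s. Q_pair K (\<mu> s) f)"
    using sol t tests_test_function[OF f] unfolding local_solution_def satisfies_kinetic_eq_def by blast
qed simp

section \<open>Collision terms dominated by a single squared weight\<close>

lemma triple_sq_integrable:
  assumes mu: "wclass c \<mu>" and sq: "integrable \<mu> (\<lambda>x. (wt x)\<^sup>2)"
  shows "integrable (triple \<mu>) (\<lambda>(x, y, z). wt x * wt y * wt z * (wt x + wt y))"
    and "(LINT (x, y, z)|triple \<mu>. wt x * wt y * wt z * (wt x + wt y)) \<le> 2 * (LINT x|\<mu>. (wt x)\<^sup>2) * c\<^sup>2"
proof -
  interpret finite_measure \<mu> by (rule wclass_finite[OF mu])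
  note w = wclass_integrable_wt[OF mu]
  note p = triple_product[OF sigma_finite_measure_axioms sq w w] triple_product[OF sigma_finite_measure_axioms w sq w]
  have e: "(\<lambda>(x, y, z). wt x * wt y * wt z * (wt x + wt y)) = (\<lambda>p. (case p of (x, y, z) \<Rightarrow> (wt x)\<^sup>2 * wt y * wt z) + (case p of (x, y, z) \<Rightarrow> wt x * (wt y)\<^sup>2 * wt z))"
    by (auto simp: fun_eq_iff algebra_simps power2_eq_square)
  show "integrable (triple \<mu>) (\<lambda>(x, y, z). wt x * wt y * wt z * (wt x + wt y))"
    unfolding e using p by (intro Bochner_Integration.integrable_add) auto
  let ?k = "LINT x|\<mu>. (wt x)\<^sup>2" and ?P = "LINT x|\<mu>. wt x"
  have "(LINT (x, y, z)|triple \<mu>. wt x * wt y * wt z * (wt x + wt y)) = ?k * ?P * ?P + ?P * ?k * ?P"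
    unfolding e using p by (subst Bochner_Integration.integral_add) auto
  also have "\<dots> = 2 * ?k * (?P * ?P)" by (simp add: algebra_simps)
  also have "\<dots> \<le> 2 * ?k * (c * c)"
    using wclass_integral_wt[OF mu] wclass_c_nonneg[OF mu] by (intro mult_left_mono mult_mono) (auto intro!: integral_nonneg_AE)
  finally show "(LINT (x, y, z)|triple \<mu>. wt x * wt y * wt z * (wt x + wt y)) \<le> 2 * ?k * c\<^sup>2"
    by (simp add: power2_eq_square)
qed

lemma collision_measurable:
  assumes mu: "wclass c \<mu>" and K: "admissible K" and f [measurable]: "f \<in> borel_measurable borel"
  shows "(\<lambda>(x, y, z). restr K x y z * gain_loss f x y z) \<in> borel_measurable (triple \<mu>)"
proof -
  have [measurable]: "(\<lambda>(x, y, z). restr K x y z) \<in> borel_measurable (borel \<Otimes>\<^sub>M (borel \<Otimes>\<^sub>M borel))"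
    using K by (simp add: admissible_def)
  have "(\<lambda>p. (case p of (x, y, z) \<Rightarrow> restr K x y z) * gain_loss f (fst p) (fst (snd p)) (snd (snd p)))
      \<in> borel_measurable (borel \<Otimes>\<^sub>M (borel \<Otimes>\<^sub>M borel))"
    unfolding gain_loss_def by measurable
  moreover have ss: "sets (triple \<mu>) = sets (borel \<Otimes>\<^sub>M (borel \<Otimes>\<^sub>M borel))"
    by (intro sets_pair_measure_cong wclass_sets[OF mu])
  ultimately show ?thesis unfolding measurable_cong_sets[OF ss refl] by (simp add: case_prod_beta')
qed

text \<open>Both sides of a collision carry the same total weight, so a function below
  \<open>wt\<close> in modulus has a bracket of at most twice that total. After multiplication by
  the kernel bound, only one of the first two weights is squared in each term.\<close>

lemma gain_loss_le:
  assumes "restr K x y z \<noteq> 0" "\<And>x. \<bar>f x\<bar> \<le> wt x"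
  shows "\<bar>gain_loss f x y z\<bar> \<le> 2 * (wt x + wt y)"
proof -
  have b: "f w \<le> wt w" "- wt w \<le> f w" for w using assms(2)[of w] by linarith+
  define w where "w = x + y - z"
  have "wt w + wt z = wt x + wt y" using restr_nonzeroD(5)[OF assms(1)] by (simp only: w_def)
  moreover have "f w \<le> wt w" "f x \<le> wt x" "f y \<le> wt y" "f z \<le> wt z"
    "- wt w \<le> f w" "- wt x \<le> f x" "- wt y \<le> f y" "- wt z \<le> f z"
    by (rule b)+
  ultimately have "f w + f z - f y - f x \<le> 2 * (wt x + wt y)" "- (f w + f z - f y - f x) \<le> 2 * (wt x + wt y)"
    by argo+
  then show ?thesis unfolding gain_loss_def w_def by (rule abs_leI)
qed

lemma collision_le:
  assumes K: "admissible K" and "\<And>x. \<bar>f x\<bar> \<le> wt x"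
  shows "\<bar>restr K x y z * gain_loss f x y z\<bar> \<le> 2 * (wt x * wt y * wt z * (wt x + wt y))"
proof (cases "restr K x y z = 0")
  case False
  have "\<bar>restr K x y z * gain_loss f x y z\<bar> \<le> (wt x * wt y * wt z) * (2 * (wt x + wt y))"
    unfolding abs_mult using admissible_nonneg[OF K] admissible_le[OF K] gain_loss_le[OF False assms(2)]
    by (intro mult_mono) auto
  then show ?thesis by (simp only: mult_ac)
qed (simp add: add_nonneg_nonneg)

lemma Q_pair_sq_bound:
  assumes mu: "wclass c \<mu>" and sq: "integrable \<mu> (\<lambda>x. (wt x)\<^sup>2)" and K: "admissible K"
    and f: "f \<in> borel_measurable borel" "\<And>x. \<bar>f x\<bar> \<le> wt x"
  shows "\<bar>Q_pair K \<mu> f\<bar> \<le> 2 * c\<^sup>2 * (LINT x|\<mu>. (wt x)\<^sup>2)"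
proof -
  note d = triple_sq_integrable[OF mu sq]
  let ?d = "\<lambda>(x, y, z). wt x * wt y * wt z * (wt x + wt y)"
  have "\<bar>LINT (x, y, z)|triple \<mu>. restr K x y z * gain_loss f x y z\<bar> \<le> (LINT p|triple \<mu>. 2 * ?d p)"
  proof (rule integral_abs_bound_integral)
    show i: "integrable (triple \<mu>) (\<lambda>p. 2 * ?d p)" using d(1) by simp
    show b: "\<bar>case p of (x, y, z) \<Rightarrow> restr K x y z * gain_loss f x y z\<bar> \<le> 2 * ?d p" for p
      using collision_le[OF K f(2)] by (auto split: prod.split)
    show "integrable (triple \<mu>) (\<lambda>(x, y, z). restr K x y z * gain_loss f x y z)"
      by (rule Bochner_Integration.integrable_bound[OF i collision_measurable[OF mu K f(1)]])
        (use b order_trans[OF _ abs_ge_self] in \<open>auto simp del: split_paired_All\<close>)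
  qed
  also have "\<dots> = 2 * (LINT p|triple \<mu>. ?d p)" by (rule integral_mult_right_zero)
  also have "\<dots> \<le> 2 * (2 * (LINT x|\<mu>. (wt x)\<^sup>2) * c\<^sup>2)" using d(2) by (intro mult_left_mono) auto
  finally have "\<bar>LINT (x, y, z)|triple \<mu>. restr K x y z * gain_loss f x y z\<bar> \<le> 2 * (2 * c\<^sup>2 * (LINT x|\<mu>. (wt x)\<^sup>2))"
    by (simp only: mult_ac)
  then show ?thesis unfolding Q_pair_eq abs_mult by simp
qed

text \<open>For affine \<open>g\<close> the collision bracket vanishes identically, so only the truncation contributes.\<close>

lemma Q_pair_cutoff_tendsto:
  assumes mu: "wclass c \<mu>" and sq: "integrable \<mu> (\<lambda>x. (wt x)\<^sup>2)" and K: "admissible K" and a: "0 \<le> a" "a \<le> 1"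
  shows "(\<lambda>n. Q_pair K \<mu> (\<lambda>x. (a + \<bar>x\<bar>) * indicator {x. \<bar>x\<bar> \<le> real n} x)) \<longlonglongrightarrow> 0"
proof -
  let ?f = "\<lambda>n x. (a + \<bar>x\<bar>) * indicator {x. \<bar>x\<bar> \<le> real n} x"
  let ?d = "\<lambda>(x, y, z). wt x * wt y * wt z * (wt x + wt y)"
  have fm: "?f n \<in> borel_measurable borel" for n by measurable
  have fb: "\<bar>?f n x\<bar> \<le> wt x" for n x using a by (auto simp: indicator_def wt_def)
  have "(\<lambda>n. LINT p|triple \<mu>. (case p of (x, y, z) \<Rightarrow> restr K x y z * gain_loss (?f n) x y z)) \<longlonglongrightarrow> (LINT p|triple \<mu>. 0)"
  proof (rule integral_dominated_convergence[where w="\<lambda>p. 2 * ?d p"])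
    show "integrable (triple \<mu>) (\<lambda>p. 2 * ?d p)" using triple_sq_integrable(1)[OF mu sq] by simp
    show "(\<lambda>(x, y, z). restr K x y z * gain_loss (?f n) x y z) \<in> borel_measurable (triple \<mu>)" for n
      by (rule collision_measurable[OF mu K fm])
    show "AE p in triple \<mu>. norm (case p of (x, y, z) \<Rightarrow> restr K x y z * gain_loss (?f n) x y z) \<le> 2 * ?d p" for n
      using collision_le[OF K fb] by (intro AE_I2) (auto split: prod.split)
    show "AE p in triple \<mu>. (\<lambda>n. case p of (x, y, z) \<Rightarrow> restr K x y z * gain_loss (?f n) x y z) \<longlonglongrightarrow> 0"
    proof (intro AE_I2)
      fix p :: "real \<times> real \<times> real"
      obtain x y z where p: "p = (x, y, z)" by (metis prod.exhaust)
      obtain N where N: "\<bar>x\<bar> + \<bar>y\<bar> + \<bar>z\<bar> \<le> real N" using real_arch_simple by blast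
      have "restr K x y z * gain_loss (?f n) x y z = 0" if "n \<ge> N" for n
      proof (cases "restr K x y z = 0")
        case False
        have "real N \<le> real n" using that by simp
        then have "\<bar>x\<bar> \<le> real n" "\<bar>y\<bar> \<le> real n" "\<bar>z\<bar> \<le> real n" "\<bar>x + y - z\<bar> \<le> real n" using N by linarith+
        then show ?thesis using restr_nonzeroD[OF False] by (simp add: gain_loss_def)
      qed simp
      then show "(\<lambda>n. case p of (x, y, z) \<Rightarrow> restr K x y z * gain_loss (?f n) x y z) \<longlonglongrightarrow> 0"
        unfolding p by (intro tendsto_eventually) (auto simp: eventually_sequentially)
    qed
  qed simp
  then show ?thesis unfolding Q_pair_eq by (auto intro!: tendsto_eq_intros)
qed

text \<open>Strength controls the second moment in time average only, so it is finite at almost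
  every time, and what is shown at single times has to be integrated afterwards.\<close>

lemma sq_moment_AE:
  assumes sol: "approx_solution K c T e \<mu> q" and K: "admissible K"
    and fin: "(\<integral>\<^sup>+s. sq_moment (\<mu> s) * indicator {0..T} s \<partial>lborel) < \<infinity>"
  shows "AE s in lborel. s \<in> {0..T} \<longrightarrow> sq_moment (\<mu> s) < \<infinity>"
    and "integrable lborel (\<lambda>s. enn2real (sq_moment (\<mu> s) * indicator {0..T} s))"
proof -
  note m = sq_moment_measurable[OF sol K]
  have ae: "AE s in lborel. sq_moment (\<mu> s) * indicator {0..T} s \<noteq> \<infinity>"
    by (rule nn_integral_noteq_infinite) (use m fin in auto)
  then show "AE s in lborel. s \<in> {0..T} \<longrightarrow> sq_moment (\<mu> s) < \<infinity>"
    by eventually_elim (auto simp: less_top)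
  have "(\<integral>\<^sup>+s. ennreal (enn2real (sq_moment (\<mu> s) * indicator {0..T} s)) \<partial>lborel) = (\<integral>\<^sup>+s. sq_moment (\<mu> s) * indicator {0..T} s \<partial>lborel)"
    using ae by (intro nn_integral_cong_AE) (auto simp: less_top elim!: eventually_mono)
  then show "integrable lborel (\<lambda>s. enn2real (sq_moment (\<mu> s) * indicator {0..T} s))"
    using m fin by (intro integrableI_nonneg) (auto intro: measurable_compose[OF _ borel_measurable_enn2real])
qed

text \<open>For \<open>a = 0\<close> this concerns the energy, for \<open>a = 1\<close> the weight
  \<open>wt\<close>. Dominated convergence acts twice: at almost every time, where the collision
  term of the cutoffs tends to \<open>0\<close>, and then in time, with majorant
  \<open>2 * c\<^sup>2 * k\<close>.\<close>

lemma conservation: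
  assumes sol: "approx_solution K c T 0 \<mu> (\<lambda>f s. Q_pair K (\<mu> s) f)" and K: "admissible K" and a: "0 \<le> a" "a \<le> 1"
    and fin: "(\<integral>\<^sup>+s. sq_moment (\<mu> s) * indicator {0..T} s \<partial>lborel) < \<infinity>" and t: "t \<in> {0..T}"
  shows "(LINT x|\<mu> t. a + \<bar>x\<bar>) = (LINT x|\<mu> 0. a + \<bar>x\<bar>)"
proof -
  let ?f = "\<lambda>n x. (a + \<bar>x\<bar>) * indicator {x. \<bar>x\<bar> \<le> real n} x"
  define k where "k s = enn2real (sq_moment (\<mu> s) * indicator {0..T} s)" for s
  have wc: "wclass c (\<mu> s)" if "s \<in> {0..T}" for s using approx_solution_wclass[OF sol that] .
  have T: "0 \<in> {0..T}" using t by auto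
  have fm: "?f n \<in> borel_measurable borel" for n by measurable
  have fb: "\<bar>?f n x\<bar> \<le> wt x" for n x using a by (auto simp: indicator_def wt_def)
  have tf: "tests (?f n)" for n
    by (rule testsI[OF fm, where R="real n"]) (use a in \<open>auto simp: indicator_def wtR_def wt_def\<close>)
  note ki = sq_moment_AE(2)[OF sol K fin, folded k_def]
  note fin' = sq_moment_AE(1)[OF sol K fin]
  have "(\<lambda>n. LINT s:{0..t}|lborel. Q_pair K (\<mu> s) (?f n)) \<longlonglongrightarrow> (LINT s:{0..t}|lborel. 0)"
    unfolding set_lebesgue_integral_def
  proof (rule integral_dominated_convergence[where w="\<lambda>s. 2 * c\<^sup>2 * k s"])
    show "integrable lborel (\<lambda>s. 2 * c\<^sup>2 * k s)" using ki by simp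
    have "set_integrable lborel {0..t} (\<lambda>s. Q_pair K (\<mu> s) (?f n))" for n
      using t by (intro set_integrable_subset[OF approx_solution_integrable[OF sol tf]]) auto
    then show "(\<lambda>s. indicator {0..t} s *\<^sub>R Q_pair K (\<mu> s) (?f n)) \<in> borel_measurable lborel" for n
      unfolding set_integrable_def by (rule borel_measurable_integrable)
    show "AE s in lborel. (\<lambda>n. indicator {0..t} s *\<^sub>R Q_pair K (\<mu> s) (?f n)) \<longlonglongrightarrow> indicator {0..t} s *\<^sub>R 0"
      using fin'
    proof eventually_elim
      case (elim s)
      show ?case
      proof (cases "s \<in> {0..t}")
        case True
        then have s: "s \<in> {0..T}" using t by auto
        show ?thesis
          using True elim s Q_pair_cutoff_tendsto[OF wc[OF s] sq_moment_finiteD(1)[OF wc[OF s]] K a] by simp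
      qed simp
    qed
    show "AE s in lborel. norm (indicator {0..t} s *\<^sub>R Q_pair K (\<mu> s) (?f n)) \<le> 2 * c\<^sup>2 * k s" for n
      using fin'
    proof eventually_elim
      case (elim s)
      show ?case
      proof (cases "s \<in> {0..t}")
        case True
        then have s: "s \<in> {0..T}" using t by auto
        then have f: "sq_moment (\<mu> s) < \<infinity>" using elim by simp
        have "\<bar>Q_pair K (\<mu> s) (?f n)\<bar> \<le> 2 * c\<^sup>2 * (LINT x|\<mu> s. (wt x)\<^sup>2)"
          by (rule Q_pair_sq_bound[OF wc[OF s] sq_moment_finiteD(1)[OF wc[OF s] f] K fm fb])
        then show ?thesis using True s sq_moment_finiteD(2)[OF wc[OF s] f] by (simp add: k_def)
      qed (simp add: k_def)
    qed
  qed simp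
  then have lim0: "(\<lambda>n. LINT s:{0..t}|lborel. Q_pair K (\<mu> s) (?f n)) \<longlonglongrightarrow> 0" by (simp add: set_lebesgue_integral_def)
  have eq: "(LINT x|\<mu> t. ?f n x) = (LINT x|\<mu> 0. ?f n x) + (LINT s:{0..t}|lborel. Q_pair K (\<mu> s) (?f n))" for n
    using sol tf t unfolding approx_solution_def by blast
  have i: "integrable (\<mu> s) (\<lambda>x. a + \<bar>x\<bar>)" if "s \<in> {0..T}" for s
    by (rule wclass_integrable[OF wc[OF that], where C=1]) (use a in \<open>auto simp: wt_def\<close>)
  have l: "(\<lambda>n. LINT x|\<mu> s. ?f n x) \<longlonglongrightarrow> (LINT x|\<mu> s. a + \<bar>x\<bar>)" if "s \<in> {0..T}" for s
    by (rule integral_cutoff_tendsto[OF wclass_sets[OF wc[OF that]] i[OF that]])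
  have "(\<lambda>n. LINT x|\<mu> t. ?f n x) \<longlonglongrightarrow> (LINT x|\<mu> 0. a + \<bar>x\<bar>) + 0"
    unfolding eq by (intro tendsto_add l[OF T] lim0)
  then show ?thesis using LIMSEQ_unique[OF l[OF t]] by simp
qed

section \<open>Uniqueness and maximal solutions\<close>

text \<open>Both \<open>indicator B\<close> and \<open>wt - indicator B\<close> lie between
  \<open>0\<close> and \<open>wt\<close>. Testing with the second one and using the mass inequality
  reverses the inequality obtained from the first.\<close>

lemma measure_eq_if_excess_le_0:
  assumes mu: "wclass c \<mu>" and nu: "wclass c \<nu>" and ex: "excess wt \<nu> \<mu> \<le> 0"
    and mass: "(LINT x|\<mu>. wt x) \<le> (LINT x|\<nu>. wt x)"
  shows "\<mu> = \<nu>"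
proof (rule measure_eqI)
  show "sets \<mu> = sets \<nu>" using wclass_sets[OF mu] wclass_sets[OF nu] by simp
  fix B assume "B \<in> sets \<mu>"
  then have B [measurable]: "B \<in> sets borel" using wclass_sets[OF mu] by simp
  interpret mu: finite_measure \<mu> by (rule wclass_finite[OF mu])
  interpret nu: finite_measure \<nu> by (rule wclass_finite[OF nu])
  have le: "(LINT x|\<nu>. f x) \<le> (LINT x|\<mu>. f x)"
    if "f \<in> borel_measurable borel" "\<And>x. 0 \<le> f x" "\<And>x. f x \<le> wt x" for f
    using excess_upper[OF mu nu wt_measurable _ that, of 1] ex by simp
  have ind: "indicator B x \<le> wt x" for x :: real by (auto simp: indicator_def)
  have i: "integrable \<kappa> (indicator B :: real \<Rightarrow> real)" if "wclass c \<kappa>" for \<kappa>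
    by (rule wclass_integrable[OF that, where C=1]) (auto simp: indicator_def)
  have 1: "(LINT x|\<nu>. indicator B x :: real) \<le> (LINT x|\<mu>. indicator B x)"
    by (rule le) (use ind in auto)
  have "(LINT x|\<nu>. wt x - indicator B x) \<le> (LINT x|\<mu>. wt x - indicator B x)"
    by (rule le) (use ind in auto)
  then have 2: "(LINT x|\<mu>. indicator B x :: real) \<le> (LINT x|\<nu>. indicator B x)"
    using mass i[OF mu] i[OF nu] wclass_integrable_wt[OF mu] wclass_integrable_wt[OF nu] by simp
  have "measure \<mu> B = measure \<nu> B"
    using 1 2 wclass_space[OF mu] wclass_space[OF nu] by simp
  then show "emeasure \<mu> B = emeasure \<nu> B"
    by (simp add: mu.emeasure_eq_measure nu.emeasure_eq_measure)
qed

lemma strong_solution_sq_finite: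
  assumes "strong_solution K \<mu>0 T \<mu>" "t \<in> times T"
  shows "(\<integral>\<^sup>+s. sq_moment (\<mu> s) * indicator {0..t} s \<partial>lborel) < \<infinity>"
proof -
  have "measure_on_Rplus (\<mu> s)" if "s \<in> {0..t}" for s
    using assms(1) times_mono[OF assms(2)] that unfolding strong_solution_def local_solution_def by simp
  then have "(\<integral>\<^sup>+s. sq_moment (\<mu> s) * indicator {0..t} s \<partial>lborel) = (\<integral>\<^sup>+ s\<in>{0..t}. moment (\<lambda>x. (phi x)\<^sup>2) (\<mu> s) \<partial>lborel)"
    by (intro nn_integral_cong) (auto simp: moment_phi_sq indicator_def)
  then show ?thesis using assms unfolding strong_solution_def by simp
qed

text \<open>At time \<open>0\<close> the equation identifies \<open>\<mu> 0\<close> with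
  \<open>\<mu>0\<close> against functions of bounded support only; the total weight is recovered
  from the cutoffs.\<close>

lemma integral_wt_eq_if_tests_eq:
  assumes "wclass c \<mu>" "wclass c \<nu>" "\<And>f. tests f \<Longrightarrow> (LINT x|\<mu>. f x) = (LINT x|\<nu>. f x)"
  shows "(LINT x|\<mu>. wt x) = (LINT x|\<nu>. wt x)"
proof -
  have l: "(\<lambda>n. LINT x|\<kappa>. wtR (real n) x) \<longlonglongrightarrow> (LINT x|\<kappa>. wt x)" if "wclass c \<kappa>" for \<kappa>
    unfolding wtR_def by (rule integral_cutoff_tendsto[OF wclass_sets[OF that] wclass_integrable_wt[OF that]])
  have "tests (wtR (real n))" for n by (rule testsI[where R="real n"]) (auto simp: wtR_bounds)
  then have "(LINT x|\<mu>. wtR (real n) x) = (LINT x|\<nu>. wtR (real n) x)" for n by (rule assms(3))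
  then show ?thesis using LIMSEQ_unique[OF l[OF assms(1)]] l[OF assms(2)] by simp
qed

lemma excess_eq_0_if_tests_eq:
  assumes "wclass c \<mu>" "wclass c \<nu>" "\<And>f. tests f \<Longrightarrow> (LINT x|\<mu>. f x) = (LINT x|\<nu>. f x)"
  shows "excess wt \<nu> \<mu> = 0"
proof -
  have "excess (wtR (real n)) \<nu> \<mu> \<le> 0" for n
  proof (rule excess_least)
    fix f assume f: "f \<in> borel_measurable borel" "\<And>x. 0 \<le> f x" "\<And>x. f x \<le> wtR (real n) x"
    have "tests f" by (rule testsI[OF f(1), where R="real n"]) (use f in simp)
    then show "(LINT x|\<nu>. f x) - (LINT x|\<mu>. f x) \<le> 0" using assms(3) by simp
  qed (rule wtR_bounds)
  then have "excess wt \<nu> \<mu> \<le> 0"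
    by (intro LIMSEQ_le_const2[OF excess_cutoff_tendsto[OF assms(1,2)]]) auto
  then show ?thesis using excess_wt_bounds(1)[OF assms(1,2)] by simp
qed

lemma ennreal_moment_finite:
  assumes "moment phi \<mu>0 < \<infinity>"
  obtains c where "moment phi \<mu>0 = ennreal c" "0 \<le> c"
  using assms by (cases "moment phi \<mu>0") auto

lemma uniqueness:
  assumes K: "admissible K" and m0: "measure_on_Rplus \<mu>0" "moment phi \<mu>0 < \<infinity>"
    and mu: "local_solution K \<mu>0 T \<mu>" and nu: "strong_solution K \<mu>0 T \<nu>" and t: "t \<in> times T"
  shows "\<mu> t = \<nu> t"
proof -
  obtain c where c: "moment phi \<mu>0 = ennreal c" "0 \<le> c" using ennreal_moment_finite[OF m0(2)] .
  have nu': "local_solution K \<mu>0 T \<nu>" using nu by (simp add: strong_solution_def)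
  have t0: "0 \<le> t" using t by (simp add: times_def)
  note sm = local_solution_approx[OF mu eq_refl[OF c(1)] c(2) t]
  note sn = local_solution_approx[OF nu' eq_refl[OF c(1)] c(2) t]
  note fin = strong_solution_sq_finite[OF nu t]
  have z: "0 \<in> {0..t}" using t0 by simp
  have wc0: "wclass c \<mu>0" by (rule wclassI[OF m0(1) eq_refl[OF c(1)] c(2)])
  have m: "(LINT x|\<nu> 0. wt x) = (LINT x|\<mu>0. wt x)"
    by (rule integral_wt_eq_if_tests_eq[OF approx_solution_wclass[OF sn z] wc0])
      (rule local_solution_initial[OF nu' tests_test_function])
  have mc: "(LINT x|\<mu>0. wt x) = c"
    using moment_phi[OF wc0] c by (metis ennreal_inj integral_nonneg_AE AE_I2 wt_nonneg)
  \<comment> \<open>\<open>c\<close> is exactly the weight of \<open>\<mu>0\<close>. The strong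
    solution keeps this value and a local solution never exceeds it, so the mass defect is
    \<open>0\<close>.\<close>
  have mass: "(LINT x|\<mu> s. wt x) \<le> (LINT x|\<nu> s. wt x) + 0" if s: "s \<in> {0..t}" for s
  proof -
    have "(LINT x|\<nu> s. wt x) = c"
      using conservation[OF sn K _ _ fin s, of 1] m mc by (simp add: wt_def[abs_def])
    then show ?thesis using wclass_integral_wt[OF approx_solution_wclass[OF sm s]] by simp
  qed
  have ex0: "excess wt (\<nu> 0) (\<mu> 0) = 0"
  proof (rule excess_eq_0_if_tests_eq[OF approx_solution_wclass[OF sm z] approx_solution_wclass[OF sn z]])
    fix f assume "tests f"
    note f = tests_test_function[OF this]
    show "(LINT x|\<mu> 0. f x) = (LINT x|\<nu> 0. f x)"
      by (simp only: local_solution_initial[OF mu f] local_solution_initial[OF nu' f])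
  qed
  obtain E where E: "(\<integral>\<^sup>+s. sq_moment (\<nu> s) * indicator {0..t} s \<partial>lborel) = ennreal E" "0 \<le> E"
    using fin by (cases "\<integral>\<^sup>+s. sq_moment (\<nu> s) * indicator {0..t} s \<partial>lborel") auto
  obtain n where n: "24 * c * E \<le> real n" using real_arch_simple by blast
  have tt: "t \<in> {0..t}" using t0 by simp
  have "excess wt (\<nu> t) (\<mu> t) \<le> (excess wt (\<nu> 0) (\<mu> 0) + (0 + 0) * t + 6 * c * 0 * E) * 2 ^ n"
    by (rule stability[OF sn sm K mass order_refl eq_refl[OF E(1)] E(2) n tt])
  then have "excess wt (\<nu> t) (\<mu> t) \<le> 0" by (simp add: ex0)
  then show ?thesis
    using measure_eq_if_excess_le_0[OF approx_solution_wclass[OF sm tt] approx_solution_wclass[OF sn tt]] mass[OF tt] by simp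
qed

lemma strong_solution_conservative:
  assumes K: "admissible K" and m0: "measure_on_Rplus \<mu>0" "moment phi \<mu>0 < \<infinity>"
    and mu: "strong_solution K \<mu>0 T \<mu>"
  shows "conservative T \<mu>"
  unfolding conservative_def
proof (intro exI[of _ "ennreal (LINT x|\<mu> 0. \<bar>x\<bar>)"] conjI ballI)
  fix t assume t: "t \<in> times T"
  obtain c where c: "moment phi \<mu>0 = ennreal c" "0 \<le> c" using ennreal_moment_finite[OF m0(2)] .
  have mu': "local_solution K \<mu>0 T \<mu>" using mu by (simp add: strong_solution_def)
  note sm = local_solution_approx[OF mu' eq_refl[OF c(1)] c(2) t]
  have tt: "t \<in> {0..t}" using t by (simp add: times_def)
  have "(LINT x|\<mu> t. \<bar>x\<bar>) = (LINT x|\<mu> 0. \<bar>x\<bar>)"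
    using conservation[OF sm K _ _ strong_solution_sq_finite[OF mu t] tt, of 0] by simp
  then show "moment (\<lambda>x. x) (\<mu> t) = ennreal (LINT x|\<mu> 0. \<bar>x\<bar>)"
    using moment_id[OF approx_solution_wclass[OF sm tt]] by simp
qed simp

section \<open>Restriction, gluing and maximality\<close>

lemma times_subset: "T \<le> T' \<Longrightarrow> t \<in> times T \<Longrightarrow> t \<in> times T'"
  unfolding times_def using less_le_trans by blast

lemma strong_solution_restrict:
  assumes "strong_solution K \<mu>0 T' \<mu>" "0 < T" "T \<le> T'"
  shows "strong_solution K \<mu>0 T \<mu>"
  using assms(1,2) times_subset[OF assms(3)]
  unfolding strong_solution_def local_solution_def satisfies_kinetic_eq_def by blast

lemma strong_solutions_agree:
  assumes K: "admissible K" and m0: "measure_on_Rplus \<mu>0" "moment phi \<mu>0 < \<infinity>"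
    and mu: "strong_solution K \<mu>0 T \<mu>" and nu: "strong_solution K \<mu>0 T' \<nu>" and t: "t \<in> times T" "t \<in> times T'"
  shows "\<mu> t = \<nu> t"
proof -
  have p: "0 < T" "0 < T'" using mu nu by (auto simp: strong_solution_def local_solution_def)
  show ?thesis
  proof (cases "T \<le> T'")
    case True
    have "local_solution K \<mu>0 T \<mu>" using mu by (simp add: strong_solution_def)
    from uniqueness[OF K m0 this strong_solution_restrict[OF nu p(1) True] t(1)] show ?thesis .
  next
    case False
    then have le: "T' \<le> T" by simp
    have "local_solution K \<mu>0 T' \<mu>" using strong_solution_restrict[OF mu p(2) le] by (simp add: strong_solution_def)
    from uniqueness[OF K m0 this nu t(2)] show ?thesis .
  qed
qed

text \<open>Strong solutions agree at common times, so choosing a value separately at each time is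
  consistent. Every condition at time \<open>t\<close> concerns \<open>{0..t}\<close> only, and
  since lifetimes are right-open, each time before the supremum lies in the lifetime of some
  member.\<close>

lemma strong_solution_glue:
  assumes K: "admissible K" and m0: "measure_on_Rplus \<mu>0" "moment phi \<mu>0 < \<infinity>"
    and S: "S = {T. \<exists>\<nu>. strong_solution K \<mu>0 T \<nu>}" "S \<noteq> {}"
  obtains \<mu> where "strong_solution K \<mu>0 (Sup S) \<mu>"
proof -
  define \<mu> where "\<mu> t = (SOME \<kappa>. \<exists>T \<nu>. strong_solution K \<mu>0 T \<nu> \<and> t \<in> times T \<and> \<kappa> = \<nu> t)" for t
  have eq: "\<mu> t = \<nu> t" if "strong_solution K \<mu>0 T \<nu>" "t \<in> times T" for T \<nu> t
  proof -
    have "\<exists>T' \<nu>'. strong_solution K \<mu>0 T' \<nu>' \<and> t \<in> times T' \<and> \<mu> t = \<nu>' t"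
      unfolding \<mu>_def by (rule someI_ex) (use that in blast)
    then show ?thesis using strong_solutions_agree[OF K m0 that(1)] that(2) by metis
  qed
  have cover: "\<exists>T \<nu>. strong_solution K \<mu>0 T \<nu> \<and> t \<in> times T" if tS: "t \<in> times (Sup S)" for t
  proof -
    have "0 \<le> t" "ennreal t < Sup S" using tS by (simp_all add: times_def)
    then obtain T where "T \<in> S" "ennreal t < T" unfolding less_Sup_iff by blast
    with \<open>0 \<le> t\<close> show ?thesis unfolding S(1) times_def by blast
  qed
  have local: "measure_on_Rplus (\<mu> t) \<and> moment (\<lambda>x. x) (\<mu> t) \<le> moment (\<lambda>x. x) \<mu>0 \<and> moment phi (\<mu> t) \<le> moment phi \<mu>0 \<and>
      (\<forall>f. test_function f \<longrightarrow> set_integrable lborel {0..t} (\<lambda>s. Q_pair K (\<mu> s) f) \<and>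
        (LINT x | \<mu> t. f x) = (LINT x | \<mu>0. f x) + (LINT s : {0..t} | lborel. Q_pair K (\<mu> s) f)) \<and>
      (\<integral>\<^sup>+ s\<in>{0..t}. moment (\<lambda>x. (phi x)\<^sup>2) (\<mu> s) \<partial>lborel) < \<infinity>"
    if tS: "t \<in> times (Sup S)" for t
  proof -
    obtain T \<nu> where nu: "strong_solution K \<mu>0 T \<nu>" and t: "t \<in> times T" using cover[OF tS] by blast
    have e: "\<mu> s = \<nu> s" if "s \<in> {0..t}" for s using eq[OF nu] times_mono[OF t] that by simp
    have et: "\<mu> t = \<nu> t" using eq[OF nu t] .
    have 1: "set_integrable lborel {0..t} (\<lambda>s. Q_pair K (\<mu> s) f) = set_integrable lborel {0..t} (\<lambda>s. Q_pair K (\<nu> s) f)" for f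
      by (intro set_integrable_cong) (auto simp: e)
    have 2: "(LINT s : {0..t} | lborel. Q_pair K (\<mu> s) f) = (LINT s : {0..t} | lborel. Q_pair K (\<nu> s) f)" for f
      by (intro set_lebesgue_integral_cong) (auto simp: e)
    have 3: "(\<integral>\<^sup>+ s\<in>{0..t}. moment (\<lambda>x. (phi x)\<^sup>2) (\<mu> s) \<partial>lborel) = (\<integral>\<^sup>+ s\<in>{0..t}. moment (\<lambda>x. (phi x)\<^sup>2) (\<nu> s) \<partial>lborel)"
      by (intro nn_integral_cong) (auto simp: e indicator_def)
    show ?thesis
      unfolding et 1 2 3 using nu t unfolding strong_solution_def local_solution_def satisfies_kinetic_eq_def by blast
  qed
  obtain T1 \<nu>1 where 1: "strong_solution K \<mu>0 T1 \<nu>1" using S by blast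
  then have "T1 \<le> Sup S" unfolding S(1) by (intro Sup_upper) blast
  moreover have "0 < T1" using 1 by (simp add: strong_solution_def local_solution_def)
  ultimately have "0 < Sup S" by (rule less_le_trans[rotated])
  then have "strong_solution K \<mu>0 (Sup S) \<mu>"
    using local unfolding strong_solution_def local_solution_def satisfies_kinetic_eq_def by blast
  then show thesis by (rule that)
qed

lemma zeta_pos:
  assumes "moment (\<lambda>x. (phi x)\<^sup>2) \<mu>0 < \<infinity>" "moment phi \<mu>0 < \<infinity>"
  shows "0 < zeta \<mu>0"
proof -
  have "inverse (moment (\<lambda>x. (phi x)\<^sup>2) \<mu>0) \<noteq> 0" "inverse (moment phi \<mu>0) \<noteq> 0"
    using assms by (auto simp: ennreal_inverse_eq_0_iff less_top[symmetric])
  then show ?thesis by (simp add: zeta_def zero_less_iff_neq_zero)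
qed

lemma maximal_strong_solution_exists:
  assumes K: "admissible K" and m0: "measure_on_Rplus \<mu>0" "moment phi \<mu>0 < \<infinity>"
    and sq: "moment (\<lambda>x. (phi x)\<^sup>2) \<mu>0 < \<infinity>"
    and ex: "\<And>T. 0 < T \<Longrightarrow> ennreal T < zeta \<mu>0 \<Longrightarrow> \<exists>\<nu>. strong_solution K \<mu>0 (ennreal T) \<nu>"
  shows "\<exists>\<mu>. strong_solution K \<mu>0 (zeta \<mu>0) \<mu> \<and>
            (\<forall>T \<nu>. strong_solution K \<mu>0 T \<nu> \<and> T \<le> zeta \<mu>0 \<longrightarrow> agree_on T \<nu> \<mu>) \<and>
            (\<exists>T. zeta \<mu>0 \<le> T \<and> maximal_strong_solution K \<mu>0 T \<mu> \<and>
                 (\<forall>T' \<nu>. maximal_strong_solution K \<mu>0 T' \<nu> \<longrightarrow> T' = T \<and> agree_on T \<nu> \<mu>))"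
proof -
  define S where "S = {T. \<exists>\<nu>. strong_solution K \<mu>0 T \<nu>}"
  have z: "0 < zeta \<mu>0" by (rule zeta_pos[OF sq m0(2)])
  \<comment> \<open>Local existence is assumed for finite real lifetimes, while
    \<open>zeta \<mu>0\<close> may be infinite; positive real numbers below it still exhaust
    it.\<close>
  have between: "\<exists>T. 0 < T \<and> T' < ennreal T \<and> ennreal T < zeta \<mu>0" if lt: "T' < zeta \<mu>0" for T'
  proof -
    obtain r where r: "T' < r" "r < zeta \<mu>0" using dense[OF lt] by blast
    then obtain T where T: "r = ennreal T" "0 \<le> T" by (cases r) auto
    moreover have "0 < T" using r T by (cases "T = 0") auto
    ultimately show ?thesis using r by blast
  qed
  have S0: "S \<noteq> {}" using between[OF z] ex unfolding S_def by blast
  obtain \<mu> where mu: "strong_solution K \<mu>0 (Sup S) \<mu>" using strong_solution_glue[OF K m0 S_def S0] .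
  have le: "T \<le> Sup S" if "strong_solution K \<mu>0 T \<nu>" for T \<nu>
    by (rule Sup_upper) (use that in \<open>auto simp: S_def\<close>)
  have zS: "zeta \<mu>0 \<le> Sup S"
  proof (rule ccontr)
    assume "\<not> zeta \<mu>0 \<le> Sup S"
    then have "Sup S < zeta \<mu>0" by (simp add: not_le)
    from between[OF this] obtain T where T: "0 < T" "Sup S < ennreal T" "ennreal T < zeta \<mu>0" by blast
    from ex[OF T(1,3)] obtain \<nu> where "strong_solution K \<mu>0 (ennreal T) \<nu>" by blast
    from le[OF this] T(2) show False by simp
  qed
  have ag: "agree_on T \<nu> \<mu>" if "strong_solution K \<mu>0 T \<nu>" for T \<nu>
    unfolding agree_on_def using strong_solutions_agree[OF K m0 that mu] times_subset[OF le[OF that]] by blast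
  have max: "maximal_strong_solution K \<mu>0 (Sup S) \<mu>"
    unfolding maximal_strong_solution_def using mu le by (blast intro: antisym)
  have uniq: "T' = Sup S \<and> agree_on (Sup S) \<nu> \<mu>" if m: "maximal_strong_solution K \<mu>0 T' \<nu>" for T' \<nu>
  proof -
    have s: "strong_solution K \<mu>0 T' \<nu>" using m by (simp add: maximal_strong_solution_def)
    \<comment> \<open>The glued solution extends the given one, so the maximality of the latter
      forces equal lifetimes.\<close>
    have "Sup S = T'" using m mu le[OF s] ag[OF s] unfolding maximal_strong_solution_def by blast
    then show ?thesis using ag[OF s] by simp
  qed
  show ?thesis
    using strong_solution_restrict[OF mu z zS] ag max uniq zS by (intro exI[of _ \<mu>]) blast
qed

section \<open>Euler steps\<close>

text \<open>With \<open>M\<close> the total mass, \<open>1 / (2 M\<^sup>2)\<close> times the two projections of \<open>triple \<mu>\<close> reproduces \<open>\<mu>\<close>,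
  so that the loss term of one Euler step can be subtracted without leaving the positive measures.\<close>

definition euler_weight :: "(real \<Rightarrow> real \<Rightarrow> real \<Rightarrow> real) \<Rightarrow> real \<Rightarrow> real measure \<Rightarrow> (real \<times> real \<times> real) \<times> nat \<Rightarrow> real" where
  "euler_weight K r \<mu> = (\<lambda>((x, y, z), i). if i < 2 then 1 / (2 * (measure \<mu> UNIV)\<^sup>2) - r / 2 * restr K x y z else r / 2 * restr K x y z)"

definition euler_target :: "(real \<times> real \<times> real) \<times> nat \<Rightarrow> real" where
  "euler_target = (\<lambda>((x, y, z), i). if i = 0 then x else if i = 1 then y else if i = 2 then x + y - z else z)"

text \<open>As a push-forward of a nonnegative density on four copies of the triple product, this is
  a measure by construction. Copies \<open>0\<close> and \<open>1\<close> hold what remains at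
  \<open>x\<close> and \<open>y\<close> after the loss, copies \<open>2\<close> and \<open>3\<close>
  the gain at \<open>x + y - z\<close> and \<open>z\<close>. Mass \<open>0\<close> is separated
  because the weight divides by the mass.\<close>

definition euler_step :: "(real \<Rightarrow> real \<Rightarrow> real \<Rightarrow> real) \<Rightarrow> real \<Rightarrow> real measure \<Rightarrow> real measure" where
  "euler_step K r \<mu> = (if measure \<mu> UNIV = 0 then \<mu> else
     distr (density (triple \<mu> \<Otimes>\<^sub>M count_space {0..<4}) (\<lambda>p. ennreal (euler_weight K r \<mu> p))) borel euler_target)"

lemma measurable_pair_count_space:
  assumes "countable A" and [measurable]: "\<And>i. i \<in> A \<Longrightarrow> (\<lambda>p. f (p, i)) \<in> measurable M N"
  shows "f \<in> measurable (M \<Otimes>\<^sub>M count_space A) N"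
  using _ _ assms(1)
  by (rule measurable_compose_countable'[where f="\<lambda>i q. f (fst q, i)" and g=snd and I=A, simplified]) simp_all

text \<open>\<open>rC\<close> is the step restriction that keeps the loss below the present measure:
  the mass \<open>M\<close> is at most \<open>c\<close>, so
  \<open>r / 2 * C \<le> 1 / (2 * M\<^sup>2)\<close> whenever \<open>M\<close> is positive.\<close>

locale euler =
  fixes K :: "real \<Rightarrow> real \<Rightarrow> real \<Rightarrow> real" and c N C r :: real and \<mu> :: "real measure"
  assumes wc: "wclass c \<mu>" and K: "admissible K" and bd: "\<And>x y z. restr K x y z \<le> C"
    and r0: "0 \<le> r" and rC: "r * C * c\<^sup>2 \<le> 1"
begin

sublocale mu: finite_measure \<mu> by (rule wclass_finite[OF wc])

lemma pair_finite: "finite_measure (\<mu> \<Otimes>\<^sub>M \<mu>)"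
  by (rule finite_measure_pair_measure) unfold_locales

lemma triple_finite: "finite_measure (triple \<mu>)"
  by (rule finite_measure_pair_measure) (use pair_finite mu.finite_measure_axioms in auto)

lemma triple_sets: "sets (triple \<mu>) = sets (borel \<Otimes>\<^sub>M (borel \<Otimes>\<^sub>M borel))"
  by (intro sets_pair_measure_cong wclass_sets[OF wc])

lemma mass_le: "measure \<mu> UNIV \<le> c"
proof -
  have "(LINT x|\<mu>. 1) \<le> (LINT x|\<mu>. wt x)"
    by (intro integral_mono wclass_integrable_wt[OF wc]) auto
  then show ?thesis using wclass_integral_wt[OF wc] wclass_space[OF wc] by simp
qed

lemma C_nonneg: "0 \<le> C" using admissible_nonneg[OF K] bd order_trans by blast

lemma weight_nonneg:
  assumes "measure \<mu> UNIV \<noteq> 0" shows "0 \<le> euler_weight K r \<mu> p"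
proof -
  obtain x y z i where p: "p = ((x, y, z), i)" by (metis prod.exhaust)
  let ?M = "measure \<mu> UNIV"
  have M: "0 < ?M" using assms by (simp add: measure_nonneg order_less_le)
  have "r * restr K x y z * ?M\<^sup>2 \<le> r * C * c\<^sup>2"
    using r0 bd[of x y z] admissible_nonneg[OF K] C_nonneg mass_le
    by (intro mult_mono mult_left_mono power_mono) (auto simp: measure_nonneg)
  then have "r * restr K x y z * ?M\<^sup>2 \<le> 1" using rC by simp
  then have "r * restr K x y z \<le> 1 / ?M\<^sup>2" using M by (simp add: pos_le_divide_eq)
  then have "r / 2 * restr K x y z \<le> 1 / (2 * ?M\<^sup>2)" by simp
  then show ?thesis using r0 admissible_nonneg[OF K] by (auto simp: p euler_weight_def)
qed

lemma step_sets: "sets (euler_step K r \<mu>) = sets borel"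
  using wclass_sets[OF wc] by (simp add: euler_step_def)

lemma weight_measurable:
  "euler_weight K r \<mu> \<in> borel_measurable (triple \<mu> \<Otimes>\<^sub>M count_space {0..<4})"
proof -
  have [measurable]: "(\<lambda>(x, y, z). restr K x y z) \<in> borel_measurable (triple \<mu>)"
    using K unfolding admissible_def measurable_cong_sets[OF triple_sets refl] by simp
  show ?thesis
  proof (rule measurable_pair_count_space)
    fix i :: nat
    have "(\<lambda>p. if i < 2 then 1 / (2 * (measure \<mu> UNIV)\<^sup>2) - r / 2 * (case p of (x, y, z) \<Rightarrow> restr K x y z)
       else r / 2 * (case p of (x, y, z) \<Rightarrow> restr K x y z)) \<in> borel_measurable (triple \<mu>)"
      by measurable
    moreover have "(\<lambda>p. if i < 2 then 1 / (2 * (measure \<mu> UNIV)\<^sup>2) - r / 2 * (case p of (x, y, z) \<Rightarrow> restr K x y z)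
       else r / 2 * (case p of (x, y, z) \<Rightarrow> restr K x y z)) = (\<lambda>p. euler_weight K r \<mu> (p, i))"
      by (auto simp: euler_weight_def fun_eq_iff)
    ultimately show "(\<lambda>p. euler_weight K r \<mu> (p, i)) \<in> borel_measurable (triple \<mu>)" by simp
  qed simp
qed

lemma target_measurable:
  "euler_target \<in> borel_measurable (triple \<mu> \<Otimes>\<^sub>M count_space {0..<4})"
proof (rule measurable_pair_count_space)
  fix i :: nat
  have "(\<lambda>p :: real \<times> real \<times> real. if i = 0 then fst p else if i = 1 then fst (snd p) else if i = 2
     then fst p + fst (snd p) - snd (snd p) else snd (snd p)) \<in> borel_measurable (borel \<Otimes>\<^sub>M (borel \<Otimes>\<^sub>M borel))"
    by (cases "i = 0"; cases "i = 1"; cases "i = 2"; simp; measurable)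
  moreover have "(\<lambda>p :: real \<times> real \<times> real. if i = 0 then fst p else if i = 1 then fst (snd p) else if i = 2
     then fst p + fst (snd p) - snd (snd p) else snd (snd p)) = (\<lambda>p. euler_target (p, i))"
    by (auto simp: euler_target_def fun_eq_iff)
  ultimately show "(\<lambda>p. euler_target (p, i)) \<in> borel_measurable (triple \<mu>)"
    unfolding measurable_cong_sets[OF triple_sets refl] by simp
qed simp

lemma weight_le: "\<bar>euler_weight K r \<mu> p\<bar> \<le> 1 / (2 * (measure \<mu> UNIV)\<^sup>2) + r / 2 * C"
proof -
  obtain x y z i where p: "p = ((x, y, z), i)" by (metis prod.exhaust)
  have "0 \<le> r / 2 * restr K x y z" "r / 2 * restr K x y z \<le> r / 2 * C"
    using r0 bd[of x y z] admissible_nonneg[OF K, of x y z] by (auto intro!: mult_left_mono)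
  moreover have "0 \<le> 1 / (2 * (measure \<mu> UNIV)\<^sup>2)" by simp
  ultimately have "\<bar>a - r / 2 * restr K x y z\<bar> \<le> a + r / 2 * C" "\<bar>r / 2 * restr K x y z\<bar> \<le> a + r / 2 * C"
    if "a = 1 / (2 * (measure \<mu> UNIV)\<^sup>2)" for a
    using that by linarith+
  then show ?thesis unfolding p euler_weight_def by simp
qed

text \<open>The constant parts of the two loss copies each contribute half of the integral of
  \<open>g\<close> over \<open>\<mu>\<close>; the kernel parts of all four copies assemble into the
  collision bracket. So the step is forward Euler in weak form, without error.\<close>

lemma step_integral:
  assumes g [measurable]: "g \<in> borel_measurable borel" and gb: "\<And>x. \<bar>g x\<bar> \<le> b"
  shows "integrable (euler_step K r \<mu>) g"
    and "(LINT x|euler_step K r \<mu>. g x) = (LINT x|\<mu>. g x) + r * Q_pair K \<mu> g"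
proof -
  let ?M = "measure \<mu> UNIV"
  have b0: "0 \<le> b" using gb[of 0] by linarith
  have gi: "integrable \<mu> g"
    by (rule mu.integrable_const_bound[where B=b]) (use gb g in \<open>auto simp: measurable_cong_sets[OF wclass_sets[OF wc] refl]\<close>)
  have "integrable (euler_step K r \<mu>) g \<and> (LINT x|euler_step K r \<mu>. g x) = (LINT x|\<mu>. g x) + r * Q_pair K \<mu> g"
  proof (cases "?M = 0")
    case True
    \<comment> \<open>With radius \<open>0\<close>, the bound \<open>L / 2 * c ^ 3\<close> on the
      collision term shows that it vanishes.\<close>
    have "wclass 0 \<mu>"
    proof -
      have "emeasure \<mu> (space \<mu>) = 0" using True wclass_space[OF wc] by (simp add: mu.emeasure_eq_measure)
      then have "AE x in \<mu>. False" by (auto intro: AE_I)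
      then have "(\<integral>\<^sup>+x. ennreal (wt x) \<partial>\<mu>) = (\<integral>\<^sup>+x. 0 \<partial>\<mu>)" by (intro nn_integral_cong_AE) auto
      then show ?thesis using wc by (simp add: wclass_def)
    qed
    from Q_pair_bound[OF this K g restr_gain_loss_bounded[OF K gb]] have "Q_pair K \<mu> g = 0" by simp
    then show ?thesis using True gi by (simp add: euler_step_def)
  next
    case False
    interpret t: finite_measure "triple \<mu>" by (rule triple_finite)
    interpret cs: finite_measure "count_space {0..<4::nat}" by (rule finite_measure_count_space) simp
    interpret pp: pair_sigma_finite "triple \<mu>" "count_space {0..<4::nat}" ..
    interpret P: finite_measure "triple \<mu> \<Otimes>\<^sub>M count_space {0..<4::nat}"
      by (rule finite_measure_pair_measure) unfold_locales
    let ?PM = "triple \<mu> \<Otimes>\<^sub>M count_space {0..<4::nat}"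
    let ?F = "\<lambda>p. euler_weight K r \<mu> p * g (euler_target p)"
    have Fm: "?F \<in> borel_measurable ?PM"
      using weight_measurable measurable_compose[OF target_measurable g] by (rule borel_measurable_times)
    have Fi: "integrable ?PM ?F"
    proof (rule P.integrable_const_bound[where B="(1 / (2 * ?M\<^sup>2) + r / 2 * C) * b"])
      show "AE p in ?PM. norm (?F p) \<le> (1 / (2 * ?M\<^sup>2) + r / 2 * C) * b"
        unfolding real_norm_def abs_mult using r0 C_nonneg b0
        by (intro AE_I2 mult_mono weight_le gb) auto
    qed (rule Fm)
    have dm: "euler_target \<in> borel_measurable (density ?PM (\<lambda>p. ennreal (euler_weight K r \<mu> p)))"
      using target_measurable by simp
    have gt: "(\<lambda>p. g (euler_target p)) \<in> borel_measurable ?PM" by (rule measurable_compose[OF target_measurable g])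
    have w0: "AE p in ?PM. 0 \<le> euler_weight K r \<mu> p" using weight_nonneg[OF False] by simp
    have i1: "integrable (euler_step K r \<mu>) g"
      using Fi False integrable_distr_eq[OF dm g] integrable_density[OF gt weight_measurable w0]
      by (simp add: euler_step_def mult.commute)
    have "(LINT x|euler_step K r \<mu>. g x) = (LINT p|?PM. ?F p)"
      using False integral_distr[OF dm g] integral_density[OF gt weight_measurable w0]
      by (simp add: euler_step_def mult.commute)
    also have "\<dots> = (LINT p|triple \<mu>. LINT i|count_space {0..<4}. ?F (p, i))"
      by (rule pp.integral_fst'[OF Fi, symmetric])
    also have "\<dots> = (LINT p|triple \<mu>. (\<Sum>i\<in>{0..<4}. ?F (p, i)))"
      by (simp add: lebesgue_integral_count_space_finite)
    also have "\<dots> = (LINT p|triple \<mu>. 1 / (2 * ?M\<^sup>2) * (case p of (x, y, z) \<Rightarrow> g x * 1 * 1) + 1 / (2 * ?M\<^sup>2) * (case p of (x, y, z) \<Rightarrow> 1 * g y * 1)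
       + r / 2 * (case p of (x, y, z) \<Rightarrow> restr K x y z * gain_loss g x y z))"
    proof (intro Bochner_Integration.integral_cong refl)
      fix p :: "real \<times> real \<times> real"
      obtain x y z where p: "p = (x, y, z)" by (metis prod.exhaust)
      have e: "{0..<4::nat} = {0, 1, 2, 3}" by auto
      show "(\<Sum>i\<in>{0..<4}. ?F (p, i)) = 1 / (2 * ?M\<^sup>2) * (case p of (x, y, z) \<Rightarrow> g x * 1 * 1) + 1 / (2 * ?M\<^sup>2) * (case p of (x, y, z) \<Rightarrow> 1 * g y * 1)
       + r / 2 * (case p of (x, y, z) \<Rightarrow> restr K x y z * gain_loss g x y z)"
        unfolding e p euler_weight_def euler_target_def gain_loss_def by (simp add: algebra_simps)
    qed
    also have "\<dots> = 1 / (2 * ?M\<^sup>2) * ((LINT x|\<mu>. g x) * ?M * ?M) + 1 / (2 * ?M\<^sup>2) * (?M * (LINT x|\<mu>. g x) * ?M) + r / 2 * (2 * Q_pair K \<mu> g)"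
    proof -
      have one: "integrable \<mu> (\<lambda>x. 1 :: real)" "(LINT x|\<mu>. (1::real)) = ?M" using wclass_space[OF wc] by auto
      note p1 = triple_product[OF mu.sigma_finite_measure_axioms gi one(1) one(1)]
      note p2 = triple_product[OF mu.sigma_finite_measure_axioms one(1) gi one(1)]
      have qi: "integrable (triple \<mu>) (\<lambda>(x, y, z). restr K x y z * gain_loss g x y z)"
      proof (rule t.integrable_const_bound[where B="C * (4 * b)"])
        have gl: "\<bar>gain_loss g x y z\<bar> \<le> 4 * b" for x y z
          unfolding gain_loss_def using gb[of x] gb[of y] gb[of z] gb[of "x+y-z"] by linarith
        have "\<bar>restr K x y z * gain_loss g x y z\<bar> \<le> C * (4 * b)" for x y z
          unfolding abs_mult using admissible_nonneg[OF K] bd gl C_nonneg by (intro mult_mono) auto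
        then show "AE p in triple \<mu>. norm (case p of (x, y, z) \<Rightarrow> restr K x y z * gain_loss g x y z) \<le> C * (4 * b)"
          by (intro AE_I2) (auto split: prod.split)
      qed (rule collision_measurable[OF wc K g])
      have q: "(LINT (x, y, z)|triple \<mu>. restr K x y z * gain_loss g x y z) = 2 * Q_pair K \<mu> g"
        by (simp add: Q_pair_eq)
      have "has_bochner_integral (triple \<mu>) (\<lambda>p. 1 / (2 * ?M\<^sup>2) * (case p of (x, y, z) \<Rightarrow> g x * 1 * 1) + 1 / (2 * ?M\<^sup>2) * (case p of (x, y, z) \<Rightarrow> 1 * g y * 1)
       + r / 2 * (case p of (x, y, z) \<Rightarrow> restr K x y z * gain_loss g x y z))
       (1 / (2 * ?M\<^sup>2) * ((LINT x|\<mu>. g x) * ?M * ?M) + 1 / (2 * ?M\<^sup>2) * (?M * (LINT x|\<mu>. g x) * ?M) + r / 2 * (2 * Q_pair K \<mu> g))"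
        using p1 p2 qi unfolding q[symmetric] one(2)
        by (intro has_bochner_integral_add has_bochner_integral_mult_right) (simp_all only: has_bochner_integral_iff simp_thms)
      then show ?thesis by (rule has_bochner_integral_integral_eq)
    qed
    also have "\<dots> = (LINT x|\<mu>. g x) + r * Q_pair K \<mu> g"
      using False by (simp add: field_simps power2_eq_square)
    finally show ?thesis using i1 by blast
  qed
  then show "integrable (euler_step K r \<mu>) g" "(LINT x|euler_step K r \<mu>. g x) = (LINT x|\<mu>. g x) + r * Q_pair K \<mu> g"
    by blast+
qed

end

section \<open>Truncated kernels and compactly supported measures\<close>

definition trunc :: "(real \<Rightarrow> real \<Rightarrow> real \<Rightarrow> real) \<Rightarrow> real \<Rightarrow> real \<Rightarrow> real \<Rightarrow> real \<Rightarrow> real" where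
  "trunc K N x y z = (if x + y \<le> N then K x y z else 0)"

lemma restr_trunc: "restr (trunc K N) x y z = (if x + y \<le> N then restr K x y z else 0)"
  by (simp add: restr_def trunc_def)

lemma admissible_trunc:
  assumes K: "admissible K" shows "admissible (trunc K N)"
  unfolding admissible_def
proof (intro conjI allI)
  have [measurable]: "(\<lambda>(x, y, z). restr K x y z) \<in> borel_measurable (borel \<Otimes>\<^sub>M (borel \<Otimes>\<^sub>M borel))"
    using K by (simp add: admissible_def)
  have "(\<lambda>p :: real \<times> real \<times> real. if fst p + fst (snd p) \<le> N then (case p of (x, y, z) \<Rightarrow> restr K x y z) else 0) \<in> borel_measurable (borel \<Otimes>\<^sub>M (borel \<Otimes>\<^sub>M borel))"
    by measurable
  also have "(\<lambda>p :: real \<times> real \<times> real. if fst p + fst (snd p) \<le> N then (case p of (x, y, z) \<Rightarrow> restr K x y z) else 0) = (\<lambda>(x, y, z). restr (trunc K N) x y z)"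
    by (auto simp: restr_trunc fun_eq_iff)
  finally show "(\<lambda>(x, y, z). restr (trunc K N) x y z) \<in> borel_measurable (borel \<Otimes>\<^sub>M (borel \<Otimes>\<^sub>M borel))" .
qed (use admissible_nonneg[OF K] admissible_le[OF K] in \<open>auto simp: restr_trunc\<close>)

text \<open>The cutoff is imposed on \<open>x + y\<close> because this sum bounds all four
  frequencies of a collision: truncated collisions do not leave \<open>[0, N]\<close>, and the
  kernel becomes bounded.\<close>

lemma restr_trunc_nonzeroD:
  assumes "restr (trunc K N) x y z \<noteq> 0"
  shows "0 \<le> x" "x \<le> N" "0 \<le> y" "y \<le> N" "0 \<le> z" "z \<le> N" "0 \<le> x + y - z" "x + y - z \<le> N"
    "wt (x + y - z) = wt x + wt y - wt z"
proof -
  have "restr K x y z \<noteq> 0" "x + y \<le> N" using assms by (auto simp: restr_trunc split: if_splits)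
  note n = restr_nonzeroD[OF this(1)] this(2)
  show "0 \<le> x" "x \<le> N" "0 \<le> y" "y \<le> N" "0 \<le> z" "z \<le> N" "0 \<le> x + y - z" "x + y - z \<le> N"
    "wt (x + y - z) = wt x + wt y - wt z" using n by linarith+
qed

lemma restr_trunc_le:
  assumes K: "admissible K" and N: "0 \<le> N"
  shows "restr (trunc K N) x y z \<le> (1 + N) ^ 3"
proof (cases "restr (trunc K N) x y z = 0")
  case False
  note n = restr_trunc_nonzeroD[OF False]
  have "restr (trunc K N) x y z \<le> wt x * wt y * wt z" by (rule admissible_le[OF admissible_trunc[OF K]])
  also have "\<dots> \<le> (1 + N) * (1 + N) * (1 + N)"
    using n by (intro mult_mono) (auto simp: wt_def)
  finally show ?thesis by (simp add: power3_eq_cube)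
qed (use N in simp)

definition sclass :: "real \<Rightarrow> real \<Rightarrow> real measure \<Rightarrow> bool" where
  "sclass N c \<mu> \<longleftrightarrow> wclass c \<mu> \<and> (AE x in \<mu>. \<bar>x\<bar> \<le> N)"

lemma sclass_integrable:
  fixes g :: "real \<Rightarrow> real"
  assumes mu: "sclass N c \<mu>" and g: "g \<in> borel_measurable borel" and b: "\<And>x. \<bar>x\<bar> \<le> N \<Longrightarrow> \<bar>g x\<bar> \<le> b"
  shows "integrable \<mu> g"
proof -
  have wc: "wclass c \<mu>" using mu by (simp add: sclass_def)
  have "AE x in \<mu>. \<bar>x\<bar> \<le> N" using mu by (simp add: sclass_def)
  then have "AE x in \<mu>. norm (g x) \<le> b" by eventually_elim (use b in simp)
  then show ?thesis
    by (rule finite_measure.integrable_const_bound[OF wclass_finite[OF wc]])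
      (simp add: measurable_cong_sets[OF wclass_sets[OF wc] refl] g)
qed

lemma sclass_integral_cutoff:
  fixes g :: "real \<Rightarrow> real"
  assumes mu: "sclass N c \<mu>" and g: "g \<in> borel_measurable borel"
  shows "(LINT x|\<mu>. g x * indicator {x. \<bar>x\<bar> \<le> N} x) = (LINT x|\<mu>. g x)"
proof (rule integral_cong_AE)
  have wc: "wclass c \<mu>" using mu by (simp add: sclass_def)
  note eq = measurable_cong_sets[OF wclass_sets[OF wc] refl]
  show "(\<lambda>x. g x * indicator {x. \<bar>x\<bar> \<le> N} x) \<in> borel_measurable \<mu>" unfolding eq using g by measurable
  show "g \<in> borel_measurable \<mu>" unfolding eq by (rule g)
  have "AE x in \<mu>. \<bar>x\<bar> \<le> N" using mu by (simp add: sclass_def)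
  then show "AE x in \<mu>. g x * indicator {x. \<bar>x\<bar> \<le> N} x = g x" by eventually_elim simp
qed

lemma collision_integrable:
  assumes mu: "wclass c \<mu>" and K: "admissible K" and f: "f \<in> borel_measurable borel"
    and L: "\<And>x y z. \<bar>restr K x y z * gain_loss f x y z\<bar> \<le> L * (wt x * wt y * wt z)"
  shows "integrable (triple \<mu>) (\<lambda>(x, y, z). restr K x y z * gain_loss f x y z)"
proof (rule Bochner_Integration.integrable_bound[OF _ collision_measurable[OF mu K f]])
  interpret finite_measure \<mu> by (rule wclass_finite[OF mu])
  note w = wclass_integrable_wt[OF mu]
  show "integrable (triple \<mu>) (\<lambda>p. L * (case p of (x, y, z) \<Rightarrow> wt x * wt y * wt z))"
    using triple_product(1)[OF sigma_finite_measure_axioms w w w] by simp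
  have "\<bar>case p of (x, y, z) \<Rightarrow> restr K x y z * gain_loss f x y z\<bar> \<le> \<bar>L * (case p of (x, y, z) \<Rightarrow> wt x * wt y * wt z)\<bar>" for p
    using L order_trans[OF _ abs_ge_self] by (cases p) (simp only: prod.case, blast)
  then show "AE p in triple \<mu>. norm (case p of (x, y, z) \<Rightarrow> restr K x y z * gain_loss f x y z) \<le> norm (L * (case p of (x, y, z) \<Rightarrow> wt x * wt y * wt z))"
    by (intro AE_I2) (simp only: real_norm_def)
qed

lemma Q_pair_le:
  assumes mu: "wclass c \<mu>" and K: "admissible K" and f: "f \<in> borel_measurable borel"
    and L: "\<And>x y z. \<bar>restr K x y z * gain_loss f x y z\<bar> \<le> L * (wt x * wt y * wt z)"
    and P: "has_bochner_integral (triple \<mu>) P I" and le: "\<And>x y z. restr K x y z * gain_loss f x y z \<le> P (x, y, z)"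
  shows "Q_pair K \<mu> f \<le> I / 2"
proof -
  have "(LINT (x, y, z)|triple \<mu>. restr K x y z * gain_loss f x y z) \<le> (LINT p|triple \<mu>. P p)"
    by (intro integral_mono collision_integrable[OF mu K f L]) (use P le in \<open>auto simp: has_bochner_integral_iff\<close>)
  then show ?thesis using P by (simp add: Q_pair_eq has_bochner_integral_iff)
qed

lemma Q_pair_cong:
  assumes "\<And>x y z. restr K x y z * gain_loss f x y z = restr L x y z * gain_loss g x y z"
  shows "Q_pair K \<mu> f = Q_pair L \<mu> g"
  unfolding Q_pair_eq assms ..

lemma Q_pair_zero [simp]: "Q_pair K \<mu> (\<lambda>x. 0) = 0"
  by (simp add: Q_pair_eq gain_loss_def case_prod_beta')

lemma trunc_gain_loss_le:
  assumes K: "admissible K" and b: "\<And>x. 0 \<le> x \<Longrightarrow> x \<le> N \<Longrightarrow> \<bar>f x\<bar> \<le> b" "0 \<le> b"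
  shows "\<bar>restr (trunc K N) x y z * gain_loss f x y z\<bar> \<le> 4 * b * (wt x * wt y * wt z)"
proof (rule restr_gain_loss_le[OF admissible_trunc[OF K]])
  fix x y z assume nz: "restr (trunc K N) x y z \<noteq> 0"
  note n = restr_trunc_nonzeroD[OF nz]
  show "\<bar>gain_loss f x y z\<bar> \<le> 4 * b"
    unfolding gain_loss_def using b(1)[OF n(1,2)] b(1)[OF n(3,4)] b(1)[OF n(5,6)] b(1)[OF n(7,8)] by linarith
qed (use b in simp)

lemma has_triple_product:
  assumes mu: "wclass c \<mu>" and "integrable \<mu> p" "integrable \<mu> q" "integrable \<mu> r"
  shows "has_bochner_integral (triple \<mu>) (\<lambda>(x, y, z). p x * q y * r z :: real) ((LINT x|\<mu>. p x) * (LINT x|\<mu>. q x) * (LINT x|\<mu>. r x))"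
  using triple_product[OF finite_measure.sigma_finite_measure[OF wclass_finite[OF mu]] assms(2-4)]
  by (simp add: has_bochner_integral_iff)

locale euler_trunc =
  fixes K :: "real \<Rightarrow> real \<Rightarrow> real \<Rightarrow> real" and c N r :: real and \<mu> :: "real measure"
  assumes sc: "sclass N c \<mu>" and K: "admissible K" and N: "0 \<le> N"
    and r0: "0 \<le> r" and rC: "r * (1 + N) ^ 3 * c\<^sup>2 \<le> 1"
begin

lemma wc: "wclass c \<mu>" using sc by (simp add: sclass_def)

sublocale eu: euler "trunc K N" c N "(1 + N) ^ 3" r \<mu>
  by unfold_locales (use wc admissible_trunc[OF K] restr_trunc_le[OF K N] r0 rC in auto)

abbreviation \<sigma> :: "real measure" where "\<sigma> \<equiv> euler_step (trunc K N) r \<mu>"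

text \<open>A set off \<open>[0, N]\<close> is neither charged by \<open>\<mu>\<close> nor reached
  by a truncated collision, so the support passes on to the next Euler step.\<close>

lemma step_zero:
  assumes B [measurable]: "B \<in> sets borel" and out: "\<And>x. 0 \<le> x \<Longrightarrow> x \<le> N \<Longrightarrow> x \<notin> B"
  shows "emeasure \<sigma> B = 0"
proof -
  have i: "integrable \<sigma> (indicator B :: real \<Rightarrow> real)" "(LINT x|\<sigma>. indicator B x :: real) = (LINT x|\<mu>. indicator B x) + r * Q_pair (trunc K N) \<mu> (indicator B)"
    by (rule eu.step_integral[where b=1]; auto simp: indicator_def)+
  have "restr (trunc K N) x y z * gain_loss (indicator B) x y z = restr K x y z * gain_loss (\<lambda>x. 0) x y z" for x y z
  proof (cases "restr (trunc K N) x y z = 0")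
    case False
    note n = restr_trunc_nonzeroD[OF False]
    show ?thesis using out[OF n(1,2)] out[OF n(3,4)] out[OF n(5,6)] out[OF n(7,8)] by (simp add: gain_loss_def)
  qed (simp add: gain_loss_def)
  then have "Q_pair (trunc K N) \<mu> (indicator B) = Q_pair K \<mu> (\<lambda>x. 0)" by (rule Q_pair_cong)
  also have "\<dots> = 0" by simp
  finally have Q: "Q_pair (trunc K N) \<mu> (indicator B) = 0" .
  have "AE x in \<mu>. 0 \<le> x" "AE x in \<mu>. \<bar>x\<bar> \<le> N" using wclass_AE[OF wc] sc by (auto simp: sclass_def)
  then have "AE x in \<mu>. (indicator B x :: real) = 0" by eventually_elim (use out in \<open>auto simp: indicator_def\<close>)
  then have "(LINT x|\<mu>. indicator B x :: real) = 0" by (rule integral_eq_zero_AE)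
  then have "(LINT x|\<sigma>. indicator B x :: real) = 0" using i(2) Q by simp
  moreover have "B \<in> sets \<sigma>" using eu.step_sets by simp
  moreover have "B \<inter> space \<sigma> = B" using sets_eq_imp_space_eq[OF eu.step_sets] by simp
  moreover have "emeasure \<sigma> B \<noteq> \<infinity>" using i(1) \<open>B \<in> sets \<sigma>\<close> \<open>B \<inter> space \<sigma> = B\<close> by (simp add: integrable_indicator_iff)
  ultimately show ?thesis by (simp add: measure_def enn2real_eq_0_iff)
qed

lemma step_AE: "AE x in \<sigma>. 0 \<le> x" "AE x in \<sigma>. \<bar>x\<bar> \<le> N"
proof -
  have "{..<0} \<in> sets \<sigma>" "{N<..} \<in> sets \<sigma>" using eu.step_sets by auto
  moreover have "emeasure \<sigma> {..<0} = 0" "emeasure \<sigma> {N<..} = 0" by (rule step_zero; simp)+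
  ultimately have "{..<0} \<in> null_sets \<sigma>" "{N<..} \<in> null_sets \<sigma>" by (simp_all add: null_setsI)
  note a = AE_not_in[OF this(1)] AE_not_in[OF this(2)]
  have 1: "AE x in \<sigma>. 0 \<le> x" using a(1) by eventually_elim simp
  moreover have "AE x in \<sigma>. \<bar>x\<bar> \<le> N" using 1 a(2) by eventually_elim simp
  ultimately show "AE x in \<sigma>. 0 \<le> x" "AE x in \<sigma>. \<bar>x\<bar> \<le> N" by blast+
qed

text \<open>Values outside the support are immaterial; this admits the powers of \<open>wt\<close>,
  which are unbounded on the line.\<close>

lemma step_integral_local:
  assumes g: "g \<in> borel_measurable borel" and gb: "\<And>x. \<bar>x\<bar> \<le> N \<Longrightarrow> \<bar>g x\<bar> \<le> b"
  shows "integrable \<sigma> g" "(LINT x|\<sigma>. g x) = (LINT x|\<mu>. g x) + r * Q_pair (trunc K N) \<mu> g"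
proof -
  let ?g = "\<lambda>x. g x * indicator {x. \<bar>x\<bar> \<le> N} x"
  have b0: "0 \<le> b" using gb[of 0] N by simp
  have gm: "?g \<in> borel_measurable borel" using g by measurable
  have gb': "\<bar>?g x\<bar> \<le> b" for x using gb b0 by (auto simp: indicator_def)
  note s = eu.step_integral[OF gm gb']
  note eq = measurable_cong_sets[OF eu.step_sets refl]
  have ae: "AE x in \<sigma>. ?g x = g x" using step_AE(2) by eventually_elim simp
  show "integrable \<sigma> g"
    by (rule integrable_cong_AE_imp[OF s(1) _ ae]) (simp add: eq g)
  have "(LINT x|\<sigma>. g x) = (LINT x|\<sigma>. ?g x)"
    by (rule integral_cong_AE[symmetric]) (use ae g gm in \<open>simp_all add: eq\<close>)
  also have "\<dots> = (LINT x|\<mu>. g x) + r * Q_pair (trunc K N) \<mu> ?g"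
    using s(2) sclass_integral_cutoff[OF sc g] by simp
  also have "Q_pair (trunc K N) \<mu> ?g = Q_pair (trunc K N) \<mu> g"
  proof (rule Q_pair_cong)
    fix x y z
    show "restr (trunc K N) x y z * gain_loss ?g x y z = restr (trunc K N) x y z * gain_loss g x y z"
    proof (cases "restr (trunc K N) x y z = 0")
      case False
      note n = restr_trunc_nonzeroD[OF False]
      show ?thesis using n by (simp add: gain_loss_def)
    qed simp
  qed
  finally show "(LINT x|\<sigma>. g x) = (LINT x|\<mu>. g x) + r * Q_pair (trunc K N) \<mu> g" .
qed

lemma step_affine: "(LINT x|\<sigma>. a + \<bar>x\<bar>) = (LINT x|\<mu>. a + \<bar>x\<bar>)"
proof -
  have "Q_pair (trunc K N) \<mu> (\<lambda>x. a + \<bar>x\<bar>) = Q_pair K \<mu> (\<lambda>x. 0)"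
  proof (rule Q_pair_cong)
    fix x y z
    show "restr (trunc K N) x y z * gain_loss (\<lambda>x. a + \<bar>x\<bar>) x y z = restr K x y z * gain_loss (\<lambda>x. 0) x y z"
      using restr_trunc_nonzeroD[of K N x y z] by (cases "restr (trunc K N) x y z = 0") (auto simp: gain_loss_def)
  qed
  also have "\<dots> = 0" by simp
  finally show ?thesis
    using step_integral_local(2)[of "\<lambda>x. a + \<bar>x\<bar>" "\<bar>a\<bar> + N"] by simp
qed

lemma step_wt: "(LINT x|\<sigma>. wt x) = (LINT x|\<mu>. wt x)"
  unfolding wt_def by (rule step_affine)

lemma step_sclass: "sclass N c \<sigma>"
proof -
  have i: "integrable \<sigma> wt" by (rule step_integral_local[where b="1 + N"]) (auto simp: wt_def)
  have "(\<integral>\<^sup>+x. ennreal (wt x) \<partial>\<sigma>) = ennreal (LINT x|\<sigma>. wt x)"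
    by (rule nn_integral_eq_integral[OF i]) simp
  also have "\<dots> \<le> ennreal c" using step_wt wclass_integral_wt[OF wc] by (simp add: ennreal_leI)
  finally show ?thesis
    using step_AE(2) eu.step_sets step_zero[of "{..<0}"] wclass_c_nonneg[OF wc]
    by (auto simp: sclass_def wclass_def measure_on_Rplus_def)
qed

lemma wt_power_integrable: "integrable \<mu> (\<lambda>x. wt x ^ j)"
  by (rule sclass_integrable[OF sc, where b="(1 + N) ^ j"]) (auto simp: wt_def intro!: power_mono)

lemma power_bound: "\<bar>x\<bar> \<le> N \<Longrightarrow> \<bar>wt x ^ j\<bar> \<le> (1 + N) ^ j"
  by (auto simp: wt_def intro!: power_mono)

lemma wt_le_c: "(LINT x|\<mu>. wt x) \<le> c" "0 \<le> (LINT x|\<mu>. wt x)"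
  using wclass_integral_wt[OF wc] by (auto intro!: integral_nonneg_AE)

lemma moment_nonneg: "0 \<le> (LINT x|\<mu>. wt x ^ j)"
  by (intro integral_nonneg_AE) auto

text \<open>With \<open>w = wt (x + y - z)\<close> the bracket of the squares equals
  \<open>2 * wt x * wt y - 2 * wt z * w\<close>. Dropping the last term leaves two second moments
  and one first moment, hence an Euler step for \<open>k' = c * k\<^sup>2\<close>.\<close>

lemma step_sq: "(LINT x|\<sigma>. (wt x)\<^sup>2) \<le> (LINT x|\<mu>. (wt x)\<^sup>2) + r * c * (LINT x|\<mu>. (wt x)\<^sup>2)\<^sup>2"
proof -
  let ?k = "LINT x|\<mu>. (wt x)\<^sup>2" and ?P = "LINT x|\<mu>. wt x"
  have w: "integrable \<mu> wt" using wclass_integrable_wt[OF wc] .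
  have "Q_pair (trunc K N) \<mu> (\<lambda>x. (wt x)\<^sup>2) \<le> 2 * (?k * ?k * ?P) / 2"
  proof (rule Q_pair_le[OF wc admissible_trunc[OF K]])
    show "(\<lambda>x. (wt x)\<^sup>2) \<in> borel_measurable borel" by measurable
    show "\<bar>restr (trunc K N) x y z * gain_loss (\<lambda>x. (wt x)\<^sup>2) x y z\<bar> \<le> 4 * (1 + N)\<^sup>2 * (wt x * wt y * wt z)" for x y z
      by (rule trunc_gain_loss_le[OF K]) (use power_bound[where j=2] in auto)
    show "has_bochner_integral (triple \<mu>) (\<lambda>p. 2 * (case p of (x, y, z) \<Rightarrow> (wt x)\<^sup>2 * (wt y)\<^sup>2 * wt z)) (2 * (?k * ?k * ?P))"
      by (intro has_bochner_integral_mult_right has_triple_product[OF wc] wt_power_integrable w)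
    fix x y z
    show "restr (trunc K N) x y z * gain_loss (\<lambda>x. (wt x)\<^sup>2) x y z \<le> 2 * (case (x, y, z) of (x, y, z) \<Rightarrow> (wt x)\<^sup>2 * (wt y)\<^sup>2 * wt z)"
    proof (cases "restr (trunc K N) x y z = 0")
      case False
      note n = restr_trunc_nonzeroD[OF False]
      have "gain_loss (\<lambda>x. (wt x)\<^sup>2) x y z = 2 * (wt x * wt y) - 2 * (wt z * wt (x + y - z))"
        unfolding gain_loss_def n(9) by (simp add: power2_eq_square algebra_simps)
      also have "\<dots> \<le> 2 * (wt x * wt y)" by simp
      finally have "restr (trunc K N) x y z * gain_loss (\<lambda>x. (wt x)\<^sup>2) x y z \<le> wt x * wt y * wt z * (2 * (wt x * wt y))"
        by (intro restr_mult_le admissible_trunc K) auto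
      also have "\<dots> = 2 * ((wt x)\<^sup>2 * (wt y)\<^sup>2 * wt z)" by (simp add: power2_eq_square)
      finally show ?thesis by simp
    qed simp
  qed
  also have "\<dots> \<le> ?k * ?k * c" using wt_le_c by (auto intro!: mult_left_mono)
  finally have "r * Q_pair (trunc K N) \<mu> (\<lambda>x. (wt x)\<^sup>2) \<le> r * (?k * ?k * c)" using r0 by (intro mult_left_mono)
  moreover have "(LINT x|\<sigma>. (wt x)\<^sup>2) = ?k + r * Q_pair (trunc K N) \<mu> (\<lambda>x. (wt x)\<^sup>2)"
    by (rule step_integral_local(2)[where b="(1 + N)\<^sup>2"]) (use power_bound[where j=2] in auto)
  ultimately show ?thesis by (simp add: power2_eq_square mult_ac)
qed

text \<open>The bracket of the cubes is
  \<open>3 * (wt x + wt y) * (wt x * wt y - wt z * wt (x + y - z))\<close>. The third moment thus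
  enters linearly, with a growth rate given by the second, and cannot blow up earlier.\<close>

lemma step_cube: "(LINT x|\<sigma>. (wt x) ^ 3) \<le> (LINT x|\<mu>. (wt x) ^ 3) * (1 + 3 * r * c * (LINT x|\<mu>. (wt x)\<^sup>2))"
proof -
  let ?k = "LINT x|\<mu>. (wt x)\<^sup>2" and ?P = "LINT x|\<mu>. wt x" and ?l = "LINT x|\<mu>. wt x ^ 3"
  have w: "integrable \<mu> wt" using wclass_integrable_wt[OF wc] .
  have "Q_pair (trunc K N) \<mu> (\<lambda>x. wt x ^ 3) \<le> 3 * (?l * ?k * ?P + ?k * ?l * ?P) / 2"
  proof (rule Q_pair_le[OF wc admissible_trunc[OF K]])
    show "(\<lambda>x. wt x ^ 3) \<in> borel_measurable borel" by measurable
    show "\<bar>restr (trunc K N) x y z * gain_loss (\<lambda>x. wt x ^ 3) x y z\<bar> \<le> 4 * (1 + N) ^ 3 * (wt x * wt y * wt z)" for x y z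
      by (rule trunc_gain_loss_le[OF K]) (use power_bound[where j=3] N in auto)
    show "has_bochner_integral (triple \<mu>) (\<lambda>p. 3 * ((case p of (x, y, z) \<Rightarrow> wt x ^ 3 * (wt y)\<^sup>2 * wt z) + (case p of (x, y, z) \<Rightarrow> (wt x)\<^sup>2 * wt y ^ 3 * wt z)))
      (3 * (?l * ?k * ?P + ?k * ?l * ?P))"
      by (intro has_bochner_integral_mult_right has_bochner_integral_add has_triple_product[OF wc] wt_power_integrable w)
    fix x y z
    show "restr (trunc K N) x y z * gain_loss (\<lambda>x. wt x ^ 3) x y z \<le> 3 * ((case (x, y, z) of (x, y, z) \<Rightarrow> wt x ^ 3 * (wt y)\<^sup>2 * wt z) + (case (x, y, z) of (x, y, z) \<Rightarrow> (wt x)\<^sup>2 * wt y ^ 3 * wt z))"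
    proof (cases "restr (trunc K N) x y z = 0")
      case False
      note n = restr_trunc_nonzeroD[OF False]
      have "gain_loss (\<lambda>x. wt x ^ 3) x y z = 3 * (wt x * wt y * (wt x + wt y)) - 3 * ((wt x + wt y) * wt z * wt (x + y - z))"
        unfolding gain_loss_def n(9) by (simp add: power3_eq_cube algebra_simps)
      also have "\<dots> \<le> 3 * (wt x * wt y * (wt x + wt y))" by (simp add: add_nonneg_nonneg)
      finally have "restr (trunc K N) x y z * gain_loss (\<lambda>x. wt x ^ 3) x y z \<le> wt x * wt y * wt z * (3 * (wt x * wt y * (wt x + wt y)))"
        by (intro restr_mult_le admissible_trunc K) (auto simp: add_nonneg_nonneg)
      also have "\<dots> = 3 * (wt x ^ 3 * (wt y)\<^sup>2 * wt z + (wt x)\<^sup>2 * wt y ^ 3 * wt z)" by (simp add: power2_eq_square power3_eq_cube algebra_simps)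
      finally show ?thesis by simp
    qed (simp add: add_nonneg_nonneg)
  qed
  also have "\<dots> = 3 * (?l * ?k) * ?P" by simp
  also have "\<dots> \<le> 3 * (?l * ?k) * c" using wt_le_c moment_nonneg[of 3] moment_nonneg[of 2] by (intro mult_left_mono) auto
  finally have "r * Q_pair (trunc K N) \<mu> (\<lambda>x. wt x ^ 3) \<le> r * (3 * (?l * ?k) * c)" using r0 by (intro mult_left_mono)
  moreover have "(LINT x|\<sigma>. wt x ^ 3) = ?l + r * Q_pair (trunc K N) \<mu> (\<lambda>x. wt x ^ 3)"
    by (rule step_integral_local(2)[where b="(1 + N) ^ 3"]) (use power_bound[where j=3] in auto)
  ultimately show ?thesis by (simp add: algebra_simps)
qed

lemma step_excess:
  "excess wt \<sigma> \<mu> \<le> 2 * r * (1 + N) * c ^ 3"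
proof (rule excess_least)
  fix f assume f: "f \<in> borel_measurable borel" "\<And>x. 0 \<le> f x" "\<And>x. f x \<le> wt x"
  have fb: "\<bar>f x\<bar> \<le> 1 + N" if "\<bar>x\<bar> \<le> N" for x using f(2,3)[of x] that by (simp add: wt_def)
  have "\<bar>Q_pair (trunc K N) \<mu> f\<bar> \<le> 4 * (1 + N) / 2 * c ^ 3"
    by (intro Q_pair_bound[OF wc admissible_trunc[OF K] f(1)] trunc_gain_loss_le[OF K] fb) (use N in auto)
  then have "Q_pair (trunc K N) \<mu> f \<le> 4 * (1 + N) / 2 * c ^ 3" by (rule order_trans[OF abs_ge_self])
  then have "r * Q_pair (trunc K N) \<mu> f \<le> r * (4 * (1 + N) / 2 * c ^ 3)" using r0 by (rule mult_left_mono)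
  also have "\<dots> = 2 * r * (1 + N) * c ^ 3" by simp
  finally show "(LINT x|\<sigma>. f x) - (LINT x|\<mu>. f x) \<le> 2 * r * (1 + N) * c ^ 3"
    using step_integral_local(2)[OF f(1) fb] by simp
qed simp

text \<open>A step conserves the weight, so its weighted distance is at most twice its excess; the
  constant is \<open>24 = 3 / 2 * 4 * 4\<close>.\<close>

lemma step_Q_pair_close:
  assumes f: "f \<in> borel_measurable borel" "\<And>x. \<bar>f x\<bar> \<le> wt x"
  shows "\<bar>Q_pair (trunc K N) \<sigma> f - Q_pair (trunc K N) \<mu> f\<bar> \<le> 24 * r * (1 + N)\<^sup>2 * c ^ 5"
proof -
  have wcs: "wclass c \<sigma>" using step_sclass by (simp add: sclass_def)
  obtain m u v where "density_pair c \<mu> \<sigma> m u v" using density_pair_exists[OF wc wcs] .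
  then interpret d: density_pair c \<mu> \<sigma> m u v .
  have fb: "\<bar>f x\<bar> \<le> 1 + N" if "0 \<le> x" "x \<le> N" for x using f(2)[of x] that by (simp add: wt_def)
  have c0: "0 \<le> c" by (rule wclass_c_nonneg[OF wc])
  have "d.wdist \<le> 2 * excess wt \<sigma> \<mu> + 0" by (rule d.wdist_le) (simp add: step_wt)
  also have "\<dots> \<le> 4 * r * (1 + N) * c ^ 3" using step_excess by simp
  finally have W: "d.wdist \<le> 4 * r * (1 + N) * c ^ 3" .
  have "\<bar>Q_pair (trunc K N) \<sigma> f - Q_pair (trunc K N) \<mu> f\<bar> \<le> 3 / 2 * (4 * (1 + N)) * c\<^sup>2 * d.wdist"
    by (rule d.Q_pair_lipschitz[OF admissible_trunc[OF K] f(1)], rule trunc_gain_loss_le[OF K]) (use fb N in auto)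
  also have "\<dots> \<le> 3 / 2 * (4 * (1 + N)) * c\<^sup>2 * (4 * r * (1 + N) * c ^ 3)"
    using W N c0 by (intro mult_left_mono) auto
  also have "\<dots> = 24 * r * (1 + N)\<^sup>2 * c ^ 5" by (simp add: power2_eq_square power3_eq_cube eval_nat_numeral)
  finally show ?thesis .
qed

end

text \<open>In the discarded collisions \<open>N < x + y\<close>, so
  \<open>wt x + wt y \<le> (wt x + wt y)\<^sup>2 / N\<close>. Trading one more power of the weight
  for \<open>1 / N\<close> is what calls for a third moment.\<close>

lemma trunc_Q_pair_close:
  assumes sc: "sclass N c \<mu>" and K: "admissible K" and N: "0 < N"
    and f: "f \<in> borel_measurable borel" "\<And>x. \<bar>f x\<bar> \<le> wt x"
  shows "\<bar>Q_pair (trunc K N) \<mu> f - Q_pair K \<mu> f\<bar> \<le> 4 * c\<^sup>2 * (LINT x|\<mu>. wt x ^ 3) / N"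
proof -
  have wc: "wclass c \<mu>" using sc by (simp add: sclass_def)
  have w: "integrable \<mu> wt" using wclass_integrable_wt[OF wc] .
  have p: "integrable \<mu> (\<lambda>x. wt x ^ 3)" "integrable \<mu> (\<lambda>x. (wt x)\<^sup>2)"
    by (rule sclass_integrable[OF sc, where b="(1 + N) ^ 3"] sclass_integrable[OF sc, where b="(1 + N) ^ 2"]; auto simp: wt_def intro!: power_mono)+
  let ?l = "LINT x|\<mu>. wt x ^ 3" and ?P = "LINT x|\<mu>. wt x"
  let ?d = "\<lambda>p. 4 / N * ((case p of (x, y, z) \<Rightarrow> wt x ^ 3 * wt y * wt z) + (case p of (x, y, z) \<Rightarrow> wt x * wt y ^ 3 * wt z))"
  let ?c = "\<lambda>K. \<lambda>(x, y, z). restr K x y z * gain_loss f x y z"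
  have D: "has_bochner_integral (triple \<mu>) ?d (4 / N * (?l * ?P * ?P + ?P * ?l * ?P))"
    by (intro has_bochner_integral_mult_right has_bochner_integral_add has_triple_product[OF wc] p w)
  have int: "integrable (triple \<mu>) (?c L)" if L: "admissible L" for L
  proof (rule Bochner_Integration.integrable_bound[OF _ collision_measurable[OF wc L f(1)]])
    show "integrable (triple \<mu>) (\<lambda>p. 2 * (case p of (x, y, z) \<Rightarrow> wt x * wt y * wt z * (wt x + wt y)))"
      using triple_sq_integrable(1)[OF wc p(2)] by simp
    have "\<bar>?c L p\<bar> \<le> \<bar>2 * (case p of (x, y, z) \<Rightarrow> wt x * wt y * wt z * (wt x + wt y))\<bar>" for p
      using collision_le[OF L f(2)] order_trans[OF _ abs_ge_self] by (cases p) (simp only: prod.case, blast)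
    then show "AE p in triple \<mu>. norm (?c L p) \<le> norm (2 * (case p of (x, y, z) \<Rightarrow> wt x * wt y * wt z * (wt x + wt y)))"
      by (intro AE_I2) (simp only: real_norm_def)
  qed
  have le: "\<bar>?c (trunc K N) p - ?c K p\<bar> \<le> ?d p" for p
  proof -
    obtain x y z where p: "p = (x, y, z)" by (metis prod.exhaust)
    let ?e = "4 / N * (wt x ^ 3 * wt y * wt z + wt x * wt y ^ 3 * wt z)"
    have e0: "0 \<le> ?e" using N by (intro mult_nonneg_nonneg add_nonneg_nonneg) auto
    have "\<bar>restr (trunc K N) x y z * gain_loss f x y z - restr K x y z * gain_loss f x y z\<bar> \<le> ?e"
    proof (cases "x + y \<le> N \<or> restr K x y z = 0")
      case True
      then show ?thesis using e0 by (auto simp: restr_trunc)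
    next
      case False
      have nz: "restr K x y z \<noteq> 0" using False by blast
      have s: "N \<le> wt x + wt y" "0 \<le> wt x + wt y"
        using False restr_nonzeroD[OF nz] by (auto simp: wt_def)
      have "\<bar>restr (trunc K N) x y z * gain_loss f x y z - restr K x y z * gain_loss f x y z\<bar> = \<bar>restr K x y z * gain_loss f x y z\<bar>"
        using False by (simp add: restr_trunc)
      also have "\<dots> \<le> 2 * (wt x * wt y * wt z * (wt x + wt y))" by (rule collision_le[OF K f(2)])
      also have "\<dots> \<le> 2 * (wt x * wt y * wt z * (2 * ((wt x)\<^sup>2 + (wt y)\<^sup>2) / N))"
      proof -
        have "N * (wt x + wt y) \<le> (wt x + wt y) * (wt x + wt y)" using s by (intro mult_right_mono)
        also have "\<dots> \<le> 2 * ((wt x)\<^sup>2 + (wt y)\<^sup>2)"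
          using sum_squares_bound[of "wt x" "wt y"] by (simp add: power2_eq_square algebra_simps)
        finally have "wt x + wt y \<le> 2 * ((wt x)\<^sup>2 + (wt y)\<^sup>2) / N"
          using N by (simp only: pos_le_divide_eq mult.commute[of N])
        then show ?thesis by (intro mult_left_mono) auto
      qed
      also have "\<dots> = ?e" using N by (simp add: field_simps power2_eq_square power3_eq_cube)
      finally show ?thesis .
    qed
    then show ?thesis by (simp only: p prod.case)
  qed
  have P: "0 \<le> ?P" "?P \<le> c" using wclass_integral_wt[OF wc] by (auto intro!: integral_nonneg_AE)
  have l0: "0 \<le> ?l" by (intro integral_nonneg_AE) auto
  define X Y d where "X = ?c (trunc K N)" and "Y = ?c K" and "d = ?d"
  have iX: "integrable (triple \<mu>) X" and iY: "integrable (triple \<mu>) Y"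
    unfolding X_def Y_def by (rule int[OF admissible_trunc[OF K]] int[OF K])+
  have D': "has_bochner_integral (triple \<mu>) d (4 / N * (?l * ?P * ?P + ?P * ?l * ?P))" and le': "\<bar>X p - Y p\<bar> \<le> d p" for p
    unfolding d_def X_def Y_def by (rule D le)+
  have "2 * (Q_pair (trunc K N) \<mu> f - Q_pair K \<mu> f) = (LINT p|triple \<mu>. X p) - (LINT p|triple \<mu>. Y p)"
    by (simp add: Q_pair_eq X_def Y_def)
  also have "\<dots> = (LINT p|triple \<mu>. X p - Y p)" using iX iY by simp
  finally have "\<bar>2 * (Q_pair (trunc K N) \<mu> f - Q_pair K \<mu> f)\<bar> = \<bar>LINT p|triple \<mu>. X p - Y p\<bar>" by simp
  also have "\<dots> \<le> (LINT p|triple \<mu>. d p)"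
    by (rule integral_abs_bound_integral) (use D' iX iY le' in \<open>auto simp: has_bochner_integral_iff\<close>)
  also have "\<dots> = 4 / N * (?l * ?P * ?P + ?P * ?l * ?P)" using D' by (rule has_bochner_integral_integral_eq)
  also have "\<dots> = 8 / N * ?l * (?P * ?P)" by simp
  also have "\<dots> \<le> 8 / N * ?l * (c * c)" using P l0 N wclass_c_nonneg[OF wc] by (intro mult_left_mono mult_mono) auto
  also have "\<dots> = 2 * (4 * c\<^sup>2 * ?l / N)" by (simp add: power2_eq_square)
  finally show ?thesis unfolding abs_mult by simp
qed

section \<open>Euler polygons\<close>

text \<open>\<open>M / (1 - a * M * s)\<close> solves \<open>k' = a * k\<^sup>2\<close> with value
  \<open>M\<close> at \<open>s = 0\<close>. It is convex, so an Euler step started below it stays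
  below; algebraically this is \<open>(D + q) * (D - q) \<le> D\<^sup>2\<close>.\<close>

lemma riccati_step:
  fixes a s r M :: real
  assumes "0 \<le> a" "0 < M" "0 \<le> r" "a * M * (s + r) < 1" "0 \<le> s" "0 \<le> k" "k \<le> M / (1 - a * M * s)"
  shows "k + r * a * k\<^sup>2 \<le> M / (1 - a * M * (s + r))"
proof -
  define D where "D = 1 - a * M * s"
  define q where "q = a * M * r"
  have q0: "0 \<le> q" using assms by (simp add: q_def)
  have Dq: "1 - a * M * (s + r) = D - q" by (simp add: D_def q_def algebra_simps)
  have D: "q < D" using assms(4) unfolding D_def q_def by (simp add: algebra_simps)
  have D0: "0 < D" "0 < D - q" using D q0 by auto
  have k: "k \<le> M / D" using assms(7) by (simp add: D_def)
  have "k + r * a * k\<^sup>2 \<le> M / D + r * a * (M / D)\<^sup>2"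
    using k assms by (intro add_mono mult_left_mono power_mono) auto
  also have "\<dots> = M * (D + q) / D\<^sup>2" using D0 by (simp add: q_def field_simps power2_eq_square)
  also have "\<dots> \<le> M / (D - q)"
  proof -
    have "(D + q) * (D - q) \<le> D\<^sup>2" by (simp add: algebra_simps power2_eq_square)
    then have "M * ((D + q) * (D - q)) \<le> M * D\<^sup>2" using assms by (intro mult_left_mono) auto
    then have "M * (D + q) * (D - q) \<le> M * D\<^sup>2" by (simp only: mult.assoc)
    then show ?thesis using D0 by (simp add: divide_le_eq le_divide_eq pos_divide_le_eq pos_le_divide_eq)
  qed
  finally show ?thesis unfolding Dq .
qed

text \<open>\<open>life\<close> keeps the Riccati majorant finite up to \<open>T\<close>, and
  \<open>hC\<close> is the step restriction for a kernel bounded by \<open>(1 + N) ^ 3\<close>.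
  \<open>M2\<close> is a positive majorant rather than the second moment itself, so that the zero
  measure is covered.\<close>

locale polygon =
  fixes K :: "real \<Rightarrow> real \<Rightarrow> real \<Rightarrow> real" and c N h T M2 :: real and \<rho> :: "real measure"
  assumes sc: "sclass N c \<rho>" and K: "admissible K" and N: "1 \<le> N" and h: "0 < h" and T: "0 \<le> T"
    and hC: "h * (1 + N) ^ 3 * c\<^sup>2 \<le> 1" and M2: "0 < M2" and life: "c * M2 * T < 1"
    and m2: "(LINT x|\<rho>. (wt x)\<^sup>2) \<le> M2"
begin

abbreviation "KN \<equiv> trunc K N"

definition sq_bound :: real where "sq_bound = M2 / (1 - c * M2 * T)"

primrec E :: "nat \<Rightarrow> real measure" where
  "E 0 = \<rho>"
| "E (Suc k) = euler_step KN h (E k)"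

definition idx :: "real \<Rightarrow> nat" where "idx t = nat \<lfloor>t / h\<rfloor>"

text \<open>A shorter Euler step from the last grid point interpolates: against a test function it
  is affine in time, and it stays a positive measure because shorter steps obey the same
  restriction.\<close>

definition path :: "real \<Rightarrow> real measure" where
  "path t = euler_step KN (t - real (idx t) * h) (E (idx t))"

definition vel :: "(real \<Rightarrow> real) \<Rightarrow> real \<Rightarrow> real" where
  "vel f t = Q_pair KN (E (idx t)) f"

text \<open>The invariant of the induction over Euler steps. The third moment obeys a linear
  inequality with rate at most \<open>3 * c * sq_bound\<close>, hence the exponential.\<close>

definition bounds :: "real \<Rightarrow> real measure \<Rightarrow> bool" where
  "bounds s \<mu> \<longleftrightarrow> sclass N c \<mu> \<and> (LINT x|\<mu>. wt x) = (LINT x|\<rho>. wt x) \<and> (LINT x|\<mu>. \<bar>x\<bar>) = (LINT x|\<rho>. \<bar>x\<bar>) \<and>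
     (LINT x|\<mu>. (wt x)\<^sup>2) \<le> M2 / (1 - c * M2 * s) \<and>
     (LINT x|\<mu>. wt x ^ 3) \<le> (LINT x|\<rho>. wt x ^ 3) * exp (3 * c * sq_bound * s)"

lemma wc: "wclass c \<rho>" using sc by (simp add: sclass_def)

lemma c0: "0 \<le> c" by (rule wclass_c_nonneg[OF wc])

lemma riccati_le_sq_bound: "0 \<le> s \<Longrightarrow> s \<le> T \<Longrightarrow> M2 / (1 - c * M2 * s) \<le> sq_bound"
  unfolding sq_bound_def using life M2 c0 by (intro divide_left_mono mult_left_mono mult_pos_pos diff_left_mono)
    (auto intro: le_less_trans[OF mult_left_mono])

lemma sq_bound_pos: "0 < sq_bound" using life M2 by (simp add: sq_bound_def)

lemma euler_trunc:
  assumes "sclass N c \<mu>" "0 \<le> r" "r \<le> h"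
  shows "euler_trunc K c N r \<mu>"
proof
  have "r * ((1 + N) ^ 3 * c\<^sup>2) \<le> h * ((1 + N) ^ 3 * c\<^sup>2)"
    using assms N by (intro mult_right_mono) auto
  then show "r * (1 + N) ^ 3 * c\<^sup>2 \<le> 1" using hC by (simp add: mult.assoc)
qed (use assms N K in auto)

lemma bounds_step:
  assumes b: "bounds s \<mu>" and r: "0 \<le> r" "r \<le> h" "0 \<le> s" "s + r \<le> T"
  shows "bounds (s + r) (euler_step KN r \<mu>)"
proof -
  have scm: "sclass N c \<mu>" using b by (simp add: bounds_def)
  interpret e: euler_trunc K c N r \<mu> by (rule euler_trunc[OF scm r(1,2)])
  let ?k = "LINT x|\<mu>. (wt x)\<^sup>2" and ?l = "LINT x|\<mu>. wt x ^ 3" and ?A = "LINT x|\<rho>. wt x ^ 3"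
  have k: "0 \<le> ?k" "?k \<le> M2 / (1 - c * M2 * s)" using e.moment_nonneg[of 2] b by (simp_all add: bounds_def)
  have l: "0 \<le> ?l" "?l \<le> ?A * exp (3 * c * sq_bound * s)" using e.moment_nonneg[of 3] b by (simp_all add: bounds_def)
  have lt: "c * M2 * (s + r) < 1"
    using mult_left_mono[OF r(4), of "c * M2"] c0 M2 life by simp
  have "(LINT x|e.\<sigma>. (wt x)\<^sup>2) \<le> M2 / (1 - c * M2 * (s + r))"
    using order_trans[OF e.step_sq riccati_step[OF c0 M2 r(1) lt r(3) k]] .
  moreover have "(LINT x|e.\<sigma>. wt x ^ 3) \<le> ?A * exp (3 * c * sq_bound * (s + r))"
  proof -
    have "?k \<le> sq_bound" using k(2) riccati_le_sq_bound[of s] r by linarith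
    then have "3 * r * c * ?k \<le> 3 * r * c * sq_bound" using r c0 by (intro mult_left_mono) auto
    also have "1 + \<dots> \<le> exp (3 * r * c * sq_bound)" by (rule exp_ge_add_one_self)
    finally have e1: "1 + 3 * r * c * ?k \<le> exp (3 * r * c * sq_bound)" by simp
    have "0 \<le> ?A * exp (3 * c * sq_bound * s)" using l by linarith
    then have "?l * (1 + 3 * r * c * ?k) \<le> (?A * exp (3 * c * sq_bound * s)) * exp (3 * r * c * sq_bound)"
      using l e1 k r c0 by (intro mult_mono) auto
    also have "\<dots> = ?A * exp (3 * c * sq_bound * (s + r))"
      by (simp add: exp_add[symmetric] mult.assoc) (simp add: algebra_simps)
    finally show ?thesis using e.step_cube by linarith
  qed
  moreover have "(LINT x|e.\<sigma>. \<bar>x\<bar>) = (LINT x|\<mu>. \<bar>x\<bar>)" using e.step_affine[of 0] by simp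
  ultimately show ?thesis using b e.step_sclass e.step_wt by (simp add: bounds_def)
qed

lemma bounds_E: "real k * h \<le> T \<Longrightarrow> bounds (real k * h) (E k)"
proof (induction k)
  case 0
  then show ?case using sc m2 by (simp add: bounds_def)
next
  case (Suc k)
  have "real k * h \<le> real (Suc k) * h" using h by (intro mult_right_mono) auto
  then have k: "real k * h \<le> T" using Suc.prems by linarith
  have e: "real (Suc k) * h = real k * h + h" by (simp add: algebra_simps)
  have "bounds (real k * h + h) (euler_step KN h (E k))"
    by (rule bounds_step[OF Suc.IH[OF k]]) (use h Suc.prems e in auto)
  then show ?case unfolding e E.simps .
qed

lemma idx:
  assumes "0 \<le> t"
  shows "real (idx t) * h \<le> t" "t < real (idx t) * h + h"
proof -
  have "0 \<le> t / h" using assms h by simp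
  then have "real (idx t) = of_int \<lfloor>t / h\<rfloor>" by (simp add: idx_def)
  then have "real (idx t) \<le> t / h" "t / h < real (idx t) + 1" by linarith+
  then show "real (idx t) * h \<le> t" "t < real (idx t) * h + h"
    using h by (simp_all add: pos_le_divide_eq pos_divide_less_eq algebra_simps)
qed

lemma idx_eq:
  assumes "real k * h \<le> t" "t < real k * h + h"
  shows "idx t = k"
proof -
  have "real k \<le> t / h" "t / h < real k + 1"
    using assms h by (simp_all add: pos_le_divide_eq pos_divide_less_eq algebra_simps)
  then have "\<lfloor>t / h\<rfloor> = int k" by (intro floor_unique) auto
  then show ?thesis by (simp add: idx_def)
qed

lemma bounds_path:
  assumes t: "0 \<le> t" "t \<le> T"
  shows "bounds t (path t)" "sclass N c (E (idx t))" "euler_trunc K c N (t - real (idx t) * h) (E (idx t))"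
proof -
  note i = idx[OF t(1)]
  have b: "bounds (real (idx t) * h) (E (idx t))" by (rule bounds_E) (use i t in linarith)
  then show s: "sclass N c (E (idx t))" by (simp add: bounds_def)
  show "euler_trunc K c N (t - real (idx t) * h) (E (idx t))"
    by (rule euler_trunc[OF s]) (use i in linarith)+
  have "bounds (real (idx t) * h + (t - real (idx t) * h)) (path t)"
    unfolding path_def by (rule bounds_step[OF b]) (use i t h in auto)
  then show "bounds t (path t)" by simp
qed

lemma test_local_bound: "(\<And>x. \<bar>f x\<bar> \<le> wt x) \<Longrightarrow> \<bar>x\<bar> \<le> N \<Longrightarrow> \<bar>f x\<bar> \<le> 1 + N"
  using order_trans[of "\<bar>f x\<bar>" "wt x" "1 + N"] by (simp add: wt_def)

lemma vel_bound:
  assumes f: "f \<in> borel_measurable borel" "\<And>x. \<bar>f x\<bar> \<le> wt x" and t: "0 \<le> t" "t \<le> T"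
  shows "\<bar>vel f t\<bar> \<le> 4 * (1 + N) / 2 * c ^ 3"
proof -
  have "wclass c (E (idx t))" using bounds_path(2)[OF t] by (simp add: sclass_def)
  then show ?thesis
    unfolding vel_def
    by (rule Q_pair_bound[OF _ admissible_trunc[OF K] f(1)], intro trunc_gain_loss_le[OF K])
      (use test_local_bound[of f] f N in auto)
qed

lemma vel_measurable: "vel f \<in> borel_measurable borel"
proof -
  have "(\<lambda>t. nat \<lfloor>t / h\<rfloor>) \<in> measurable borel (count_space UNIV)" by measurable
  from measurable_compose[OF this, of "\<lambda>k. Q_pair KN (E k) f" borel]
  show ?thesis by (simp add: vel_def[abs_def] idx_def)
qed

lemma vel_integrable:
  assumes f: "f \<in> borel_measurable borel" "\<And>x. \<bar>f x\<bar> \<le> wt x"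
  shows "set_integrable lborel {0..T} (vel f)"
  unfolding set_integrable_def
proof (rule Bochner_Integration.integrable_bound[OF set_integrable_const_Icc[of 0 T "4 * (1 + N) / 2 * c ^ 3", unfolded set_integrable_def]])
  show "(\<lambda>t. indicator {0..T} t *\<^sub>R vel f t) \<in> borel_measurable lborel"
    using vel_measurable by simp
  show "AE t in lborel. norm (indicator {0..T} t *\<^sub>R vel f t) \<le> norm (indicator {0..T} t *\<^sub>R (4 * (1 + N) / 2 * c ^ 3))"
  proof (intro AE_I2)
    fix t
    have "\<bar>vel f t\<bar> \<le> \<bar>4 * (1 + N) / 2 * c ^ 3\<bar>" if "t \<in> {0..T}"
      by (rule order_trans[OF vel_bound[OF f] abs_ge_self]) (use that in auto)
    then show "norm (indicator {0..T} t *\<^sub>R vel f t) \<le> norm (indicator {0..T} t *\<^sub>R (4 * (1 + N) / 2 * c ^ 3))"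
      by (cases "t \<in> {0..T}") (simp_all only: indicator_simps scaleR_one real_norm_def scaleR_zero_left order_refl not_False_eq_True)
  qed
qed

lemma vel_integral_piece:
  assumes r: "0 \<le> r" "r \<le> h"
  shows "(LINT s:{real k * h<..real k * h + r}|lborel. vel f s) = r * Q_pair KN (E k) f"
proof -
  \<comment> \<open>For \<open>r = h\<close> the right end point already belongs to the next cell;
    being a single point it is discarded.\<close>
  have "AE s in lborel. s \<noteq> real k * h + r" by (rule AE_lborel_singleton)
  then have "AE s in lborel. indicator {real k * h<..real k * h + r} s *\<^sub>R vel f s
     = indicator {real k * h<..real k * h + r} s *\<^sub>R Q_pair KN (E k) f"
  proof eventually_elim
    case (elim s)
    show ?case
    proof (cases "s \<in> {real k * h<..real k * h + r}")
      case True
      then have "idx s = k" using elim r by (intro idx_eq) auto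
      then show ?thesis by (simp add: vel_def)
    qed simp
  qed
  then have "(LINT s:{real k * h<..real k * h + r}|lborel. vel f s) = (LINT s:{real k * h<..real k * h + r}|lborel. Q_pair KN (E k) f)"
    unfolding set_lebesgue_integral_def
    by (intro integral_cong_AE) (use vel_measurable in auto)
  then show ?thesis using r by (simp add: set_lebesgue_integral_def)
qed

lemma E_integral:
  assumes f: "f \<in> borel_measurable borel" "\<And>x. \<bar>f x\<bar> \<le> wt x" and k: "real k * h \<le> T"
  shows "(LINT x|E k. f x) = (LINT x|\<rho>. f x) + (LINT s:{0..real k * h}|lborel. vel f s)"
  using k
proof (induction k)
  case 0
  then show ?case by simp
next
  case (Suc k)
  have e: "real (Suc k) * h = real k * h + h" by (simp add: algebra_simps)
  have k: "real k * h \<le> T" using Suc.prems e h by linarith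
  have "sclass N c (E k)" using bounds_E[OF k] by (simp add: bounds_def)
  then interpret e: euler_trunc K c N h "E k" by (rule euler_trunc) (use h in auto)
  have "(LINT x|E (Suc k). f x) = (LINT x|E k. f x) + h * Q_pair KN (E k) f"
    unfolding E.simps by (rule e.step_integral_local(2)[OF f(1)]) (rule test_local_bound[OF f(2)])
  also have "(LINT s:{real k * h<..real k * h + h}|lborel. vel f s) = h * Q_pair KN (E k) f"
    by (rule vel_integral_piece) (use h in auto)
  then have "h * Q_pair KN (E k) f = (LINT s:{0..real (Suc k) * h}|lborel. vel f s) - (LINT s:{0..real k * h}|lborel. vel f s)"
    using set_integral_split[OF vel_integrable[OF f], of "real k * h" "real (Suc k) * h"] Suc.prems e h by auto
  finally show ?case using Suc.IH[OF k] by simp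
qed

lemma path_integral:
  assumes f: "f \<in> borel_measurable borel" "\<And>x. \<bar>f x\<bar> \<le> wt x" and t: "0 \<le> t" "t \<le> T"
  shows "(LINT x|path t. f x) = (LINT x|\<rho>. f x) + (LINT s:{0..t}|lborel. vel f s)"
proof -
  note i = idx[OF t(1)]
  interpret e: euler_trunc K c N "t - real (idx t) * h" "E (idx t)" by (rule bounds_path(3)[OF t])
  have k: "real (idx t) * h \<le> T" using i t by linarith
  have "(LINT x|path t. f x) = (LINT x|E (idx t). f x) + (t - real (idx t) * h) * Q_pair KN (E (idx t)) f"
    unfolding path_def by (rule e.step_integral_local(2)[OF f(1)]) (rule test_local_bound[OF f(2)])
  moreover have "(t - real (idx t) * h) * Q_pair KN (E (idx t)) f = (LINT s:{real (idx t) * h<..t}|lborel. vel f s)"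
    using vel_integral_piece[of "t - real (idx t) * h" "idx t" f] i by simp
  moreover have "(LINT s:{0..t}|lborel. vel f s) = (LINT s:{0..real (idx t) * h}|lborel. vel f s) + (LINT s:{real (idx t) * h<..t}|lborel. vel f s)"
    using i t h by (intro set_integral_split[OF vel_integrable[OF f]]) auto
  ultimately show ?thesis using E_integral[OF f k] by simp
qed

lemma path_initial:
  assumes f: "f \<in> borel_measurable borel" "\<And>x. \<bar>f x\<bar> \<le> wt x"
  shows "(LINT x|path 0. f x) = (LINT x|\<rho>. f x)"
  using path_integral[OF f order_refl T] by simp

text \<open>Two errors add up: freezing the velocity at the last grid point, of order
  \<open>h\<close>, and truncating the kernel, of order \<open>1 / N\<close>.\<close>

lemma vel_close:
  assumes f: "f \<in> borel_measurable borel" "\<And>x. \<bar>f x\<bar> \<le> wt x" and t: "0 \<le> t" "t \<le> T"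
  shows "\<bar>vel f t - Q_pair K (path t) f\<bar> \<le> 24 * h * (1 + N)\<^sup>2 * c ^ 5 + 4 * c\<^sup>2 * ((LINT x|\<rho>. wt x ^ 3) * exp (3 * c * sq_bound * T)) / N"
proof -
  note i = idx[OF t(1)] and b = bounds_path[OF t]
  let ?A = "LINT x|\<rho>. wt x ^ 3"
  interpret e: euler_trunc K c N "t - real (idx t) * h" "E (idx t)" by (rule b(3))
  have sp: "sclass N c (path t)" using b(1) by (simp add: bounds_def)
  have "\<bar>Q_pair KN (path t) f - Q_pair KN (E (idx t)) f\<bar> \<le> 24 * (t - real (idx t) * h) * (1 + N)\<^sup>2 * c ^ 5"
    unfolding path_def by (rule e.step_Q_pair_close[OF f])
  also have "\<dots> \<le> 24 * h * (1 + N)\<^sup>2 * c ^ 5"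
    using i c0 by (intro mult_right_mono mult_left_mono) auto
  finally have 1: "\<bar>Q_pair KN (path t) f - Q_pair KN (E (idx t)) f\<bar> \<le> 24 * h * (1 + N)\<^sup>2 * c ^ 5" .
  have l0: "0 \<le> ?A" by (intro integral_nonneg_AE) auto
  have "(LINT x|path t. wt x ^ 3) \<le> ?A * exp (3 * c * sq_bound * t)" using b(1) by (simp add: bounds_def)
  also have "\<dots> \<le> ?A * exp (3 * c * sq_bound * T)" using l0 t c0 sq_bound_pos by (intro mult_left_mono) (auto intro!: mult_left_mono)
  finally have "4 * c\<^sup>2 * (LINT x|path t. wt x ^ 3) / N \<le> 4 * c\<^sup>2 * (?A * exp (3 * c * sq_bound * T)) / N"
    using N by (intro divide_right_mono mult_left_mono) auto
  moreover have "\<bar>Q_pair KN (path t) f - Q_pair K (path t) f\<bar> \<le> 4 * c\<^sup>2 * (LINT x|path t. wt x ^ 3) / N"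
    by (rule trunc_Q_pair_close[OF sp K _ f]) (use N in simp)
  ultimately show ?thesis using 1 unfolding vel_def by linarith
qed

lemma path_approx_solution:
  assumes e: "24 * h * (1 + N)\<^sup>2 * c ^ 5 + 4 * c\<^sup>2 * ((LINT x|\<rho>. wt x ^ 3) * exp (3 * c * sq_bound * T)) / N \<le> e"
  shows "approx_solution K c T e path vel"
  unfolding approx_solution_def
proof (intro conjI ballI allI impI)
  fix t assume t: "t \<in> {0..T}"
  then have t': "0 \<le> t" "t \<le> T" by auto
  show "wclass c (path t)" using bounds_path(1)[OF t'] by (simp add: bounds_def sclass_def)
  fix f assume "tests f"
  then have f: "f \<in> borel_measurable borel" "\<bar>f x\<bar> \<le> wt x" for x by (auto simp: tests_def)
  show "\<bar>vel f t - Q_pair K (path t) f\<bar> \<le> e" using vel_close[OF f t'] e by linarith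
  show "(LINT x|path t. f x) = (LINT x|path 0. f x) + (LINT s:{0..t}|lborel. vel f s)"
    unfolding path_initial[OF f] by (rule path_integral[OF f t'])
next
  fix f assume "tests f"
  then have f: "f \<in> borel_measurable borel" "\<bar>f x\<bar> \<le> wt x" for x by (auto simp: tests_def)
  show "set_integrable lborel {0..T} (vel f)" by (rule vel_integrable[OF f])
qed

lemma path_sq_moment:
  assumes t: "0 \<le> t" "t \<le> T"
  shows "sq_moment (path t) \<le> ennreal sq_bound"
proof -
  have b: "sclass N c (path t)" "(LINT x|path t. (wt x)\<^sup>2) \<le> M2 / (1 - c * M2 * t)"
    using bounds_path(1)[OF t] by (simp_all add: bounds_def)
  have i: "integrable (path t) (\<lambda>x. (wt x)\<^sup>2)"
    by (rule sclass_integrable[OF b(1), where b="(1 + N)\<^sup>2"]) (auto simp: wt_def intro!: power_mono)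
  have "sq_moment (path t) = ennreal (LINT x|path t. (wt x)\<^sup>2)"
    unfolding sq_moment_def by (rule nn_integral_eq_integral[OF i]) simp
  also have "\<dots> \<le> ennreal sq_bound" using b(2) riccati_le_sq_bound[OF t] by (intro ennreal_leI) linarith
  finally show ?thesis .
qed

end

lemma euler_polygon_exists:
  assumes sc: "sclass n c \<rho>" and K: "admissible K" and T: "0 \<le> T" and M2: "0 < M2" and life: "c * M2 * T < 1"
    and m2: "(LINT x|\<rho>. (wt x)\<^sup>2) \<le> M2" and e: "0 < e"
  obtains \<nu> q where "approx_solution K c T e \<nu> q"
    "\<And>t. t \<in> {0..T} \<Longrightarrow> (LINT x|\<nu> t. wt x) = (LINT x|\<rho>. wt x)"
    "\<And>t. t \<in> {0..T} \<Longrightarrow> (LINT x|\<nu> t. \<bar>x\<bar>) = (LINT x|\<rho>. \<bar>x\<bar>)"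
    "\<And>t. t \<in> {0..T} \<Longrightarrow> sq_moment (\<nu> t) \<le> ennreal (M2 / (1 - c * M2 * T))"
    "\<And>f. \<lbrakk>f \<in> borel_measurable borel; \<And>x. \<bar>f x\<bar> \<le> wt x\<rbrakk> \<Longrightarrow> (LINT x|\<nu> 0. f x) = (LINT x|\<rho>. f x)"
proof -
  have c0: "0 \<le> c" using sc wclass_c_nonneg by (auto simp: sclass_def)
  define B where "B = (LINT x|\<rho>. wt x ^ 3) * exp (3 * c * (M2 / (1 - c * M2 * T)) * T)"
  have B0: "0 \<le> B" unfolding B_def by (intro mult_nonneg_nonneg integral_nonneg_AE) auto
  \<comment> \<open>Makes the truncation error at most \<open>e / 2\<close> and exceeds the support
    radius \<open>n\<close>. It depends on \<open>\<rho>\<close> through the third moment bound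
    \<open>B\<close>.\<close>
  define N where "N = max n 1 + 8 * c\<^sup>2 * B / e"
  have pos: "0 \<le> 8 * c\<^sup>2 * B / e" using B0 e by simp
  have N: "1 \<le> N" "n \<le> N" "8 * c\<^sup>2 * B / e \<le> N" using pos by (auto simp: N_def)
  have scN: "sclass N c \<rho>" using sc N(2) unfolding sclass_def by (auto elim!: eventually_mono)
  \<comment> \<open>\<open>h = 1 / Z\<close> meets the step restriction and makes the freezing error
    at most \<open>e / 2\<close>. It is fixed after \<open>N\<close>, whose powers it has to
    beat.\<close>
  define Z where "Z = 1 + (1 + N) ^ 3 * c\<^sup>2 + 48 * (1 + N)\<^sup>2 * c ^ 5 / e"
  have z: "0 \<le> (1 + N) ^ 3 * c\<^sup>2" "0 \<le> 48 * (1 + N)\<^sup>2 * c ^ 5 / e" using N c0 e by simp_all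
  then have Z: "0 < Z" "(1 + N) ^ 3 * c\<^sup>2 \<le> Z" "48 * (1 + N)\<^sup>2 * c ^ 5 / e \<le> Z" by (auto simp: Z_def)
  define h where "h = 1 / Z"
  have h: "0 < h" using Z by (simp add: h_def)
  have h1: "h * (1 + N) ^ 3 * c\<^sup>2 \<le> 1" using Z by (simp add: h_def)
  have h2: "24 * h * (1 + N)\<^sup>2 * c ^ 5 \<le> e / 2"
  proof -
    have "48 * (1 + N)\<^sup>2 * c ^ 5 \<le> Z * e" using Z(3) e by (simp add: pos_divide_le_eq)
    then have "48 * (1 + N)\<^sup>2 * c ^ 5 / Z \<le> e" using Z(1) by (simp add: pos_divide_le_eq mult.commute)
    then show ?thesis by (simp add: h_def)
  qed
  interpret p: polygon K c N h T M2 \<rho>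
    by unfold_locales (use scN K N h T h1 M2 life m2 in auto)
  have h3: "4 * c\<^sup>2 * B / N \<le> e / 2"
  proof -
    have "8 * c\<^sup>2 * B \<le> N * e" using N(3) e by (simp add: pos_divide_le_eq)
    then have "8 * c\<^sup>2 * B / N \<le> e" using N(1) by (simp add: pos_divide_le_eq mult.commute)
    then show ?thesis by simp
  qed
  have le: "24 * h * (1 + N)\<^sup>2 * c ^ 5 + 4 * c\<^sup>2 * ((LINT x|\<rho>. wt x ^ 3) * exp (3 * c * p.sq_bound * T)) / N \<le> e"
    using h2 h3 by (simp add: B_def p.sq_bound_def)
  show thesis
  proof (rule that[OF p.path_approx_solution[OF le]])
    fix t assume "t \<in> {0..T}"
    then have t: "0 \<le> t" "t \<le> T" by auto
    show "(LINT x|p.path t. wt x) = (LINT x|\<rho>. wt x)" "(LINT x|p.path t. \<bar>x\<bar>) = (LINT x|\<rho>. \<bar>x\<bar>)"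
      using p.bounds_path(1)[OF t] by (simp_all add: p.bounds_def)
    show "sq_moment (p.path t) \<le> ennreal (M2 / (1 - c * M2 * T))"
      using p.path_sq_moment[OF t] by (simp add: p.sq_bound_def)
  qed (rule p.path_initial)
qed

section \<open>Limits in weighted total variation\<close>

lemma Q_pair_scale: "Q_pair K \<mu> (\<lambda>x. b * f x) = b * Q_pair K \<mu> f"
proof -
  have "(\<lambda>(x, y, z). restr K x y z * gain_loss (\<lambda>x. b * f x) x y z) = (\<lambda>p. b * (case p of (x, y, z) \<Rightarrow> restr K x y z * gain_loss f x y z))"
    by (auto simp: fun_eq_iff gain_loss_def algebra_simps)
  then show ?thesis by (simp add: Q_pair_eq)
qed

lemma excess_upper_wt:
  assumes "wclass c \<mu>" "wclass c \<nu>" "f \<in> borel_measurable borel" "\<And>x. 0 \<le> f x" "\<And>x. f x \<le> wt x"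
  shows "(LINT x|\<nu>. f x) - (LINT x|\<mu>. f x) \<le> excess wt \<nu> \<mu>"
  by (rule excess_upper[OF assms(1,2) wt_measurable _ assms(3-5), of 1]) simp

text \<open>The positive and negative parts of \<open>f\<close> both lie between \<open>0\<close>
  and \<open>wt\<close>, and each of them is controlled from both sides by the two excesses.\<close>

lemma integral_diff_le_excess:
  assumes mu: "wclass c \<mu>" and nu: "wclass c \<nu>" and f: "f \<in> borel_measurable borel" "\<And>x. \<bar>f x\<bar> \<le> wt x"
  shows "\<bar>(LINT x|\<nu>. f x) - (LINT x|\<mu>. f x)\<bar> \<le> 2 * (excess wt \<nu> \<mu> + excess wt \<mu> \<nu>)"
proof -
  let ?p = "\<lambda>x. max 0 (f x)" and ?n = "\<lambda>x. max 0 (- f x)"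
  have m: "?p \<in> borel_measurable borel" "?n \<in> borel_measurable borel" using f(1) by measurable
  have b: "?p x \<le> wt x" "?n x \<le> wt x" for x
    using f(2)[of x] wt_nonneg[of x] by (auto simp: abs_le_iff)
  have i: "integrable \<kappa> ?p" "integrable \<kappa> ?n" if "wclass c \<kappa>" for \<kappa>
    by (rule wclass_integrable[OF that m(1), of 1] wclass_integrable[OF that m(2), of 1]; use b in simp)+
  have e: "(LINT x|\<kappa>. f x) = (LINT x|\<kappa>. ?p x) - (LINT x|\<kappa>. ?n x)" if "wclass c \<kappa>" for \<kappa>
  proof -
    have "(LINT x|\<kappa>. f x) = (LINT x|\<kappa>. ?p x - ?n x)"
      by (rule Bochner_Integration.integral_cong) (auto simp: max_def)
    also have "\<dots> = (LINT x|\<kappa>. ?p x) - (LINT x|\<kappa>. ?n x)"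
      by (rule Bochner_Integration.integral_diff[OF i[OF that]])
    finally show ?thesis .
  qed
  have "(LINT x|\<nu>. ?p x) - (LINT x|\<mu>. ?p x) \<le> excess wt \<nu> \<mu>" "(LINT x|\<nu>. ?n x) - (LINT x|\<mu>. ?n x) \<le> excess wt \<nu> \<mu>"
    by (rule excess_upper_wt[OF mu nu m(1) _ b(1)] excess_upper_wt[OF mu nu m(2) _ b(2)]; simp)+
  moreover have "(LINT x|\<mu>. ?p x) - (LINT x|\<nu>. ?p x) \<le> excess wt \<mu> \<nu>" "(LINT x|\<mu>. ?n x) - (LINT x|\<nu>. ?n x) \<le> excess wt \<mu> \<nu>"
    by (rule excess_upper_wt[OF nu mu m(1) _ b(1)] excess_upper_wt[OF nu mu m(2) _ b(2)]; simp)+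
  moreover have "0 \<le> excess wt \<mu> \<nu>" "0 \<le> excess wt \<nu> \<mu>"
    using excess_wt_bounds(1)[OF mu nu] excess_wt_bounds(1)[OF nu mu] by auto
  moreover have "\<bar>p1 - n1 - (p2 - n2)\<bar> \<le> 2 * (A + B)"
    if "p1 - p2 \<le> A" "n1 - n2 \<le> A" "p2 - p1 \<le> B" "n2 - n1 \<le> B" "0 \<le> B" "0 \<le> A" for p1 p2 n1 n2 A B :: real
    using that by argo
  ultimately show ?thesis unfolding e[OF mu] e[OF nu] by blast
qed

lemma (in density_pair) wdist_eq_excess: "wdist = excess wt \<nu> \<mu> + excess wt \<mu> \<nu>"
proof -
  interpret s: density_pair c \<nu> \<mu> m v u by (rule swap)
  have "has_bochner_integral m (\<lambda>x. wt x * max 0 (v x - u x) + wt x * max 0 (u x - v x)) (excess wt \<nu> \<mu> + excess wt \<mu> \<nu>)"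
    by (intro has_bochner_integral_add excess_eq[where C=1] s.excess_eq[where C=1]) auto
  moreover have "wt x * max 0 (v x - u x) + wt x * max 0 (u x - v x) = wt x * \<bar>v x - u x\<bar>" for x
    by (auto simp: max_def abs_if)
  ultimately show ?thesis unfolding wdist_def by (simp add: has_bochner_integral_iff)
qed

lemma Q_pair_diff_le_excess:
  assumes mu: "wclass c \<mu>" and nu: "wclass c \<nu>" and K: "admissible K" and f: "f \<in> borel_measurable borel" "\<And>x. \<bar>f x\<bar> \<le> b"
  shows "\<bar>Q_pair K \<nu> f - Q_pair K \<mu> f\<bar> \<le> 6 * b * c\<^sup>2 * (excess wt \<nu> \<mu> + excess wt \<mu> \<nu>)"
proof -
  obtain m u v where "density_pair c \<mu> \<nu> m u v" using density_pair_exists[OF mu nu] .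
  then interpret density_pair c \<mu> \<nu> m u v .
  show ?thesis
    using Q_pair_lipschitz[OF K f(1) restr_gain_loss_bounded[OF K f(2)]] by (simp add: wdist_eq_excess)
qed

text \<open>The set function \<open>B \<mapsto> lim \<integral>\<^sub>B wt dM\<^sub>n\<close> is countably additive because the limit is uniform in \<open>B\<close>.\<close>

lemma excess_limit:
  fixes M :: "nat \<Rightarrow> real measure"
  assumes wc: "\<And>n. wclass c (M n)" and cau: "\<And>n m. excess wt (M n) (M m) \<le> \<eta> n + \<eta> m" and \<eta>: "\<eta> \<longlonglongrightarrow> 0"
  obtains L where "wclass c L" "\<And>n. excess wt (M n) L \<le> \<eta> n" "\<And>n. excess wt L (M n) \<le> \<eta> n"
proof -
  define a where "a B n = (LINT x|M n. wt x * indicator B x)" for B n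
  define F where "F B = lim (a B)" for B
  have ind: "0 \<le> wt x * indicator B x" "wt x * indicator B x \<le> wt x" for x and B :: "real set"
    by (auto simp: indicator_def)
  have i: "integrable \<kappa> (\<lambda>x. wt x * indicator B x)" if "wclass c \<kappa>" "B \<in> sets borel" for \<kappa> B
    using that(2) by (intro wclass_integrable[OF that(1), where C=1]) (auto simp: indicator_def)
  have ad: "a B n - a B m \<le> \<eta> n + \<eta> m" if "B \<in> sets borel" for B n m
  proof -
    have "(\<lambda>x. wt x * indicator B x) \<in> borel_measurable borel" using that by measurable
    from excess_upper_wt[OF wc[of m] wc[of n] this ind] show ?thesis
      using cau[of n m] unfolding a_def by linarith
  qed
  have conv: "a B \<longlonglongrightarrow> F B" if B: "B \<in> sets borel" for B
  proof -
    have "Cauchy (a B)"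
    proof (rule CauchyI)
      fix e :: real assume "0 < e"
      then have "\<forall>\<^sub>F n in sequentially. \<eta> n < e / 2" using order_tendstoD(2)[OF \<eta>, of "e / 2"] by simp
      then obtain N where N: "\<And>n. n \<ge> N \<Longrightarrow> \<eta> n < e / 2" by (auto simp: eventually_sequentially)
      have "norm (a B m - a B n) < e" if "m \<ge> N" "n \<ge> N" for m n
        using ad[OF B, of m n] ad[OF B, of n m] N[OF that(1)] N[OF that(2)] by (simp add: abs_less_iff)
      then show "\<exists>N. \<forall>m\<ge>N. \<forall>n\<ge>N. norm (a B m - a B n) < e" by blast
    qed
    then show ?thesis unfolding F_def by (simp add: Cauchy_convergent_iff convergent_LIMSEQ_iff)
  qed
  have close: "a B n - F B \<le> \<eta> n" "F B - a B n \<le> \<eta> n" if B: "B \<in> sets borel" for B n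
  proof -
    have "(\<lambda>m. a B n - a B m) \<longlonglongrightarrow> a B n - F B" "(\<lambda>m. \<eta> n + \<eta> m) \<longlonglongrightarrow> \<eta> n + 0"
      by (intro tendsto_intros conv B \<eta>)+
    from LIMSEQ_le[OF this] show "a B n - F B \<le> \<eta> n" using ad[OF B] by auto
    have "(\<lambda>m. a B m - a B n) \<longlonglongrightarrow> F B - a B n" "(\<lambda>m. \<eta> m + \<eta> n) \<longlonglongrightarrow> 0 + \<eta> n"
      by (intro tendsto_intros conv B \<eta>)+
    from LIMSEQ_le[OF this] show "F B - a B n \<le> \<eta> n" using ad[OF B] by auto
  qed
  have a0: "0 \<le> a B n" for B n unfolding a_def using ind(1) by (intro integral_nonneg_AE) auto
  have F0: "0 \<le> F B" if "B \<in> sets borel" for B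
    by (rule LIMSEQ_le_const[OF conv[OF that]]) (use a0 in auto)
  have Fe: "F {} = 0"
  proof -
    have "a {} = (\<lambda>n. 0)" by (simp add: a_def fun_eq_iff)
    then show ?thesis using LIMSEQ_unique[OF conv[of "{}"], of 0] by simp
  qed
  have Fadd: "F (A \<union> B) = F A + F B" if "A \<in> sets borel" "B \<in> sets borel" "A \<inter> B = {}" for A B
  proof -
    have "a (A \<union> B) n = a A n + a B n" for n
    proof -
      have "(\<lambda>x. wt x * indicator (A \<union> B) x) = (\<lambda>x. wt x * indicator A x + wt x * indicator B x)"
        using that(3) by (auto simp: fun_eq_iff indicator_def)
      then show ?thesis unfolding a_def using i[OF wc that(1)] i[OF wc that(2)] by simp
    qed
    then have "a (A \<union> B) = (\<lambda>n. a A n + a B n)" by (simp add: fun_eq_iff)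
    then have "(\<lambda>n. a A n + a B n) \<longlonglongrightarrow> F (A \<union> B)" using conv[of "A \<union> B"] that by simp
    then show ?thesis using LIMSEQ_unique tendsto_add[OF conv[OF that(1)] conv[OF that(2)]] by blast
  qed
  have ca: "countably_additive (sets borel) (\<lambda>B. ennreal (F B))"
  proof (rule sets.empty_continuous_imp_countably_additive)
    show "positive (sets borel) (\<lambda>B. ennreal (F B))" by (simp add: positive_def Fe)
    show "additive (sets borel) (\<lambda>B. ennreal (F B))"
      by (auto simp: additive_def Fadd F0 ennreal_plus)
    show "\<forall>A\<in>sets borel. ennreal (F A) \<noteq> \<infinity>" by simp
    fix A :: "nat \<Rightarrow> real set" assume A: "range A \<subseteq> sets borel" "decseq A" "(\<Inter>i. A i) = {}"
    have As: "A i \<in> sets borel" for i using A(1) by auto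
    \<comment> \<open>A single index \<open>n\<close> with small \<open>\<eta> n\<close>
      approximates \<open>F\<close> on all the sets \<open>A i\<close> at once, and the integral
      over \<open>A i\<close> against the one measure \<open>M n\<close> tends to
      \<open>0\<close>.\<close>
    have "(\<lambda>i. F (A i)) \<longlonglongrightarrow> 0"
    proof (rule LIMSEQ_I)
      fix e :: real assume "0 < e"
      then have "\<forall>\<^sub>F n in sequentially. \<eta> n < e / 2" using order_tendstoD(2)[OF \<eta>, of "e / 2"] by simp
      then obtain n where n: "\<eta> n < e / 2" by (auto simp: eventually_sequentially)
      have "(\<lambda>i. a (A i) n) \<longlonglongrightarrow> (LINT x|M n. 0)"
        unfolding a_def
      proof (rule integral_dominated_convergence[where w=wt])
        show "(\<lambda>x. wt x * indicator (A i) x) \<in> borel_measurable (M n)" for i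
          by (rule borel_measurable_integrable[OF i[OF wc As]])
        show "AE x in M n. norm (wt x * indicator (A i) x) \<le> wt x" for i
          using ind by (intro AE_I2) simp
        have "(\<lambda>i. wt x * indicator (A i) x) \<longlonglongrightarrow> 0" for x
        proof -
          obtain j where "x \<notin> A j" using A(3) by auto
          then have "x \<notin> A i" if "i \<ge> j" for i using decseqD[OF A(2) that] by auto
          then show ?thesis by (intro tendsto_eventually) (auto simp: eventually_sequentially intro!: exI[of _ j])
        qed
        then show "AE x in M n. (\<lambda>i. wt x * indicator (A i) x) \<longlonglongrightarrow> 0" by simp
      qed (use wclass_integrable_wt[OF wc] in auto)
      then have "(\<lambda>i. a (A i) n) \<longlonglongrightarrow> 0" by simp
      from order_tendstoD(2)[OF this, of "e / 2"] \<open>0 < e\<close>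
      obtain I where I: "\<And>j. j \<ge> I \<Longrightarrow> a (A j) n < e / 2" by (auto simp: eventually_sequentially)
      have "norm (F (A j) - 0) < e" if "j \<ge> I" for j
        using close(2)[OF As, of j n] I[OF that] n F0[OF As, of j] by simp
      then show "\<exists>no. \<forall>j\<ge>no. norm (F (A j) - 0) < e" by blast
    qed
    then show "(\<lambda>i. ennreal (F (A i))) \<longlonglongrightarrow> 0" using tendsto_ennrealI by fastforce
  qed
  \<comment> \<open>\<open>L'\<close> is the setwise limit of the measures with density
    \<open>wt\<close> with respect to \<open>M n\<close>; the division by \<open>wt\<close> in
    \<open>L\<close> undoes the weight.\<close>
  define L' where "L' = measure_of UNIV (sets borel) (\<lambda>B. ennreal (F B))"
  have sL': "sets L' = sets borel" unfolding L'_def using sets.sigma_sets_eq[of "borel :: real measure"] by simp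
  have eL': "emeasure L' B = ennreal (F B)" if "B \<in> sets borel" for B
    unfolding L'_def
  proof (rule emeasure_measure_of_sigma)
    show "sigma_algebra UNIV (sets (borel :: real measure))" using sets.sigma_algebra_axioms[of "borel :: real measure"] by simp
    show "positive (sets borel) (\<lambda>B. ennreal (F B))" by (simp add: positive_def Fe)
  qed (use ca that in auto)
  define L where "L = density L' (\<lambda>x. ennreal (1 / wt x))"
  have sL: "sets L = sets borel" by (simp add: L_def sL')
  have wm: "(\<lambda>x. ennreal (1 / wt x)) \<in> borel_measurable L'"
    unfolding measurable_cong_sets[OF sL' refl] by measurable
  have nnB: "(\<integral>\<^sup>+x. ennreal (wt x * indicator B x) \<partial>L) = ennreal (F B)" if B: "B \<in> sets borel" for B
  proof -
    have "(\<integral>\<^sup>+x. ennreal (wt x * indicator B x) \<partial>L) = (\<integral>\<^sup>+x. ennreal (1 / wt x) * ennreal (wt x * indicator B x) \<partial>L')"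
      unfolding L_def by (rule nn_integral_density[OF wm]) (use B in \<open>simp add: measurable_cong_sets[OF sL' refl]\<close>)
    also have "\<dots> = (\<integral>\<^sup>+x. indicator B x \<partial>L')"
    proof (intro nn_integral_cong)
      fix x
      have "wt x \<noteq> 0" using wt_pos[of x] by (rule less_imp_neq[symmetric])
      then have "1 / wt x * (wt x * indicator B x) = (indicator B x :: real)" by simp
      then show "ennreal (1 / wt x) * ennreal (wt x * indicator B x) = indicator B x"
        by (subst ennreal_mult[symmetric]) (auto simp: indicator_def)
    qed
    also have "\<dots> = ennreal (F B)" using B sL' eL' by simp
    finally show ?thesis .
  qed
  have Fc: "F UNIV \<le> c"
    by (rule LIMSEQ_le_const2[OF conv]) (use wclass_integral_wt[OF wc] in \<open>auto simp: a_def\<close>)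
  have wcL: "wclass c L"
    unfolding wclass_def measure_on_Rplus_def
  proof (intro conjI)
    show "sets L = sets borel" by (rule sL)
    show "(\<integral>\<^sup>+x. ennreal (wt x) \<partial>L) \<le> ennreal c" using nnB[of UNIV] Fc by (simp add: ennreal_leI)
    have "F {..<0} = 0"
    proof -
      have "a {..<0} n = 0" for n
        unfolding a_def
        by (rule integral_eq_zero_AE) (use wclass_AE[OF wc[of n]] in eventually_elim, auto)
      then have "a {..<0} = (\<lambda>n. 0)" by (simp add: fun_eq_iff)
      then have "(\<lambda>n. 0) \<longlonglongrightarrow> F {..<0}" using conv[of "{..<0}"] by simp
      then show ?thesis using LIMSEQ_unique tendsto_const by blast
    qed
    then have "emeasure L' {..<0} = 0" using eL'[of "{..<0}"] by simp
    then have "{..<0} \<in> null_sets L'" by (simp add: null_sets_def sL')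
    then show "emeasure L {..<0} = 0"
      unfolding L_def using absolutely_continuousI_density[OF wm] by (auto simp: absolutely_continuous_def)
    show "0 \<le> c" using wclass_c_nonneg[OF wc[of 0]] .
  qed
  have LB: "(LINT x|L. wt x * indicator B x) = F B" if B: "B \<in> sets borel" for B
  proof -
    have "ennreal (LINT x|L. wt x * indicator B x) = ennreal (F B)"
      using nnB[OF B] nn_integral_eq_integral[OF i[OF wcL B]] ind(1) by simp
    then show ?thesis using F0[OF B] ind(1) by (subst (asm) ennreal_inj) (auto intro!: integral_nonneg_AE)
  qed
  show thesis
  proof (rule that[OF wcL])
    fix n
    \<comment> \<open>The bounds \<open>close\<close> hold for every Borel set, in particular for
      the Hahn set, on which the excess is attained.\<close>
    obtain A where A: "hahn_set (M n) L A" using hahn_set_exists[OF wcL wc] .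
    have "excess wt (M n) L = (LINT x|M n. wt x * indicator A x) - (LINT x|L. wt x * indicator A x)"
      by (rule hahn_setD(4)[OF A, where C=1]) auto
    then show "excess wt (M n) L \<le> \<eta> n" using close(1)[OF hahn_setD(1)[OF A], of n] LB[OF hahn_setD(1)[OF A]] by (simp add: a_def)
    obtain A where A: "hahn_set L (M n) A" using hahn_set_exists[OF wc wcL] .
    have "excess wt L (M n) = (LINT x|L. wt x * indicator A x) - (LINT x|M n. wt x * indicator A x)"
      by (rule hahn_setD(4)[OF A, where C=1]) auto
    then show "excess wt L (M n) \<le> \<eta> n" using close(2)[OF hahn_setD(1)[OF A], of n] LB[OF hahn_setD(1)[OF A]] by (simp add: a_def)
  qed
qed

section \<open>Existence\<close>

lemma tests_bounded:
  assumes "tests f" obtains b where "0 \<le> b" "\<And>x. \<bar>f x\<bar> \<le> b"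
proof -
  obtain R where R: "\<And>x. \<bar>x\<bar> > R \<Longrightarrow> f x = 0" using assms by (auto simp: tests_def)
  have "\<bar>f x\<bar> \<le> 1 + \<bar>R\<bar>" for x
  proof (cases "\<bar>x\<bar> > R")
    case False
    have "\<bar>f x\<bar> \<le> wt x" using assms by (simp add: tests_def)
    then show ?thesis using False by (simp add: wt_def)
  qed (simp add: R)
  then show thesis by (intro that[of "1 + \<bar>R\<bar>"]) auto
qed

lemma LIMSEQ_abs_bound:
  fixes a :: "nat \<Rightarrow> real"
  assumes "\<And>n. \<bar>a n - l\<bar> \<le> b n" "b \<longlonglongrightarrow> 0"
  shows "a \<longlonglongrightarrow> l"
  by (rule LIM_zero_cancel, rule Lim_null_comparison[OF _ assms(2)]) (use assms(1) in simp)

lemma excess_tests_tendsto: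
  assumes wcn: "\<And>n. wclass c (M n)" and wc: "wclass c L" and \<eta>: "\<eta> \<longlonglongrightarrow> 0"
    and ex: "\<And>n. excess wt (M n) L \<le> \<eta> n" "\<And>n. excess wt L (M n) \<le> \<eta> n"
    and f: "f \<in> borel_measurable borel" "\<And>x. \<bar>f x\<bar> \<le> wt x"
  shows "(\<lambda>n. LINT x|M n. f x) \<longlonglongrightarrow> (LINT x|L. f x)"
proof (rule LIMSEQ_abs_bound)
  show "\<bar>(LINT x|M n. f x) - (LINT x|L. f x)\<bar> \<le> 4 * \<eta> n" for n
  proof -
    have "\<bar>(LINT x|M n. f x) - (LINT x|L. f x)\<bar> \<le> 2 * (excess wt (M n) L + excess wt L (M n))"
      by (rule integral_diff_le_excess[OF wc wcn f])
    then show ?thesis using ex[of n] by argo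
  qed
  show "(\<lambda>n. 4 * \<eta> n) \<longlonglongrightarrow> 0" using tendsto_mult_right_zero[OF \<eta>, of 4] .
qed

text \<open>Convergence is in weighted total variation at each time, with a rate uniform in time.
  The bound \<open>e n \<le> 1\<close> yields the common majorant \<open>Z\<close> for the
  velocities.\<close>

lemma approx_solution_limit:
  fixes \<nu> :: "nat \<Rightarrow> real \<Rightarrow> real measure"
  assumes sol: "\<And>n. approx_solution K c T (e n) (\<nu> n) (q n)" and K: "admissible K" and e: "e \<longlonglongrightarrow> 0" "\<And>n. e n \<le> 1"
    and wc: "\<And>t. t \<in> {0..T} \<Longrightarrow> wclass c (\<mu> t)" and \<eta>: "\<eta> \<longlonglongrightarrow> 0"
    and ex: "\<And>n t. t \<in> {0..T} \<Longrightarrow> excess wt (\<nu> n t) (\<mu> t) \<le> \<eta> n" "\<And>n t. t \<in> {0..T} \<Longrightarrow> excess wt (\<mu> t) (\<nu> n t) \<le> \<eta> n"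
  shows "approx_solution K c T 0 \<mu> (\<lambda>f s. Q_pair K (\<mu> s) f)"
proof -
  have wcn: "wclass c (\<nu> n t)" if "t \<in> {0..T}" for n t using approx_solution_wclass[OF sol that] .
  have main: "set_integrable lborel {0..t} (\<lambda>s. Q_pair K (\<mu> s) f) \<and>
      (LINT x|\<mu> t. f x) = (LINT x|\<mu> 0. f x) + (LINT s:{0..t}|lborel. Q_pair K (\<mu> s) f)"
    if f: "tests f" and t: "t \<in> {0..T}" for f t
  proof -
    have z: "0 \<in> {0..T}" using t by auto
    have fm: "f \<in> borel_measurable borel" and fw: "\<bar>f x\<bar> \<le> wt x" for x using f by (auto simp: tests_def)
    obtain b where b: "0 \<le> b" "\<And>x. \<bar>f x\<bar> \<le> b" using tests_bounded[OF f] by blast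
    have lim: "(\<lambda>n. LINT x|\<nu> n s. f x) \<longlonglongrightarrow> (LINT x|\<mu> s. f x)" if s: "s \<in> {0..T}" for s
      by (rule excess_tests_tendsto[OF wcn[OF s] wc[OF s] \<eta> ex(1)[OF s] ex(2)[OF s] fm fw])
    have qlim: "(\<lambda>n. q n f s) \<longlonglongrightarrow> Q_pair K (\<mu> s) f" if s: "s \<in> {0..T}" for s
    proof (rule LIMSEQ_abs_bound)
      show "\<bar>q n f s - Q_pair K (\<mu> s) f\<bar> \<le> e n + 12 * b * c\<^sup>2 * \<eta> n" for n
      proof -
        have "\<bar>Q_pair K (\<nu> n s) f - Q_pair K (\<mu> s) f\<bar> \<le> 6 * b * c\<^sup>2 * (excess wt (\<nu> n s) (\<mu> s) + excess wt (\<mu> s) (\<nu> n s))"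
          by (rule Q_pair_diff_le_excess[OF wc[OF s] wcn[OF s] K fm b(2)])
        also have "\<dots> \<le> 6 * b * c\<^sup>2 * (\<eta> n + \<eta> n)"
          using ex[OF s, of n] b(1) by (intro mult_left_mono add_mono) auto
        also have "\<dots> = 12 * b * c\<^sup>2 * \<eta> n" by simp
        finally show ?thesis using approx_solution_close[OF sol f s, of n] by linarith
      qed
      have "(\<lambda>n. e n + 12 * b * c\<^sup>2 * \<eta> n) \<longlonglongrightarrow> 0 + 12 * b * c\<^sup>2 * 0"
        by (intro tendsto_intros e(1) \<eta>)
      then show "(\<lambda>n. e n + 12 * b * c\<^sup>2 * \<eta> n) \<longlonglongrightarrow> 0" by simp
    qed
    define Z where "Z = 1 + 4 * b / 2 * c ^ 3"
    have qb: "\<bar>q n f s\<bar> \<le> Z" if s: "s \<in> {0..T}" for n s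
    proof -
      have "\<bar>Q_pair K (\<nu> n s) f\<bar> \<le> 4 * b / 2 * c ^ 3"
        by (rule Q_pair_bound[OF wcn[OF s] K fm restr_gain_loss_bounded[OF K b(2)]])
      then show ?thesis using approx_solution_close[OF sol f s, of n] e(2)[of n] unfolding Z_def by linarith
    qed
    let ?g = "\<lambda>s. indicator {0..t} s *\<^sub>R Q_pair K (\<mu> s) f" and ?s = "\<lambda>n s. indicator {0..t} s *\<^sub>R q n f s"
    have sm: "?s n \<in> borel_measurable lborel" for n
    proof -
      have "set_integrable lborel {0..t} (q n f)"
        using t by (intro set_integrable_subset[OF approx_solution_integrable[OF sol f]]) auto
      then show ?thesis unfolding set_integrable_def by (rule borel_measurable_integrable)
    qed
    have pl: "(\<lambda>n. ?s n s) \<longlonglongrightarrow> ?g s" for s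
      using qlim[of s] t by (cases "s \<in> {0..t}") auto
    \<comment> \<open>The limit family comes without any regularity in time; the measurability of
      its collision term is inherited from the approximations.\<close>
    have gm: "?g \<in> borel_measurable lborel" by (rule borel_measurable_LIMSEQ_real[OF pl sm])
    have wi: "integrable lborel (\<lambda>s. indicator {0..t} s *\<^sub>R Z)"
      using set_integrable_const_Icc[of 0 t Z] by (simp add: set_integrable_def)
    have bd: "AE s in lborel. norm (?s n s) \<le> indicator {0..t} s *\<^sub>R Z" for n
      using qb[of _ n] t by (intro AE_I2) (auto simp: indicator_def)
    have ae: "AE s in lborel. (\<lambda>n. ?s n s) \<longlonglongrightarrow> ?g s" using pl by simp
    have gi: "integrable lborel ?g"
      by (rule integrable_dominated_convergence[OF gm sm wi ae bd])
    have "(\<lambda>n. LINT s:{0..t}|lborel. q n f s) \<longlonglongrightarrow> (LINT s:{0..t}|lborel. Q_pair K (\<mu> s) f)"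
      unfolding set_lebesgue_integral_def by (rule integral_dominated_convergence[OF gm sm wi ae bd])
    then have "(\<lambda>n. (LINT x|\<nu> n 0. f x) + (LINT s:{0..t}|lborel. q n f s)) \<longlonglongrightarrow> (LINT x|\<mu> 0. f x) + (LINT s:{0..t}|lborel. Q_pair K (\<mu> s) f)"
      by (rule tendsto_add[OF lim[OF z]])
    moreover have "(LINT x|\<nu> n t. f x) = (LINT x|\<nu> n 0. f x) + (LINT s:{0..t}|lborel. q n f s)" for n
      using sol[of n] f t unfolding approx_solution_def by blast
    ultimately have "(\<lambda>n. LINT x|\<nu> n t. f x) \<longlonglongrightarrow> (LINT x|\<mu> 0. f x) + (LINT s:{0..t}|lborel. Q_pair K (\<mu> s) f)"
      by (simp only:)
    from LIMSEQ_unique[OF lim[OF t] this] gi show ?thesis by (simp add: set_integrable_def)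
  qed
  show ?thesis
    unfolding approx_solution_def
  proof (intro conjI ballI allI impI)
    fix t assume t: "t \<in> {0..T}"
    show "wclass c (\<mu> t)" by (rule wc[OF t])
    fix f assume f: "tests f"
    show "\<bar>Q_pair K (\<mu> t) f - Q_pair K (\<mu> t) f\<bar> \<le> 0" by simp
    show "(LINT x|\<mu> t. f x) = (LINT x|\<mu> 0. f x) + (LINT s:{0..t}|lborel. Q_pair K (\<mu> s) f)"
      using main[OF f t] by blast
  next
    fix f assume f: "tests f"
    show "set_integrable lborel {0..T} (\<lambda>s. Q_pair K (\<mu> s) f)"
    proof (cases "0 \<le> T")
      case True
      then have "T \<in> {0..T}" by simp
      from main[OF f this] show ?thesis by blast
    qed (simp add: set_integrable_def)
  qed
qed

text \<open>\<open>c\<close> is exactly the weight of \<open>\<mu>0\<close>, so membership in the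
  class is already the inequality \<open>moment phi (\<mu> t) \<le> moment phi \<mu>0\<close>.
  Arbitrary test functions are reached by scaling the normalised ones.\<close>

lemma approx_solution_strong:
  assumes sol: "approx_solution K c T 0 \<mu> (\<lambda>f s. Q_pair K (\<mu> s) f)" and K: "admissible K" and T: "0 < T"
    and m0: "wclass c \<mu>0" and c: "(LINT x|\<mu>0. wt x) = c"
    and init: "\<And>f. tests f \<Longrightarrow> (LINT x|\<mu> 0. f x) = (LINT x|\<mu>0. f x)"
    and mom: "\<And>t. t \<in> {0..T} \<Longrightarrow> (LINT x|\<mu> t. \<bar>x\<bar>) \<le> (LINT x|\<mu>0. \<bar>x\<bar>)"
    and sq: "\<And>t. t \<in> {0..T} \<Longrightarrow> sq_moment (\<mu> t) \<le> ennreal P"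
  shows "strong_solution K \<mu>0 (ennreal T) \<mu>"
proof -
  have tT: "t \<in> {0..T}" if "t \<in> times (ennreal T)" for t
    using that T by (auto simp: times_def ennreal_less_iff)
  have wc: "wclass c (\<mu> t)" if "t \<in> {0..T}" for t using approx_solution_wclass[OF sol that] .
  have eq: "set_integrable lborel {0..t} (\<lambda>s. Q_pair K (\<mu> s) f) \<and>
        (LINT x | \<mu> t. f x) = (LINT x | \<mu>0. f x) + (LINT s : {0..t} | lborel. Q_pair K (\<mu> s) f)"
    if f: "test_function f" and t: "t \<in> {0..T}" for f t
  proof -
    obtain C where C: "\<And>x. \<bar>f x\<bar> \<le> C" using f by (auto simp: test_function_def)
    define b where "b = 1 + \<bar>C\<bar>"
    have b: "0 < b" "\<bar>f x\<bar> \<le> b" for x using C[of x] unfolding b_def by linarith+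
    define g where "g x = f x / b" for x
    have "f x = b * g x" for x using b(1) by (simp add: g_def)
    then have fg: "f = (\<lambda>x. b * g x)" by (rule ext)
    have gw: "\<bar>g x\<bar> \<le> wt x" for x
    proof -
      have "\<bar>g x\<bar> \<le> 1" using b by (simp add: g_def abs_divide pos_divide_le_eq)
      then show ?thesis using wt_ge_1[of x] by linarith
    qed
    have g: "tests g"
      unfolding tests_def
    proof (intro conjI allI)
      have [measurable]: "f \<in> borel_measurable borel" using f by (simp add: test_function_def)
      show "g \<in> borel_measurable borel" unfolding g_def by measurable
      obtain R where "\<And>x. \<bar>x\<bar> > R \<Longrightarrow> f x = 0" using f by (auto simp: test_function_def)
      then show "\<exists>R. \<forall>x. \<bar>x\<bar> > R \<longrightarrow> g x = 0" by (auto simp: g_def)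
    qed (rule gw)
    have i: "set_integrable lborel {0..t} (\<lambda>s. Q_pair K (\<mu> s) g)"
      using t by (intro set_integrable_subset[OF approx_solution_integrable[OF sol g]]) auto
    have e: "(LINT x|\<mu> t. g x) = (LINT x|\<mu>0. g x) + (LINT s:{0..t}|lborel. Q_pair K (\<mu> s) g)"
      unfolding init[OF g, symmetric] using sol g t unfolding approx_solution_def by blast
    have "(LINT x|\<mu> t. f x) = b * (LINT x|\<mu> t. g x)" "(LINT x|\<mu>0. f x) = b * (LINT x|\<mu>0. g x)"
      unfolding fg by simp_all
    moreover have "Q_pair K (\<mu> s) f = b * Q_pair K (\<mu> s) g" for s unfolding fg by (rule Q_pair_scale)
    ultimately show ?thesis using i e by (simp add: algebra_simps)
  qed
  have mphi: "moment phi (\<mu> t) \<le> moment phi \<mu>0" if t: "t \<in> {0..T}" for t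
    unfolding moment_phi[OF wc[OF t]] moment_phi[OF m0] c using wclass_integral_wt[OF wc[OF t]] by (rule ennreal_leI)
  have mid: "moment (\<lambda>x. x) (\<mu> t) \<le> moment (\<lambda>x. x) \<mu>0" if t: "t \<in> {0..T}" for t
    unfolding moment_id[OF wc[OF t]] moment_id[OF m0] using mom[OF t] by (rule ennreal_leI)
  have msq: "(\<integral>\<^sup>+ s\<in>{0..t}. moment (\<lambda>x. (phi x)\<^sup>2) (\<mu> s) \<partial>lborel) < \<infinity>" if t: "t \<in> {0..T}" for t
  proof -
    have "(\<integral>\<^sup>+ s\<in>{0..t}. moment (\<lambda>x. (phi x)\<^sup>2) (\<mu> s) \<partial>lborel) \<le> (\<integral>\<^sup>+ s. ennreal P * indicator {0..t} s \<partial>lborel)"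
    proof (rule nn_integral_mono)
      fix s
      show "moment (\<lambda>x. (phi x)\<^sup>2) (\<mu> s) * indicator {0..t} s \<le> ennreal P * indicator {0..t} s"
      proof (cases "s \<in> {0..t}")
        case True
        then have s: "s \<in> {0..T}" using t by auto
        show ?thesis using True sq[OF s] moment_phi_sq[of "\<mu> s"] wc[OF s] by (simp add: wclass_def)
      qed simp
    qed
    also have "\<dots> = ennreal P * ennreal t" using t by (simp add: nn_integral_cmult_indicator)
    also have "\<dots> < \<infinity>" by (simp add: ennreal_mult_less_top)
    finally show ?thesis .
  qed
  have Rp: "measure_on_Rplus (\<mu> t)" if "t \<in> {0..T}" for t using wc[OF that] by (simp add: wclass_def)
  show ?thesis
    unfolding strong_solution_def local_solution_def satisfies_kinetic_eq_def
  proof (intro conjI ballI allI impI)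
    show "0 < ennreal T" using T by simp
    fix t assume "t \<in> times (ennreal T)"
    note t = tT[OF this]
    show "measure_on_Rplus (\<mu> t)" by (rule Rp[OF t])
    show "moment (\<lambda>x. x) (\<mu> t) \<le> moment (\<lambda>x. x) \<mu>0" by (rule mid[OF t])
    show "moment phi (\<mu> t) \<le> moment phi \<mu>0" by (rule mphi[OF t])
    show "(\<integral>\<^sup>+ s\<in>{0..t}. moment (\<lambda>x. (phi x)\<^sup>2) (\<mu> s) \<partial>lborel) < \<infinity>" by (rule msq[OF t])
    fix f assume f: "test_function f"
    show "set_integrable lborel {0..t} (\<lambda>s. Q_pair K (\<mu> s) f)"
      "(LINT x | \<mu> t. f x) = (LINT x | \<mu>0. f x) + (LINT s : {0..t} | lborel. Q_pair K (\<mu> s) f)"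
      using eq[OF f t] by blast+
  qed
qed

section \<open>Cut-off initial measures and local existence\<close>

definition cut :: "real \<Rightarrow> real measure \<Rightarrow> real measure" where
  "cut n \<mu> = density \<mu> (\<lambda>x. ennreal (indicator {x. \<bar>x\<bar> \<le> n} x))"

lemma cut_integral:
  fixes f :: "real \<Rightarrow> real"
  assumes mu: "wclass c \<mu>" and f: "f \<in> borel_measurable borel"
  shows "(LINT x|cut n \<mu>. f x) = (LINT x|\<mu>. f x * indicator {x. \<bar>x\<bar> \<le> n} x)"
proof -
  note eq = measurable_cong_sets[OF wclass_sets[OF mu] refl]
  have "f \<in> borel_measurable \<mu>" "(\<lambda>x. indicator {x. \<bar>x\<bar> \<le> n} x :: real) \<in> borel_measurable \<mu>"
    unfolding eq by (rule f) measurable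
  from integral_density[OF this] show ?thesis by (simp add: cut_def mult.commute)
qed

lemma cut_sclass:
  assumes mu: "wclass c \<mu>" shows "sclass n c (cut n \<mu>)"
proof -
  note eq = measurable_cong_sets[OF wclass_sets[OF mu] refl]
  have im: "(\<lambda>x. ennreal (indicator {x. \<bar>x\<bar> \<le> n} x)) \<in> borel_measurable \<mu>" unfolding eq by measurable
  have "(\<integral>\<^sup>+x. ennreal (wt x) \<partial>cut n \<mu>) = (\<integral>\<^sup>+x. ennreal (indicator {x. \<bar>x\<bar> \<le> n} x) * ennreal (wt x) \<partial>\<mu>)"
    unfolding cut_def by (rule nn_integral_density[OF im]) (simp add: eq)
  also have "\<dots> \<le> (\<integral>\<^sup>+x. ennreal (wt x) \<partial>\<mu>)"
    by (intro nn_integral_mono) (auto simp: indicator_def)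
  also have "\<dots> \<le> ennreal c" using mu by (simp add: wclass_def)
  finally have w: "(\<integral>\<^sup>+x. ennreal (wt x) \<partial>cut n \<mu>) \<le> ennreal c" .
  have "{..<0} \<in> null_sets \<mu>" using mu by (simp add: null_sets_def wclass_def measure_on_Rplus_def)
  then have z: "emeasure (cut n \<mu>) {..<0} = 0"
    unfolding cut_def using absolutely_continuousI_density[OF im] by (auto simp: absolutely_continuous_def)
  have "AE x in cut n \<mu>. \<bar>x\<bar> \<le> n"
    unfolding cut_def by (subst AE_density[OF im]) (auto simp: indicator_def)
  moreover have "sets (cut n \<mu>) = sets borel" using wclass_sets[OF mu] by (simp add: cut_def)
  ultimately show ?thesis
    using w z wclass_c_nonneg[OF mu] by (simp add: sclass_def wclass_def measure_on_Rplus_def)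
qed

text \<open>If \<open>k\<close> and \<open>c\<close> are positive, \<open>M = k\<close> works, and
  the claim is \<open>T < zeta \<mu>0\<close> with the inverses cleared. For \<open>k = 0\<close> a
  positive value is still required, and \<open>1 / (c * T + 1)\<close> keeps
  \<open>c * M * T\<close> below \<open>1\<close>.\<close>

lemma lifetime_parameter:
  assumes c: "moment phi \<mu>0 = ennreal c" "0 \<le> c" and k: "moment (\<lambda>x. (phi x)\<^sup>2) \<mu>0 = ennreal k" "0 \<le> k"
    and T: "0 < T" "ennreal T < zeta \<mu>0"
  obtains M where "0 < M" "k \<le> M" "c * M * T < 1"
proof (cases "k = 0 \<or> c = 0")
  case True
  show thesis
  proof (cases "k = 0")
    case True
    have "0 < c * T + 1" using c T by (simp add: add_nonneg_pos)
    then show thesis using True by (intro that[of "1 / (c * T + 1)"]) (auto simp: pos_divide_less_eq)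
  next
    case False
    then show thesis using \<open>k = 0 \<or> c = 0\<close> k by (intro that[of k]) auto
  qed
next
  case False
  then have pos: "0 < k" "0 < c" using c k by auto
  have "zeta \<mu>0 = ennreal (inverse k * inverse c)"
    using pos by (simp add: zeta_def c(1) k(1) inverse_ennreal ennreal_mult)
  then have "T < inverse k * inverse c" using T by (simp add: ennreal_less_iff)
  then have "T * (k * c) < inverse k * inverse c * (k * c)" using pos by (intro mult_strict_right_mono) auto
  also have "\<dots> = 1" using pos by (simp add: field_simps)
  finally have "c * k * T < 1" by (simp add: mult_ac)
  then show thesis using pos by (intro that[of k]) auto
qed

lemma local_existence:
  assumes K: "admissible K" and m0: "measure_on_Rplus \<mu>0" "moment phi \<mu>0 < \<infinity>"
    and sq: "moment (\<lambda>x. (phi x)\<^sup>2) \<mu>0 < \<infinity>" and T: "0 < T" "ennreal T < zeta \<mu>0"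
  shows "\<exists>\<mu>. strong_solution K \<mu>0 (ennreal T) \<mu>"
proof -
  obtain c where c: "moment phi \<mu>0 = ennreal c" "0 \<le> c" using ennreal_moment_finite[OF m0(2)] .
  have wc0: "wclass c \<mu>0" by (rule wclassI[OF m0(1) eq_refl[OF c(1)] c(2)])
  have w0: "integrable \<mu>0 wt" by (rule wclass_integrable_wt[OF wc0])
  have mc: "(LINT x|\<mu>0. wt x) = c"
    using moment_phi[OF wc0] c by (metis ennreal_inj integral_nonneg_AE AE_I2 wt_nonneg)
  have sq0: "sq_moment \<mu>0 < \<infinity>" using sq by (simp add: moment_phi_sq[OF m0(1)])
  note i2 = sq_moment_finiteD(1)[OF wc0 sq0]
  define k where "k = (LINT x|\<mu>0. (wt x)\<^sup>2)"
  have k0: "0 \<le> k" unfolding k_def by (intro integral_nonneg_AE) auto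
  have kk: "moment (\<lambda>x. (phi x)\<^sup>2) \<mu>0 = ennreal k"
    unfolding moment_phi_sq[OF m0(1)] sq_moment_def k_def by (rule nn_integral_eq_integral[OF i2]) simp
  obtain M where M: "0 < M" "k \<le> M" "c * M * T < 1" using lifetime_parameter[OF c kk k0 T] .
  define P where "P = M / (1 - c * M * T)"
  have P0: "0 \<le> P" using M by (simp add: P_def)
  define \<rho> where "\<rho> n = cut (real n) \<mu>0" for n :: nat
  define e where "e n = inverse (real (Suc n))" for n
  have e0: "0 < e n" "e n \<le> 1" for n by (simp_all add: e_def inverse_le_1_iff)
  have elim: "e \<longlonglongrightarrow> 0" unfolding e_def[abs_def] by (rule LIMSEQ_inverse_real_of_nat)
  have T0: "0 \<le> T" using T by simp
  have \<rho>sc: "sclass (real n) c (\<rho> n)" for n unfolding \<rho>_def by (rule cut_sclass[OF wc0])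
  have \<rho>i: "(LINT x|\<rho> n. f x) = (LINT x|\<mu>0. f x * indicator {x. \<bar>x\<bar> \<le> real n} x)" if "f \<in> borel_measurable borel" for f :: "real \<Rightarrow> real" and n
    unfolding \<rho>_def by (rule cut_integral[OF wc0 that])
  have \<rho>le: "(LINT x|\<rho> n. f x) \<le> (LINT x|\<mu>0. f x)" if f: "f \<in> borel_measurable borel" "integrable \<mu>0 f" "\<And>x. 0 \<le> f x" for f :: "real \<Rightarrow> real" and n
    unfolding \<rho>i[OF f(1)]
  proof (rule integral_mono[OF _ f(2)])
    show "integrable \<mu>0 (\<lambda>x. f x * indicator {x. \<bar>x\<bar> \<le> real n} x)"
    proof (rule Bochner_Integration.integrable_bound[OF f(2)])
      show "(\<lambda>x. f x * indicator {x. \<bar>x\<bar> \<le> real n} x) \<in> borel_measurable \<mu>0"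
        unfolding measurable_cong_sets[OF wclass_sets[OF wc0] refl] using f(1) by measurable
      show "AE x in \<mu>0. norm (f x * indicator {x. \<bar>x\<bar> \<le> real n} x) \<le> norm (f x)"
        by (intro AE_I2) (simp add: indicator_def)
    qed
  qed (use f(3) in \<open>simp add: indicator_def\<close>)
  have m2: "(LINT x|\<rho> n. (wt x)\<^sup>2) \<le> M" for n
    using \<rho>le[of "\<lambda>x. (wt x)\<^sup>2" n] i2 M(2) unfolding k_def by fastforce
  have "\<exists>\<nu> q. approx_solution K c T (e n) \<nu> q \<and>
    (\<forall>t\<in>{0..T}. (LINT x|\<nu> t. wt x) = (LINT x|\<rho> n. wt x) \<and> (LINT x|\<nu> t. \<bar>x\<bar>) = (LINT x|\<rho> n. \<bar>x\<bar>) \<and> sq_moment (\<nu> t) \<le> ennreal P) \<and>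
    (\<forall>f. f \<in> borel_measurable borel \<longrightarrow> (\<forall>x. \<bar>f x\<bar> \<le> wt x) \<longrightarrow> (LINT x|\<nu> 0. f x) = (LINT x|\<rho> n. f x))" for n
    by (rule euler_polygon_exists[OF \<rho>sc[of n] K T0 M(1,3) m2[of n] e0(1)[of n]], unfold P_def, blast)
  then obtain \<nu> q where sol: "\<And>n. approx_solution K c T (e n) (\<nu> n) (q n)"
    and nw: "\<And>n t. t \<in> {0..T} \<Longrightarrow> (LINT x|\<nu> n t. wt x) = (LINT x|\<rho> n. wt x)"
    and nx: "\<And>n t. t \<in> {0..T} \<Longrightarrow> (LINT x|\<nu> n t. \<bar>x\<bar>) = (LINT x|\<rho> n. \<bar>x\<bar>)"
    and nsq: "\<And>n t. t \<in> {0..T} \<Longrightarrow> sq_moment (\<nu> n t) \<le> ennreal P"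
    and n0: "\<And>n f. \<lbrakk>f \<in> borel_measurable borel; \<And>x. \<bar>f x\<bar> \<le> wt x\<rbrakk> \<Longrightarrow> (LINT x|\<nu> n 0. f x) = (LINT x|\<rho> n. f x)"
    by metis
  have wcn: "wclass c (\<nu> n t)" if "t \<in> {0..T}" for n t using approx_solution_wclass[OF sol that] .
  \<comment> \<open>The weight lost by cutting at radius \<open>n\<close>. It bounds the initial
    excess as well as the mass defect of the approximations.\<close>
  define \<delta> where "\<delta> n = c - (LINT x|\<rho> n. wt x)" for n
  have \<delta>0: "0 \<le> \<delta> n" for n using \<rho>le[OF wt_measurable w0, of n] mc by (simp add: \<delta>_def)
  have \<delta>lim: "\<delta> \<longlonglongrightarrow> 0"
  proof -
    have "(\<lambda>n. c - (LINT x|\<mu>0. wt x * indicator {x. \<bar>x\<bar> \<le> real n} x)) \<longlonglongrightarrow> c - (LINT x|\<mu>0. wt x)"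
      by (intro tendsto_diff tendsto_const integral_cutoff_tendsto[OF wclass_sets[OF wc0] w0])
    then show ?thesis unfolding \<delta>_def[abs_def] \<rho>i[OF wt_measurable] mc by simp
  qed
  have ex0: "excess wt (\<nu> n 0) (\<nu> m 0) \<le> \<delta> m" for n m
  proof (rule excess_least)
    fix f assume f: "f \<in> borel_measurable borel" "\<And>x. 0 \<le> f x" "\<And>x. f x \<le> wt x"
    have fa: "\<bar>f x\<bar> \<le> wt x" for x using f by simp
    have i: "integrable \<mu>0 f" by (rule wclass_integrable[OF wc0 f(1), of 1]) (use fa in simp)
    have wf: "(\<lambda>x. wt x - f x) \<in> borel_measurable borel" using f(1) by measurable
    have 1: "(LINT x|\<rho> n. f x) \<le> (LINT x|\<mu>0. f x)" by (rule \<rho>le[OF f(1) i f(2)])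
    \<comment> \<open>Testing with \<open>wt - f\<close> turns the monotonicity of the cut into a
      lower bound: cutting costs the integral of \<open>f\<close> at most
      \<open>\<delta> m\<close>.\<close>
    have 2: "(LINT x|\<rho> m. wt x - f x) \<le> (LINT x|\<mu>0. wt x - f x)"
      by (rule \<rho>le[OF wf]) (use w0 i f in auto)
    have wcr: "wclass c (\<rho> m)" using \<rho>sc[of m] by (simp add: sclass_def)
    have "integrable (\<rho> m) f" by (rule wclass_integrable[OF wcr f(1), of 1]) (use fa in simp)
    then have "(LINT x|\<mu>0. f x) - (LINT x|\<rho> m. f x) \<le> \<delta> m"
      using 2 w0 i mc wclass_integrable_wt[OF wcr] by (simp add: \<delta>_def)
    then show "(LINT x|\<nu> n 0. f x) - (LINT x|\<nu> m 0. f x) \<le> \<delta> m"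
      unfolding n0[OF f(1) fa] using 1 by linarith
  qed simp
  obtain j where j: "24 * c * (P * T) \<le> real j" using real_arch_simple by blast
  \<comment> \<open>\<open>stability\<close> produces mixed terms in \<open>n\<close> and
    \<open>m\<close>; all are nonnegative, so the missing ones are added to reach the form
    \<open>\<eta> n + \<eta> m\<close>. The exponent \<open>j\<close> is independent of
    \<open>n\<close> because \<open>P * T\<close> bounds the time integral of every second
    moment.\<close>
  define \<eta> where "\<eta> n = (\<delta> n + e n * T + 6 * c * \<delta> n * (P * T)) * 2 ^ j" for n
  have \<eta>lim: "\<eta> \<longlonglongrightarrow> 0"
  proof -
    have "\<eta> \<longlonglongrightarrow> (0 + 0 * T + 6 * c * 0 * (P * T)) * 2 ^ j"
      unfolding \<eta>_def[abs_def] by (intro tendsto_intros \<delta>lim elim)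
    then show ?thesis by simp
  qed
  have cau: "excess wt (\<nu> n t) (\<nu> m t) \<le> \<eta> n + \<eta> m" if t: "t \<in> {0..T}" for n m t
  proof -
    have E: "(\<integral>\<^sup>+s. sq_moment (\<nu> n s) * indicator {0..T} s \<partial>lborel) \<le> ennreal (P * T)"
    proof -
      have "(\<integral>\<^sup>+s. sq_moment (\<nu> n s) * indicator {0..T} s \<partial>lborel) \<le> (\<integral>\<^sup>+s. ennreal P * indicator {0..T} s \<partial>lborel)"
        using nsq by (intro nn_integral_mono) (auto simp: indicator_def)
      also have "\<dots> = ennreal (P * T)" using T0 P0 by (simp add: nn_integral_cmult_indicator ennreal_mult)
      finally show ?thesis .
    qed
    have mass: "(LINT x|\<nu> m s. wt x) \<le> (LINT x|\<nu> n s. wt x) + \<delta> n" if s: "s \<in> {0..T}" for s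
      unfolding nw[OF s] \<delta>_def using \<rho>le[OF wt_measurable w0, of m] mc by simp
    have "excess wt (\<nu> n t) (\<nu> m t) \<le> (excess wt (\<nu> n 0) (\<nu> m 0) + (e n + e m) * T + 6 * c * \<delta> n * (P * T)) * 2 ^ j"
      by (rule stability[OF sol sol K mass \<delta>0 E _ j t]) (use P0 T0 in auto)
    also have "\<dots> \<le> (\<delta> m + (e n + e m) * T + 6 * c * \<delta> n * (P * T)) * 2 ^ j"
      using ex0[of n m] by (intro mult_right_mono add_right_mono) auto
    also have "\<dots> \<le> ((\<delta> n + \<delta> m) + (e n + e m) * T + (6 * c * \<delta> n * (P * T) + 6 * c * \<delta> m * (P * T))) * 2 ^ j"
      using \<delta>0[of n] \<delta>0[of m] c(2) P0 T0 by (intro mult_right_mono add_mono) auto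
    also have "\<dots> = \<eta> n + \<eta> m" by (simp add: \<eta>_def algebra_simps)
    finally show ?thesis .
  qed
  have "\<exists>L. wclass c L \<and> (\<forall>n. excess wt (\<nu> n t) L \<le> \<eta> n) \<and> (\<forall>n. excess wt L (\<nu> n t) \<le> \<eta> n)" if t: "t \<in> {0..T}" for t
    by (rule excess_limit[of c "\<lambda>n. \<nu> n t" \<eta>, OF wcn[OF t] cau[OF t] \<eta>lim]) blast
  then obtain \<mu> where wc: "\<And>t. t \<in> {0..T} \<Longrightarrow> wclass c (\<mu> t)"
    and ex: "\<And>n t. t \<in> {0..T} \<Longrightarrow> excess wt (\<nu> n t) (\<mu> t) \<le> \<eta> n" "\<And>n t. t \<in> {0..T} \<Longrightarrow> excess wt (\<mu> t) (\<nu> n t) \<le> \<eta> n"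
    by metis
  have lim: "(\<lambda>n. LINT x|\<nu> n t. f x) \<longlonglongrightarrow> (LINT x|\<mu> t. f x)"
    if t: "t \<in> {0..T}" and f: "f \<in> borel_measurable borel" "\<And>x. \<bar>f x\<bar> \<le> wt x" for f t
    by (rule excess_tests_tendsto[OF wcn[OF t] wc[OF t] \<eta>lim ex(1)[OF t] ex(2)[OF t] f])
  have z: "0 \<in> {0..T}" using T0 by simp
  have "strong_solution K \<mu>0 (ennreal T) \<mu>"
  proof (rule approx_solution_strong[OF approx_solution_limit[OF sol K elim e0(2) wc \<eta>lim ex] K T(1) wc0 mc])
    fix f assume "tests f"
    then have f: "f \<in> borel_measurable borel" "\<bar>f x\<bar> \<le> wt x" for x by (auto simp: tests_def)
    have i: "integrable \<mu>0 f" by (rule wclass_integrable[OF wc0 f(1), of 1]) (use f(2) in simp)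
    have "(\<lambda>n. LINT x|\<nu> n 0. f x) \<longlonglongrightarrow> (LINT x|\<mu>0. f x)"
      unfolding n0[OF f] \<rho>i[OF f(1)] by (rule integral_cutoff_tendsto[OF wclass_sets[OF wc0] i])
    with lim[OF z f] show "(LINT x|\<mu> 0. f x) = (LINT x|\<mu>0. f x)" by (rule LIMSEQ_unique)
  next
    fix t assume t: "t \<in> {0..T}"
    have fx: "(\<lambda>x::real. \<bar>x\<bar>) \<in> borel_measurable borel" "\<bar>\<bar>x\<bar>\<bar> \<le> wt x" for x by (auto simp: wt_def)
    have ix: "integrable \<mu>0 (\<lambda>x. \<bar>x\<bar>)" by (rule wclass_integrable[OF wc0 fx(1), of 1]) (use fx(2) in simp)
    show "(LINT x|\<mu> t. \<bar>x\<bar>) \<le> (LINT x|\<mu>0. \<bar>x\<bar>)"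
      by (rule LIMSEQ_le_const2[OF lim[OF t fx]]) (use nx[OF t] \<rho>le[OF fx(1) ix] in auto)
    \<comment> \<open>Lower semicontinuity: cut-off second moments pass to the limit as test
      integrals, and the bound \<open>P\<close> survives the supremum over the radii. Division by
      \<open>1 + real R\<close> brings the integrand below \<open>wt\<close>.\<close>
    show "sq_moment (\<mu> t) \<le> ennreal P"
      unfolding sq_moment_eq_SUP[OF wc[OF t]]
    proof (rule SUP_least, rule ennreal_leI)
      fix R :: nat
      define g where "g x = wt x * wtR (real R) x / (1 + real R)" for x
      have gm: "g \<in> borel_measurable borel" unfolding g_def by measurable
      have gb: "\<bar>g x\<bar> \<le> wt x" for x
      proof -
        have "wt x * wtR (real R) x \<le> (1 + real R) * wtR (real R) x" using sq_cutoff(3)[of x "real R"] by simp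
        also have "\<dots> \<le> (1 + real R) * wt x" by (intro mult_left_mono wtR_bounds(2)) auto
        finally have "g x \<le> wt x" by (simp add: g_def pos_divide_le_eq mult.commute)
        moreover have "0 \<le> g x" unfolding g_def using wtR_bounds(1)[of "real R" x] by simp
        ultimately show ?thesis by simp
      qed
      have s: "(LINT x|\<kappa>. wt x * wtR (real R) x) = (1 + real R) * (LINT x|\<kappa>. g x)" for \<kappa>
        unfolding g_def by simp
      have l: "(\<lambda>n. LINT x|\<nu> n t. wt x * wtR (real R) x) \<longlonglongrightarrow> (LINT x|\<mu> t. wt x * wtR (real R) x)"
        unfolding s by (intro tendsto_mult_left lim[OF t gm gb])
      have "(LINT x|\<nu> n t. wt x * wtR (real R) x) \<le> P" for n
      proof -
        have "ennreal (LINT x|\<nu> n t. wt x * wtR (real R) x) \<le> sq_moment (\<nu> n t)"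
          unfolding sq_moment_eq_SUP[OF wcn[OF t]] by (rule SUP_upper) simp
        also have "\<dots> \<le> ennreal P" by (rule nsq[OF t])
        finally show ?thesis using P0 by simp
      qed
      then show "(LINT x|\<mu> t. wt x * wtR (real R) x) \<le> P"
        by (intro LIMSEQ_le_const2[OF l]) auto
    qed
  qed
  then show ?thesis by blast
qed

theorem theorem1p6:
  fixes K :: "real \<Rightarrow> real \<Rightarrow> real \<Rightarrow> real" and lam :: real and \<mu>0 :: "real measure"
  assumes "measure_on_Rplus \<mu>0"
    and "model_kernel lam K"
    and "sub_multiplicative K"
    and "moment phi \<mu>0 < \<infinity>"
  shows
    "(\<forall>T \<mu> \<nu>. local_solution K \<mu>0 T \<mu> \<and> strong_solution K \<mu>0 T \<nu> \<longrightarrow> agree_on T \<mu> \<nu>) \<and>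
     (\<forall>T \<mu>. strong_solution K \<mu>0 T \<mu> \<longrightarrow> conservative T \<mu>) \<and>
     (moment (\<lambda>x. (phi x)\<^sup>2) \<mu>0 < \<infinity> \<longrightarrow>
       (\<exists>\<mu>. strong_solution K \<mu>0 (zeta \<mu>0) \<mu> \<and>
            (\<forall>T \<nu>. strong_solution K \<mu>0 T \<nu> \<and> T \<le> zeta \<mu>0 \<longrightarrow> agree_on T \<nu> \<mu>) \<and>
            (\<exists>T. zeta \<mu>0 \<le> T \<and> maximal_strong_solution K \<mu>0 T \<mu> \<and>
                 (\<forall>T' \<nu>. maximal_strong_solution K \<mu>0 T' \<nu> \<longrightarrow> T' = T \<and> agree_on T \<nu> \<mu>))))"
proof (intro conjI allI impI)
  have K: "admissible K" by (rule admissible_model_kernel[OF assms(2,3)])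
  show "agree_on T \<mu> \<nu>" if "local_solution K \<mu>0 T \<mu> \<and> strong_solution K \<mu>0 T \<nu>" for T \<mu> \<nu>
    unfolding agree_on_def using uniqueness[OF K assms(1,4)] that by blast
  show "conservative T \<mu>" if "strong_solution K \<mu>0 T \<mu>" for T \<mu>
    by (rule strong_solution_conservative[OF K assms(1,4) that])
  assume sq: "moment (\<lambda>x. (phi x)\<^sup>2) \<mu>0 < \<infinity>"
  show "\<exists>\<mu>. strong_solution K \<mu>0 (zeta \<mu>0) \<mu> \<and>
            (\<forall>T \<nu>. strong_solution K \<mu>0 T \<nu> \<and> T \<le> zeta \<mu>0 \<longrightarrow> agree_on T \<nu> \<mu>) \<and>
            (\<exists>T. zeta \<mu>0 \<le> T \<and> maximal_strong_solution K \<mu>0 T \<mu> \<and>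
                 (\<forall>T' \<nu>. maximal_strong_solution K \<mu>0 T' \<nu> \<longrightarrow> T' = T \<and> agree_on T \<nu> \<mu>))"
    by (rule maximal_strong_solution_exists[OF K assms(1,4) sq local_existence[OF K assms(1,4) sq]])
qed

end
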